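(* Let $\Gamma$ be a cancelation monoid, let $A=\bigoplus_{\gamma\in\Gamma}A_\gamma$ be a $\Gamma$-graded local ring with maximal graded ideal $\mathfrak{M}$. Every finitely generated $\Gamma$-graded $A$-module $M$ has the following two properties. (i) The graded submodule $\mathfrak{M}M$ of $M$ is gr-superfluous. (ii) Up to a graded isomorphism, $M$ has a unique gr-projective cover.
   Context: Rings are associative with identity $1$, not necessarily commutative; modules are unitary left modules. A cancelation monoid is a (not necessarily commutative) monoid with neutral element $e$ satisfying the left and right cancelation laws. A $\Gamma$-graded ring is a ring $A=\bigoplus_{\gamma\in\Gamma}A_\gamma$ (additive subgroups) with $A_{\gamma_1}A_{\gamma_2}\subseteq A_{\gamma_1\gamma_2}$; a $\Gamma$-graded $A$-module is a module $M=\bigoplus_{\gamma\in\Gamma}M_\gamma$ (additive subgroups) with $A_{\gamma_1}M_{\gamma_2}\subseteq M_{\gamma_1\gamma_2}$. Homogeneous elements are the nonzero elements of the components; a graded submodule (ideal) is one generated by homogeneous elements; a graded homomorphism $\varphi:M\to N$ is an $A$-homomorphism with $\varphi(M_\gamma)\subseteq N_\gamma$ for all $\gamma$. A $\Gamma$-graded local ring is a $\Gamma$-graded ring $A$ whose degree-$e$ part $A_e$ is a local ring (it has a unique maximal left ideal, which is also its unique maximal right and two-sided ideal); its maximal graded ideal $\mathfrak{M}$ is the two-sided ideal generated by all non-invertible homogeneous elements, which is the unique maximal graded (left, right and two-sided) ideal of $A$. A graded submodule $N$ of $M$ is gr-superfluous if, whenever $H$ is a graded submodule of $M$ with $H+N=M$,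 then $H=M$. A gr-projective cover of $M$ is a graded epimorphism $\varepsilon:P\to M$ with $P$ a $\Gamma$-graded $A$-module that is projective and with $\operatorname{Ker}\varepsilon$ gr-superfluous in $P$. Two gr-projective covers $\varepsilon_1:P_1\to M$, $\varepsilon_2:P_2\to M$ are isomorphic if there is a graded isomorphism $\varphi:P_1\to P_2$ with $\varepsilon_2\varphi=\varepsilon_1$. *)

theory Defs
  imports "HOL-Algebra.Module" "HOL-Algebra.Ideal" "HOL-Algebra.Divisibility"
begin

section \<open>Left modules over not necessarily commutative rings\<close>

text \<open>The library locale \<^locale>\<open>module\<close> requires a commutative ring; this is the same list of
  axioms over a \<^locale>\<open>ring\<close>.  The multiplication and unit fields that the record inherits
  from rings play no role.\<close>

locale left_module = R?: ring R + M?: abelian_group M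
  for R :: "('a, 'r) ring_scheme" and M :: "('a, 'm, 's) module_scheme" +
  assumes smult_closed [simp, intro]:
      "\<lbrakk>a \<in> carrier R; x \<in> carrier M\<rbrakk> \<Longrightarrow> a \<odot>\<^bsub>M\<^esub> x \<in> carrier M"
    and smult_l_distr:
      "\<lbrakk>a \<in> carrier R; b \<in> carrier R; x \<in> carrier M\<rbrakk> \<Longrightarrow>
        (a \<oplus>\<^bsub>R\<^esub> b) \<odot>\<^bsub>M\<^esub> x = a \<odot>\<^bsub>M\<^esub> x \<oplus>\<^bsub>M\<^esub> b \<odot>\<^bsub>M\<^esub> x"
    and smult_r_distr:
      "\<lbrakk>a \<in> carrier R; x \<in> carrier M; y \<in> carrier M\<rbrakk> \<Longrightarrow>
        a \<odot>\<^bsub>M\<^esub> (x \<oplus>\<^bsub>M\<^esub> y) = a \<odot>\<^bsub>M\<^esub> x \<oplus>\<^bsub>M\<^esub> a \<odot>\<^bsub>M\<^esub> y"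
    and smult_assoc:
      "\<lbrakk>a \<in> carrier R; b \<in> carrier R; x \<in> carrier M\<rbrakk> \<Longrightarrow>
        (a \<otimes>\<^bsub>R\<^esub> b) \<odot>\<^bsub>M\<^esub> x = a \<odot>\<^bsub>M\<^esub> (b \<odot>\<^bsub>M\<^esub> x)"
    and smult_one [simp]: "x \<in> carrier M \<Longrightarrow> \<one>\<^bsub>R\<^esub> \<odot>\<^bsub>M\<^esub> x = x"

definition submodule_gen ::
  "('a, 'r) ring_scheme \<Rightarrow> ('a, 'm, 's) module_scheme \<Rightarrow> 'm set \<Rightarrow> 'm set"
  where "submodule_gen R M S = \<Inter>{H. submodule H R M \<and> S \<subseteq> H}"

definition fin_gen_module :: "('a, 'r) ring_scheme \<Rightarrow> ('a, 'm, 's) module_scheme \<Rightarrow> bool"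
  where "fin_gen_module R M \<longleftrightarrow>
    (\<exists>S. finite S \<and> S \<subseteq> carrier M \<and> submodule_gen R M S = carrier M)"

definition ideal_smult ::
  "('a, 'r) ring_scheme \<Rightarrow> 'a set \<Rightarrow> ('a, 'm, 's) module_scheme \<Rightarrow> 'm set"
  where "ideal_smult R I M = submodule_gen R M {a \<odot>\<^bsub>M\<^esub> x | a x. a \<in> I \<and> x \<in> carrier M}"

definition mod_hom ::
  "('a, 'r) ring_scheme \<Rightarrow> ('a, 'm, 's) module_scheme \<Rightarrow> ('a, 'n, 't) module_scheme \<Rightarrow> ('m \<Rightarrow> 'n) set"
  where "mod_hom R M N = {f \<in> hom (add_monoid M) (add_monoid N).
    \<forall>a\<in>carrier R. \<forall>x\<in>carrier M. f (a \<odot>\<^bsub>M\<^esub> x) = a \<odot>\<^bsub>N\<^esub> f x}"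

text \<open>The lifting property.  A definition cannot quantify over types, so the test modules
  are taken on the two types \<open>'p \<Rightarrow> 'a\<close> and \<open>'p\<close>, which accommodate the canonical epimorphism
  onto \<open>P\<close> from the free module on \<open>carrier P\<close>.  This is no restriction: lemma
  \<open>projective_module_lift\<close> below derives the lifting property for modules on arbitrary types.\<close>

definition projective_module :: "('a, 'r) ring_scheme \<Rightarrow> ('a, 'p) module \<Rightarrow> bool"
  where "projective_module R P \<longleftrightarrow> left_module R P \<and>
    (\<forall>(N :: ('a, 'p \<Rightarrow> 'a) module) (L :: ('a, 'p) module) g f.
      left_module R N \<and> left_module R L \<and>
      g \<in> mod_hom R N L \<and> g ` carrier N = carrier L \<and> f \<in> mod_hom R P L \<longrightarrow>
      (\<exists>h\<in>mod_hom R P N. \<forall>x\<in>carrier P. g (h x) = f x))"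


section \<open>Local rings\<close>

definition left_ideal :: "'a set \<Rightarrow> ('a, 'r) ring_scheme \<Rightarrow> bool"
  where "left_ideal I R \<longleftrightarrow> additive_subgroup I R \<and>
    (\<forall>a\<in>carrier R. \<forall>x\<in>I. a \<otimes>\<^bsub>R\<^esub> x \<in> I)"

definition maximal_left_ideal :: "'a set \<Rightarrow> ('a, 'r) ring_scheme \<Rightarrow> bool"
  where "maximal_left_ideal I R \<longleftrightarrow> left_ideal I R \<and> I \<noteq> carrier R \<and>
    (\<forall>J. left_ideal J R \<and> I \<subseteq> J \<longrightarrow> J = I \<or> J = carrier R)"

definition local_ring :: "('a, 'r) ring_scheme \<Rightarrow> bool"
  where "local_ring R \<longleftrightarrow> ring R \<and> (\<exists>!I. maximal_left_ideal I R)"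


section \<open>Graded rings and modules\<close>

definition internal_direct_sum ::
  "'g set \<Rightarrow> ('g \<Rightarrow> 'm set) \<Rightarrow> ('m, 's) ring_scheme \<Rightarrow> bool"
  where "internal_direct_sum I D M \<longleftrightarrow> (\<forall>i\<in>I. additive_subgroup (D i) M) \<and>
    (\<forall>x\<in>carrier M. \<exists>!f. f \<in> (\<Pi>\<^sub>E i\<in>I. D i) \<and> finite {i \<in> I. f i \<noteq> \<zero>\<^bsub>M\<^esub>} \<and>
       x = finsum M f {i \<in> I. f i \<noteq> \<zero>\<^bsub>M\<^esub>})"

locale graded_ring = monoid G + ring R
  for G :: "('g, 'h) monoid_scheme" and R :: "('a, 'r) ring_scheme" and \<A> :: "'g \<Rightarrow> 'a set" +
  assumes ring_direct_sum: "internal_direct_sum (carrier G) \<A> R"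
    and ring_degree: "\<lbrakk>\<gamma> \<in> carrier G; \<delta> \<in> carrier G; a \<in> \<A> \<gamma>; b \<in> \<A> \<delta>\<rbrakk> \<Longrightarrow>
      a \<otimes>\<^bsub>R\<^esub> b \<in> \<A> (\<gamma> \<otimes>\<^bsub>G\<^esub> \<delta>)"

locale graded_module = graded_ring G R \<A> + left_module R M
  for G :: "('g, 'h) monoid_scheme" and R :: "('a, 'r) ring_scheme" and \<A> :: "'g \<Rightarrow> 'a set"
    and M :: "('a, 'm, 's) module_scheme" and \<M> :: "'g \<Rightarrow> 'm set" +
  assumes module_direct_sum: "internal_direct_sum (carrier G) \<M> M"
    and module_degree: "\<lbrakk>\<gamma> \<in> carrier G; \<delta> \<in> carrier G; a \<in> \<A> \<gamma>; x \<in> \<M> \<delta>\<rbrakk> \<Longrightarrow>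
      a \<odot>\<^bsub>M\<^esub> x \<in> \<M> (\<gamma> \<otimes>\<^bsub>G\<^esub> \<delta>)"

definition homogeneous ::
  "('g, 'h) monoid_scheme \<Rightarrow> ('m, 's) ring_scheme \<Rightarrow> ('g \<Rightarrow> 'm set) \<Rightarrow> 'm set"
  where "homogeneous G M \<M> = (\<Union>\<gamma>\<in>carrier G. \<M> \<gamma>) - {\<zero>\<^bsub>M\<^esub>}"

locale graded_local_ring = graded_ring +
  assumes local_ring_degree_one: "local_ring (R\<lparr>carrier := \<A> \<one>\<^bsub>G\<^esub>\<rparr>)"

definition max_graded_ideal ::
  "('g, 'h) monoid_scheme \<Rightarrow> ('a, 'r) ring_scheme \<Rightarrow> ('g \<Rightarrow> 'a set) \<Rightarrow> 'a set"
  where "max_graded_ideal G R \<A> = Idl\<^bsub>R\<^esub> (homogeneous G R \<A> - Units R)"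

definition graded_submodule ::
  "('g, 'h) monoid_scheme \<Rightarrow> ('a, 'r) ring_scheme \<Rightarrow> ('a, 'm, 's) module_scheme \<Rightarrow>
    ('g \<Rightarrow> 'm set) \<Rightarrow> 'm set \<Rightarrow> bool"
  where "graded_submodule G R M \<M> N \<longleftrightarrow> (\<exists>S \<subseteq> homogeneous G M \<M>. N = submodule_gen R M S)"

definition gr_superfluous ::
  "('g, 'h) monoid_scheme \<Rightarrow> ('a, 'r) ring_scheme \<Rightarrow> ('a, 'm, 's) module_scheme \<Rightarrow>
    ('g \<Rightarrow> 'm set) \<Rightarrow> 'm set \<Rightarrow> bool"
  where "gr_superfluous G R M \<M> N \<longleftrightarrow> graded_submodule G R M \<M> N \<and>
    (\<forall>H. graded_submodule G R M \<M> H \<and> H <+>\<^bsub>M\<^esub> N = carrier M \<longrightarrow> H = carrier M)"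

definition graded_hom ::
  "('g, 'h) monoid_scheme \<Rightarrow> ('a, 'r) ring_scheme \<Rightarrow>
    ('a, 'm, 's) module_scheme \<Rightarrow> ('g \<Rightarrow> 'm set) \<Rightarrow>
    ('a, 'n, 't) module_scheme \<Rightarrow> ('g \<Rightarrow> 'n set) \<Rightarrow> ('m \<Rightarrow> 'n) set"
  where "graded_hom G R M \<M> N \<N> = {f \<in> mod_hom R M N. \<forall>\<gamma>\<in>carrier G. f ` \<M> \<gamma> \<subseteq> \<N> \<gamma>}"

text \<open>The inverse of a bijective graded homomorphism between graded modules is automatically
  graded.\<close>

definition graded_iso ::
  "('g, 'h) monoid_scheme \<Rightarrow> ('a, 'r) ring_scheme \<Rightarrow>
    ('a, 'm, 's) module_scheme \<Rightarrow> ('g \<Rightarrow> 'm set) \<Rightarrow>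
    ('a, 'n, 't) module_scheme \<Rightarrow> ('g \<Rightarrow> 'n set) \<Rightarrow> ('m \<Rightarrow> 'n) set"
  where "graded_iso G R M \<M> N \<N> =
    {f \<in> graded_hom G R M \<M> N \<N>. bij_betw f (carrier M) (carrier N)}"

text \<open>The existence of a cover of a finitely generated module has to be claimed on a specific type;
  \<open>nat \<Rightarrow> 'a\<close> contains the finite direct sums of (degree-shifted) copies of the ring.\<close>

definition gr_projective_cover ::
  "('g, 'h) monoid_scheme \<Rightarrow> ('a, 'r) ring_scheme \<Rightarrow> ('g \<Rightarrow> 'a set) \<Rightarrow>
    ('a, 'm, 's) module_scheme \<Rightarrow> ('g \<Rightarrow> 'm set) \<Rightarrow>
    ('a, 'p) module \<Rightarrow> ('g \<Rightarrow> 'p set) \<Rightarrow> ('p \<Rightarrow> 'm) \<Rightarrow> bool"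
  where "gr_projective_cover G R \<A> M \<M> P \<P> \<epsilon> \<longleftrightarrow>
    graded_module G R \<A> P \<P> \<and> projective_module R P \<and>
    \<epsilon> \<in> graded_hom G R P \<P> M \<M> \<and> \<epsilon> ` carrier P = carrier M \<and>
    gr_superfluous G R P \<P> (a_kernel P M \<epsilon>)"

definition gr_cover_isomorphic ::
  "('g, 'h) monoid_scheme \<Rightarrow> ('a, 'r) ring_scheme \<Rightarrow>
    ('a, 'p, 's) module_scheme \<Rightarrow> ('g \<Rightarrow> 'p set) \<Rightarrow> ('p \<Rightarrow> 'm) \<Rightarrow>
    ('a, 'q, 't) module_scheme \<Rightarrow> ('g \<Rightarrow> 'q set) \<Rightarrow> ('q \<Rightarrow> 'm) \<Rightarrow> bool"
  where "gr_cover_isomorphic G R P\<^sub>1 \<P>\<^sub>1 \<epsilon>\<^sub>1 P\<^sub>2 \<P>\<^sub>2 \<epsilon>\<^sub>2 \<longleftrightarrow>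
    (\<exists>\<phi>\<in>graded_iso G R P\<^sub>1 \<P>\<^sub>1 P\<^sub>2 \<P>\<^sub>2. \<forall>x\<in>carrier P\<^sub>1. \<epsilon>\<^sub>2 (\<phi> x) = \<epsilon>\<^sub>1 x)"


section \<open>Projectivity does not depend on the types of the test modules\<close>

lemma mod_homD:
  assumes "f \<in> mod_hom R M N"
  shows "x \<in> carrier M \<Longrightarrow> f x \<in> carrier N"
    and "x \<in> carrier M \<Longrightarrow> y \<in> carrier M \<Longrightarrow> f (x \<oplus>\<^bsub>M\<^esub> y) = f x \<oplus>\<^bsub>N\<^esub> f y"
    and "a \<in> carrier R \<Longrightarrow> x \<in> carrier M \<Longrightarrow> f (a \<odot>\<^bsub>M\<^esub> x) = a \<odot>\<^bsub>N\<^esub> f x"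
  using assms by (auto simp: mod_hom_def hom_def)

lemma mod_homI:
  assumes "\<And>x. x \<in> carrier M \<Longrightarrow> f x \<in> carrier N"
    and "\<And>x y. x \<in> carrier M \<Longrightarrow> y \<in> carrier M \<Longrightarrow> f (x \<oplus>\<^bsub>M\<^esub> y) = f x \<oplus>\<^bsub>N\<^esub> f y"
    and "\<And>a x. a \<in> carrier R \<Longrightarrow> x \<in> carrier M \<Longrightarrow> f (a \<odot>\<^bsub>M\<^esub> x) = a \<odot>\<^bsub>N\<^esub> f x"
  shows "f \<in> mod_hom R M N"
  using assms by (auto simp: mod_hom_def hom_def)

context left_module
begin

lemma smult_l_null [simp]:
  assumes "x \<in> carrier M" shows "\<zero>\<^bsub>R\<^esub> \<odot>\<^bsub>M\<^esub> x = \<zero>\<^bsub>M\<^esub>"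
proof -
  have "\<zero>\<^bsub>R\<^esub> \<odot>\<^bsub>M\<^esub> x \<oplus>\<^bsub>M\<^esub> \<zero>\<^bsub>R\<^esub> \<odot>\<^bsub>M\<^esub> x = \<zero>\<^bsub>R\<^esub> \<odot>\<^bsub>M\<^esub> x"
    using smult_l_distr[of "\<zero>\<^bsub>R\<^esub>" "\<zero>\<^bsub>R\<^esub>" x] assms by simp
  then show ?thesis using assms by (metis M.add.r_cancel_one' smult_closed R.zero_closed)
qed

lemma smult_r_null [simp]:
  assumes "a \<in> carrier R" shows "a \<odot>\<^bsub>M\<^esub> \<zero>\<^bsub>M\<^esub> = \<zero>\<^bsub>M\<^esub>"
proof -
  have "a \<odot>\<^bsub>M\<^esub> \<zero>\<^bsub>M\<^esub> \<oplus>\<^bsub>M\<^esub> a \<odot>\<^bsub>M\<^esub> \<zero>\<^bsub>M\<^esub> = a \<odot>\<^bsub>M\<^esub> \<zero>\<^bsub>M\<^esub>"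
    using smult_r_distr[of a "\<zero>\<^bsub>M\<^esub>" "\<zero>\<^bsub>M\<^esub>"] assms by simp
  then show ?thesis using assms by (metis M.add.r_cancel_one' smult_closed M.zero_closed)
qed

lemma smult_finsum:
  assumes "finite I" "a \<in> carrier R" "\<And>i. i \<in> I \<Longrightarrow> f i \<in> carrier M"
  shows "a \<odot>\<^bsub>M\<^esub> finsum M f I = finsum M (\<lambda>i. a \<odot>\<^bsub>M\<^esub> f i) I"
  using assms(1,3)
proof (induction I)
  case empty
  then show ?case using assms(2) by simp
next
  case (insert i I)
  then have "finsum M f I \<in> carrier M" by (intro M.finsum_closed) auto
  moreover have "finsum M f (insert i I) = f i \<oplus>\<^bsub>M\<^esub> finsum M f I"
    using insert by (intro M.finsum_insert) auto
  moreover have "finsum M (\<lambda>i. a \<odot>\<^bsub>M\<^esub> f i) (insert i I)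
      = a \<odot>\<^bsub>M\<^esub> f i \<oplus>\<^bsub>M\<^esub> finsum M (\<lambda>i. a \<odot>\<^bsub>M\<^esub> f i) I"
    using insert assms(2) by (intro M.finsum_insert) auto
  ultimately show ?case using insert assms(2) by (simp add: smult_r_distr)
qed

end

lemma mod_hom_zero:
  assumes "left_module R M" "left_module R N" "f \<in> mod_hom R M N"
  shows "f \<zero>\<^bsub>M\<^esub> = \<zero>\<^bsub>N\<^esub>"
proof -
  interpret M: left_module R M by fact
  interpret N: left_module R N by fact
  have "f (\<zero>\<^bsub>R\<^esub> \<odot>\<^bsub>M\<^esub> \<zero>\<^bsub>M\<^esub>) = \<zero>\<^bsub>R\<^esub> \<odot>\<^bsub>N\<^esub> f \<zero>\<^bsub>M\<^esub>"
    by (intro mod_homD(3)[OF assms(3)]) auto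
  then show ?thesis using mod_homD(1)[OF assms(3)] by simp
qed

lemma mod_hom_finsum:
  assumes "left_module R M" "left_module R N" "f \<in> mod_hom R M N"
    and "finite I" "\<And>i. i \<in> I \<Longrightarrow> x i \<in> carrier M"
  shows "f (finsum M x I) = finsum N (\<lambda>i. f (x i)) I"
  using assms(4,5)
proof (induction I)
  case empty
  interpret M: left_module R M by fact
  interpret N: left_module R N by fact
  show ?case using mod_hom_zero[OF assms(1-3)] by simp
next
  case (insert i I)
  interpret M: left_module R M by fact
  interpret N: left_module R N by fact
  have "finsum M x I \<in> carrier M" using insert by (intro M.finsum_closed) auto
  moreover have "finsum M x (insert i I) = x i \<oplus>\<^bsub>M\<^esub> finsum M x I"
    using insert by (intro M.finsum_insert) auto
  moreover have "finsum N (\<lambda>i. f (x i)) (insert i I) = f (x i) \<oplus>\<^bsub>N\<^esub> finsum N (\<lambda>i. f (x i)) I"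
    using insert mod_homD(1)[OF assms(3)] by (intro N.finsum_insert) auto
  ultimately show ?case using insert mod_homD(2)[OF assms(3)] by simp
qed

definition free_module :: "('a, 'r) ring_scheme \<Rightarrow> 'x set \<Rightarrow> ('a, 'x \<Rightarrow> 'a) module"
  where "free_module R B =
    \<lparr>carrier = {c. (\<forall>x. c x \<in> carrier R) \<and> finite {x. c x \<noteq> \<zero>\<^bsub>R\<^esub>} \<and> {x. c x \<noteq> \<zero>\<^bsub>R\<^esub>} \<subseteq> B},
     monoid.mult = undefined, one = undefined,
     zero = (\<lambda>_. \<zero>\<^bsub>R\<^esub>), add = (\<lambda>c d x. c x \<oplus>\<^bsub>R\<^esub> d x), smult = (\<lambda>a c x. a \<otimes>\<^bsub>R\<^esub> c x)\<rparr>"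

lemma free_module_left_module:
  assumes "ring R"
  shows "left_module R (free_module R B)"
proof -
  interpret ring R by fact
  let ?F = "free_module R B"
  have add: "(\<lambda>x. c x \<oplus>\<^bsub>R\<^esub> d x) \<in> carrier ?F" if "c \<in> carrier ?F" "d \<in> carrier ?F" for c d
  proof -
    have "{x. c x \<oplus>\<^bsub>R\<^esub> d x \<noteq> \<zero>\<^bsub>R\<^esub>} \<subseteq> {x. c x \<noteq> \<zero>\<^bsub>R\<^esub>} \<union> {x. d x \<noteq> \<zero>\<^bsub>R\<^esub>}" by auto
    with that show ?thesis by (auto simp: free_module_def elim: finite_subset)
  qed
  have smult: "(\<lambda>x. a \<otimes>\<^bsub>R\<^esub> c x) \<in> carrier ?F" if "a \<in> carrier R" "c \<in> carrier ?F" for a c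
  proof -
    have "{x. a \<otimes>\<^bsub>R\<^esub> c x \<noteq> \<zero>\<^bsub>R\<^esub>} \<subseteq> {x. c x \<noteq> \<zero>\<^bsub>R\<^esub>}" using that by auto
    with that show ?thesis by (auto simp: free_module_def elim: finite_subset)
  qed
  have neg: "(\<lambda>x. \<ominus>\<^bsub>R\<^esub> c x) \<in> carrier ?F" if "c \<in> carrier ?F" for c
  proof -
    have "{x. \<ominus>\<^bsub>R\<^esub> c x \<noteq> \<zero>\<^bsub>R\<^esub>} \<subseteq> {x. c x \<noteq> \<zero>\<^bsub>R\<^esub>}" by auto
    with that show ?thesis by (auto simp: free_module_def elim: finite_subset)
  qed
  have "abelian_group ?F"
  proof (rule abelian_groupI)
    fix c assume c: "c \<in> carrier ?F"
    show "\<exists>d\<in>carrier ?F. d \<oplus>\<^bsub>?F\<^esub> c = \<zero>\<^bsub>?F\<^esub>"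
      using neg[OF c] c by (intro bexI[of _ "\<lambda>x. \<ominus>\<^bsub>R\<^esub> c x"]) (auto simp: free_module_def l_neg)
  next
    fix c d e assume "c \<in> carrier ?F" "d \<in> carrier ?F" "e \<in> carrier ?F"
    then show "c \<oplus>\<^bsub>?F\<^esub> d \<oplus>\<^bsub>?F\<^esub> e = c \<oplus>\<^bsub>?F\<^esub> (d \<oplus>\<^bsub>?F\<^esub> e)"
      by (simp add: free_module_def a_assoc)
  next
    fix c d assume "c \<in> carrier ?F" "d \<in> carrier ?F"
    then show "c \<oplus>\<^bsub>?F\<^esub> d = d \<oplus>\<^bsub>?F\<^esub> c"
      by (simp add: free_module_def a_comm)
  qed (use add in \<open>auto simp: free_module_def\<close>)
  then show ?thesis
    using smult
    by (intro left_module.intro left_module_axioms.intro)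
       (auto simp: free_module_def l_distr r_distr m_assoc fun_eq_iff assms)
qed

definition free_eval :: "('a, 'r) ring_scheme \<Rightarrow> ('a, 'n, 't) module_scheme \<Rightarrow> ('x \<Rightarrow> 'n) \<Rightarrow> ('x \<Rightarrow> 'a) \<Rightarrow> 'n"
  where "free_eval R N n c = finsum N (\<lambda>x. c x \<odot>\<^bsub>N\<^esub> n x) {x. c x \<noteq> \<zero>\<^bsub>R\<^esub>}"

lemma free_eval_superset:
  assumes "left_module R N" "\<And>x. x \<in> B \<Longrightarrow> n x \<in> carrier N"
    and "\<And>x. c x \<in> carrier R" "finite Y" "Y \<subseteq> B" "{x. c x \<noteq> \<zero>\<^bsub>R\<^esub>} \<subseteq> Y"
  shows "free_eval R N n c = finsum N (\<lambda>x. c x \<odot>\<^bsub>N\<^esub> n x) Y"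
proof -
  interpret left_module R N by fact
  show ?thesis unfolding free_eval_def
    using assms by (intro M.add.finprod_mono_neutral_cong_left) auto
qed

lemma free_eval_mod_hom:
  assumes "left_module R N" "\<And>x. x \<in> B \<Longrightarrow> n x \<in> carrier N"
  shows "free_eval R N n \<in> mod_hom R (free_module R B) N"
proof (rule mod_homI)
  interpret left_module R N by fact
  fix c assume c: "c \<in> carrier (free_module R B)"
  then show "free_eval R N n c \<in> carrier N"
    unfolding free_eval_def using assms(2)
    by (intro M.finsum_closed) (auto simp: free_module_def)
  have cR: "\<And>x. c x \<in> carrier R" and cf: "finite {x. c x \<noteq> \<zero>\<^bsub>R\<^esub>}" and cX: "{x. c x \<noteq> \<zero>\<^bsub>R\<^esub>} \<subseteq> B"
    using c by (auto simp: free_module_def)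
  {
    fix d assume d: "d \<in> carrier (free_module R B)"
    have dR: "\<And>x. d x \<in> carrier R" and df: "finite {x. d x \<noteq> \<zero>\<^bsub>R\<^esub>}" and dX: "{x. d x \<noteq> \<zero>\<^bsub>R\<^esub>} \<subseteq> B"
      using d by (auto simp: free_module_def)
    let ?Y = "{x. c x \<noteq> \<zero>\<^bsub>R\<^esub>} \<union> {x. d x \<noteq> \<zero>\<^bsub>R\<^esub>}"
    have Y: "finite ?Y" "?Y \<subseteq> B" using cf df cX dX by auto
    have ev: "free_eval R N n e = finsum N (\<lambda>x. e x \<odot>\<^bsub>N\<^esub> n x) ?Y"
      if "\<And>x. e x \<in> carrier R" "{x. e x \<noteq> \<zero>\<^bsub>R\<^esub>} \<subseteq> ?Y" for e
      by (rule free_eval_superset[OF assms(1), of B]) (use that Y assms(2) in auto)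
    have "free_eval R N n (\<lambda>x. c x \<oplus>\<^bsub>R\<^esub> d x) = finsum N (\<lambda>x. (c x \<oplus>\<^bsub>R\<^esub> d x) \<odot>\<^bsub>N\<^esub> n x) ?Y"
      using cR dR by (intro ev) auto
    also have "\<dots> = finsum N (\<lambda>x. c x \<odot>\<^bsub>N\<^esub> n x \<oplus>\<^bsub>N\<^esub> d x \<odot>\<^bsub>N\<^esub> n x) ?Y"
      using cR dR Y assms(2) by (intro M.finsum_cong') (auto simp: smult_l_distr subset_iff)
    also have "\<dots> = finsum N (\<lambda>x. c x \<odot>\<^bsub>N\<^esub> n x) ?Y \<oplus>\<^bsub>N\<^esub> finsum N (\<lambda>x. d x \<odot>\<^bsub>N\<^esub> n x) ?Y"
      using cR dR Y assms(2) by (intro M.finsum_addf) (auto simp: subset_iff)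
    also have "\<dots> = free_eval R N n c \<oplus>\<^bsub>N\<^esub> free_eval R N n d"
      by (simp add: ev[OF cR] ev[OF dR])
    finally show "free_eval R N n (c \<oplus>\<^bsub>free_module R B\<^esub> d)
        = free_eval R N n c \<oplus>\<^bsub>N\<^esub> free_eval R N n d"
      by (simp add: free_module_def)
  }
  fix a assume a: "a \<in> carrier R"
  have "free_eval R N n (\<lambda>x. a \<otimes>\<^bsub>R\<^esub> c x)
      = finsum N (\<lambda>x. (a \<otimes>\<^bsub>R\<^esub> c x) \<odot>\<^bsub>N\<^esub> n x) {x. c x \<noteq> \<zero>\<^bsub>R\<^esub>}"
    using a cR cf cX by (intro free_eval_superset[OF assms]) auto
  also have "\<dots> = finsum N (\<lambda>x. a \<odot>\<^bsub>N\<^esub> (c x \<odot>\<^bsub>N\<^esub> n x)) {x. c x \<noteq> \<zero>\<^bsub>R\<^esub>}"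
    using a cR cX assms(2) by (intro M.finsum_cong') (auto simp: smult_assoc subset_iff)
  also have "\<dots> = a \<odot>\<^bsub>N\<^esub> free_eval R N n c"
    unfolding free_eval_def using a cR cf cX assms(2)
    by (intro smult_finsum[symmetric]) (auto simp: subset_iff)
  finally show "free_eval R N n (a \<odot>\<^bsub>free_module R B\<^esub> c) = a \<odot>\<^bsub>N\<^esub> free_eval R N n c"
    by (simp add: free_module_def)
qed

lemma projective_module_lift:
  fixes P :: "('a, 'p) module" and N :: "('a, 'n, 's) module_scheme"
    and L :: "('a, 'l, 't) module_scheme"
  assumes P: "projective_module R P" and N: "left_module R N" and L: "left_module R L"
    and g: "g \<in> mod_hom R N L" "g ` carrier N = carrier L" and f: "f \<in> mod_hom R P L"
  shows "\<exists>h\<in>mod_hom R P N. \<forall>x\<in>carrier P. g (h x) = f x"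
proof -
  have modP: "left_module R P" using P by (simp add: projective_module_def)
  interpret P: left_module R P by fact
  interpret N: left_module R N by fact
  interpret L: left_module R L by fact
  let ?F = "free_module R (carrier P)"
  have modF: "left_module R ?F" using P.R.ring_axioms by (rule free_module_left_module)
  let ?e = "free_eval R P (\<lambda>x. x)"
  have e: "?e \<in> mod_hom R ?F P" using modP by (rule free_eval_mod_hom)
  have "x \<in> ?e ` carrier ?F" if x: "x \<in> carrier P" for x
  proof
    let ?d = "\<lambda>y. if y = x then \<one>\<^bsub>R\<^esub> else \<zero>\<^bsub>R\<^esub>"
    have sub: "{y. ?d y \<noteq> \<zero>\<^bsub>R\<^esub>} \<subseteq> {x}" by auto
    then show "?d \<in> carrier ?F" using x by (auto simp: free_module_def elim: finite_subset)
    have "?e ?d = finsum P (\<lambda>y. ?d y \<odot>\<^bsub>P\<^esub> y) {x}"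
      using x sub by (intro free_eval_superset[OF modP, of "carrier P"]) auto
    then show "x = ?e ?d" using x by simp
  qed
  then have "?e ` carrier ?F = carrier P" using mod_homD(1)[OF e] by blast
  moreover have "(\<lambda>x. x) \<in> mod_hom R P P" by (intro mod_homI) auto
  ultimately obtain s where s: "s \<in> mod_hom R P ?F" "\<forall>x\<in>carrier P. ?e (s x) = x"
    using P modP modF e unfolding projective_module_def by metis
  have "\<forall>y\<in>carrier P. \<exists>z\<in>carrier N. g z = f y"
    using g(2) mod_homD(1)[OF f] by (metis imageE)
  then obtain n where n: "\<And>y. y \<in> carrier P \<Longrightarrow> n y \<in> carrier N"
      "\<And>y. y \<in> carrier P \<Longrightarrow> g (n y) = f y" by metis
  have E: "free_eval R N n \<in> mod_hom R ?F N" using N n(1) by (rule free_eval_mod_hom)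
  let ?h = "\<lambda>x. free_eval R N n (s x)"
  have "?h \<in> mod_hom R P N"
    using mod_homD[OF E] mod_homD[OF s(1)] by (intro mod_homI) auto
  moreover have "g (?h x) = f x" if x: "x \<in> carrier P" for x
  proof -
    have sx: "s x \<in> carrier ?F" using mod_homD(1)[OF s(1)] x .
    let ?S = "{y. s x y \<noteq> \<zero>\<^bsub>R\<^esub>}"
    have S: "finite ?S" "?S \<subseteq> carrier P" "\<And>y. s x y \<in> carrier R"
      using sx by (auto simp: free_module_def)
    have "g (?h x) = finsum L (\<lambda>y. g (s x y \<odot>\<^bsub>N\<^esub> n y)) ?S"
      unfolding free_eval_def using S n by (intro mod_hom_finsum[OF N L g(1)]) auto
    also have "\<dots> = finsum L (\<lambda>y. f (s x y \<odot>\<^bsub>P\<^esub> y)) ?S"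
    proof (rule L.M.finsum_cong')
      fix y assume "y \<in> ?S"
      then have y: "y \<in> carrier P" using S(2) by blast
      show "g (s x y \<odot>\<^bsub>N\<^esub> n y) = f (s x y \<odot>\<^bsub>P\<^esub> y)"
        by (simp add: mod_homD(3)[OF g(1)] mod_homD(3)[OF f] S(3) n y)
    qed (use S mod_homD(1)[OF f] in auto)
    also have "\<dots> = f (?e (s x))"
      unfolding free_eval_def using S by (intro mod_hom_finsum[OF modP L f, symmetric]) auto
    also have "\<dots> = f x" using s(2) x by simp
    finally show ?thesis .
  qed
  ultimately show ?thesis by (intro bexI[of _ ?h]) auto
qed

end

theory Submission
  imports Defs
begin

text \<open>Homogeneous non-units of a given degree are closed under addition, because left-invertible
  homogeneous elements are units and the part of degree \<open>e\<close> is local; hence the maximal graded ideal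
  consists of the elements all of whose components are non-units.  Together with right cancelation
  this yields a graded Nakayama lemma, proved one homogeneous generator at a time.  For an
  irredundant family of homogeneous generators the canonical map from the graded free module has
  its kernel inside the maximal graded ideal times the free module, so it is a projective cover.
  For uniqueness, a lift between two covers can be made graded by left cancelation; it is onto, and
  so is a graded right inverse of it, by superfluity of the two kernels.\<close>


section \<open>Local rings\<close>

text \<open>The obstacle is the bookkeeping of degrees, since \<Gamma> is neither a group nor
  commutative. Multiplication by a homogeneous element carries components along a translate of
  \<Gamma>. Cancelation makes the translate injective, so components are moved without being merged;
  but it need not be onto, so each component formula has a second clause for the degrees that are
  missed. Locality is a statement about the single degree e. It governs all degrees because a
  homogeneous left inverse in degree \<delta> of an element of degree \<gamma> satisfies
  \<delta>\<gamma> = e, and cancelation then forces \<gamma>\<delta> = e, so both products can be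
  studied in degree e. Superfluity tests graded submodules only. Hence every image to which it is
  applied has to be graded, and the ungraded lifts that projectivity provides cannot be used as they
  stand. Irredundance acts through its contrapositive: in a relation between homogeneous generators,
  a coefficient with an invertible component would express its generator by the others.\<close>

lemma left_ideal_eq_carrier:
  assumes "ring R" "left_ideal I R" "\<one>\<^bsub>R\<^esub> \<in> I"
  shows "I = carrier R"
proof -
  interpret ring R by fact
  interpret I: additive_subgroup I R using assms(2) by (simp add: left_ideal_def)
  have "a \<in> I" if "a \<in> carrier R" for a
    using assms(2,3) that r_one[OF that] unfolding left_ideal_def by metis
  then show ?thesis using I.a_subset by blast
qed

text \<open>Zorn's lemma is applied to the left ideals that contain \<open>L\<close> and omit the
  unit. Omitting the unit visibly survives unions of chains, and by
  \<open>left_ideal_eq_carrier\<close> it amounts to being proper.\<close>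

lemma exists_maximal_left_ideal:
  assumes R: "ring R" and L: "left_ideal L R" "\<one>\<^bsub>R\<^esub> \<notin> L"
  shows "\<exists>I. maximal_left_ideal I R \<and> L \<subseteq> I"
proof -
  interpret ring R by fact
  define S where "S = {I. left_ideal I R \<and> L \<subseteq> I \<and> \<one>\<^bsub>R\<^esub> \<notin> I}"
  have "\<exists>I\<in>S. \<forall>X\<in>S. I \<subseteq> X \<longrightarrow> X = I"
  proof (rule subset_Zorn_nonempty)
    show "S \<noteq> {}" using L by (auto simp: S_def)
    fix C assume ne: "C \<noteq> {}" and chain: "subset.chain S C"
    have C: "left_ideal I R" "additive_subgroup I R" "L \<subseteq> I" "\<one>\<^bsub>R\<^esub> \<notin> I" if "I \<in> C" for I
      using chain that unfolding subset_chain_def S_def left_ideal_def by auto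
    have "left_ideal (\<Union>C) R"
      unfolding left_ideal_def
    proof (intro conjI ballI additive_subgroupI add.subgroupI)
      show "\<Union>C \<subseteq> carrier R" using additive_subgroup.a_subset[OF C(2)] by (rule Union_least)
      obtain I where "I \<in> C" using ne by blast
      then show "\<Union>C \<noteq> {}" using additive_subgroup.zero_closed[OF C(2)] by blast
    next
      fix a assume "a \<in> \<Union>C"
      then show "\<ominus>\<^bsub>R\<^esub> a \<in> \<Union>C" using additive_subgroup.a_inv_closed[OF C(2)] by (metis UnionE UnionI)
    next
      fix a b assume "a \<in> \<Union>C" "b \<in> \<Union>C"
      then obtain I J where IJ: "I \<in> C" "J \<in> C" "a \<in> I" "b \<in> J" by blast
      then have "I \<subseteq> J \<or> J \<subseteq> I" using chain by (simp add: subset_chain_def)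
      then obtain K where K: "K \<in> C" "a \<in> K" "b \<in> K" using IJ by (metis subsetD)
      then show "a \<oplus>\<^bsub>R\<^esub> b \<in> \<Union>C" using additive_subgroup.a_closed[OF C(2)] by (metis UnionI)
    next
      fix a x assume "a \<in> carrier R" "x \<in> \<Union>C"
      then show "a \<otimes>\<^bsub>R\<^esub> x \<in> \<Union>C" using C(1) unfolding left_ideal_def by (metis UnionE UnionI)
    qed
    moreover have "L \<subseteq> \<Union>C" "\<one>\<^bsub>R\<^esub> \<notin> \<Union>C" using ne C(3,4) by blast+
    ultimately show "\<Union>C \<in> S" by (simp add: S_def)
  qed
  then obtain I where I: "I \<in> S" "\<And>X. X \<in> S \<Longrightarrow> I \<subseteq> X \<Longrightarrow> X = I" by blast
  have "maximal_left_ideal I R"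
    unfolding maximal_left_ideal_def
  proof (intro conjI allI impI)
    show "left_ideal I R" "I \<noteq> carrier R" using I(1) by (auto simp: S_def)
    fix J assume "left_ideal J R \<and> I \<subseteq> J"
    then show "J = I \<or> J = carrier R"
      using I left_ideal_eq_carrier[OF R, of J] by (auto simp: S_def)
  qed
  then show ?thesis using I(1) by (auto simp: S_def)
qed

lemma principal_left_ideal:
  assumes "ring R" "x \<in> carrier R"
  shows "left_ideal ((\<lambda>a. a \<otimes>\<^bsub>R\<^esub> x) ` carrier R) R"
proof -
  interpret ring R by fact
  have "subgroup ((\<lambda>a. a \<otimes>\<^bsub>R\<^esub> x) ` carrier R) (add_monoid R)"
  proof (rule add.subgroupI)
    fix a assume "a \<in> (\<lambda>a. a \<otimes>\<^bsub>R\<^esub> x) ` carrier R"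
    then show "\<ominus>\<^bsub>R\<^esub> a \<in> (\<lambda>a. a \<otimes>\<^bsub>R\<^esub> x) ` carrier R"
      using assms(2) by (auto simp: l_minus[symmetric])
  next
    fix a b assume "a \<in> (\<lambda>a. a \<otimes>\<^bsub>R\<^esub> x) ` carrier R" "b \<in> (\<lambda>a. a \<otimes>\<^bsub>R\<^esub> x) ` carrier R"
    then show "a \<oplus>\<^bsub>R\<^esub> b \<in> (\<lambda>a. a \<otimes>\<^bsub>R\<^esub> x) ` carrier R"
      using assms(2) by (auto simp: l_distr[symmetric])
  qed (use assms(2) in auto)
  moreover have "a \<otimes>\<^bsub>R\<^esub> y \<in> (\<lambda>a. a \<otimes>\<^bsub>R\<^esub> x) ` carrier R"
    if "a \<in> carrier R" "y \<in> (\<lambda>a. a \<otimes>\<^bsub>R\<^esub> x) ` carrier R" for a y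
    using that assms(2) by (auto simp: m_assoc[symmetric])
  ultimately show ?thesis by (auto simp: left_ideal_def intro!: additive_subgroupI)
qed

text \<open>A maximal left ideal contains zero and, being proper, omits the unit.\<close>

lemma local_ring_one_not_zero:
  assumes "local_ring R" shows "\<one>\<^bsub>R\<^esub> \<noteq> \<zero>\<^bsub>R\<^esub>"
proof
  assume 1: "\<one>\<^bsub>R\<^esub> = \<zero>\<^bsub>R\<^esub>"
  have R: "ring R" using assms by (simp add: local_ring_def)
  obtain J where J: "maximal_left_ideal J R" using assms unfolding local_ring_def by blast
  then have "\<one>\<^bsub>R\<^esub> \<in> J"
    using 1 by (auto simp: maximal_left_ideal_def left_ideal_def additive_subgroup.zero_closed)
  then show False
    using J left_ideal_eq_carrier[OF R] by (auto simp: maximal_left_ideal_def)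
qed

text \<open>Let \<open>J\<close> be the unique maximal left ideal. An element outside
  \<open>J\<close> generates a left ideal that lies in no maximal one, so it is left invertible; its
  left inverse again lies outside \<open>J\<close>, which makes the inverse two-sided. As the unit
  is not in \<open>J\<close>, the two summands cannot both be.\<close>

lemma local_ring_sum_eq_one:
  assumes local: "local_ring R"
    and xy: "x \<in> carrier R" "y \<in> carrier R" "x \<oplus>\<^bsub>R\<^esub> y = \<one>\<^bsub>R\<^esub>"
  shows "x \<in> Units R \<or> y \<in> Units R"
proof -
  have R: "ring R" using local by (simp add: local_ring_def)
  interpret ring R by fact
  obtain J where J: "maximal_left_ideal J R" and uniq: "\<And>I. maximal_left_ideal I R \<Longrightarrow> I = J"
    using local unfolding local_ring_def by blast
  interpret J: additive_subgroup J R using J by (simp add: maximal_left_ideal_def left_ideal_def)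
  have left: "a \<otimes>\<^bsub>R\<^esub> b \<in> J" if "a \<in> carrier R" "b \<in> J" for a b
    using J that by (simp add: maximal_left_ideal_def left_ideal_def)
  have one: "\<one>\<^bsub>R\<^esub> \<notin> J"
    using J left_ideal_eq_carrier[OF R] by (auto simp: maximal_left_ideal_def)
  have linv: "\<exists>b\<in>carrier R. b \<otimes>\<^bsub>R\<^esub> a = \<one>\<^bsub>R\<^esub>" if a: "a \<in> carrier R" "a \<notin> J" for a
  proof (rule ccontr)
    assume "\<not> ?thesis"
    then have "\<one>\<^bsub>R\<^esub> \<notin> (\<lambda>b. b \<otimes>\<^bsub>R\<^esub> a) ` carrier R" by auto
    then obtain I where I: "maximal_left_ideal I R" "(\<lambda>b. b \<otimes>\<^bsub>R\<^esub> a) ` carrier R \<subseteq> I"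
      using exists_maximal_left_ideal[OF R principal_left_ideal[OF R a(1)]] by blast
    have "\<one>\<^bsub>R\<^esub> \<otimes>\<^bsub>R\<^esub> a \<in> (\<lambda>b. b \<otimes>\<^bsub>R\<^esub> a) ` carrier R" by blast
    then show False using I uniq a by auto
  qed
  have unit: "a \<in> Units R" if a: "a \<in> carrier R" "a \<notin> J" for a
  proof -
    obtain b where b: "b \<in> carrier R" "b \<otimes>\<^bsub>R\<^esub> a = \<one>\<^bsub>R\<^esub>" using linv[OF a] by blast
    \<comment> \<open>If b were in \<open>J\<close>, so would be ab, and 1 - ab would lie outside
      \<open>J\<close> with a left inverse z. But (1 - ab)a = a - a(ba) = 0, so multiplying by z
      gives a = 0, an element of \<open>J\<close>.\<close>
    have "b \<notin> J"
    proof
      assume "b \<in> J"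
      then have ab: "a \<otimes>\<^bsub>R\<^esub> b \<in> J" using left a by blast
      let ?c = "\<one>\<^bsub>R\<^esub> \<ominus>\<^bsub>R\<^esub> a \<otimes>\<^bsub>R\<^esub> b"
      have "?c \<notin> J"
      proof
        assume "?c \<in> J"
        then have "?c \<oplus>\<^bsub>R\<^esub> a \<otimes>\<^bsub>R\<^esub> b \<in> J" using ab by blast
        moreover have "?c \<oplus>\<^bsub>R\<^esub> a \<otimes>\<^bsub>R\<^esub> b = \<one>\<^bsub>R\<^esub>"
          using a b(1) by (simp add: minus_eq a_assoc l_neg)
        ultimately show False using one by simp
      qed
      then obtain z where z: "z \<in> carrier R" "z \<otimes>\<^bsub>R\<^esub> ?c = \<one>\<^bsub>R\<^esub>" using linv[of ?c] a b by auto
      have "?c \<otimes>\<^bsub>R\<^esub> a = \<zero>\<^bsub>R\<^esub>"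
        using a b by (simp add: minus_eq l_distr l_minus m_assoc r_neg)
      then have "z \<otimes>\<^bsub>R\<^esub> ?c \<otimes>\<^bsub>R\<^esub> a = \<zero>\<^bsub>R\<^esub>" using z(1) a b(1) by (simp add: m_assoc)
      then show False using z a J.zero_closed by simp
    qed
    then obtain c where c: "c \<in> carrier R" "c \<otimes>\<^bsub>R\<^esub> b = \<one>\<^bsub>R\<^esub>" using linv b by blast
    have "c = a" using a b c by (metis l_one m_assoc r_one)
    then show ?thesis using a b c by (auto simp: Units_def)
  qed
  have "x \<notin> J \<or> y \<notin> J" using J.a_closed[of x y] xy(3) one by auto
  then show ?thesis using unit xy by blast
qed


section \<open>Direct sum decompositions\<close>

lemma (in abelian_group) finsum_mem_subgroup:
  assumes H: "additive_subgroup H G" and "finite S" "\<And>s. s \<in> S \<Longrightarrow> y s \<in> H"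
  shows "finsum G y S \<in> H"
  using assms(2,3)
proof (induction S)
  case empty
  then show ?case using H additive_subgroup.zero_closed by fastforce
next
  case (insert s S)
  moreover have "finsum G y (insert s S) = y s \<oplus> finsum G y S"
    using insert additive_subgroup.a_Hcarr[OF H] by (intro finsum_insert) auto
  ultimately show ?case using additive_subgroup.a_closed[OF H] by simp
qed

text \<open>The description repeats the predicate of \<open>internal_direct_sum\<close>, so that the
  unique existence stated there applies directly. The families are extensional, hence the value off
  \<open>I\<close> is \<open>undefined\<close>, and facts about a single component ask for an index
  in \<open>I\<close>.\<close>

definition component :: "'g set \<Rightarrow> ('g \<Rightarrow> 'm set) \<Rightarrow> ('m, 's) ring_scheme \<Rightarrow> 'm \<Rightarrow> 'g \<Rightarrow> 'm"
  where "component I D M x = (THE f. f \<in> (\<Pi>\<^sub>E i\<in>I. D i) \<and> finite {i \<in> I. f i \<noteq> \<zero>\<^bsub>M\<^esub>} \<and>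
    x = finsum M f {i \<in> I. f i \<noteq> \<zero>\<^bsub>M\<^esub>})"

locale direct_sum = abelian_group M
  for M :: "('m, 's) ring_scheme" (structure) and I :: "'g set" and D :: "'g \<Rightarrow> 'm set" +
  assumes internal_direct_sum: "internal_direct_sum I D M"
begin

abbreviation "cmp \<equiv> component I D M"

lemma part_subgroup: "i \<in> I \<Longrightarrow> additive_subgroup (D i) M"
  using internal_direct_sum by (simp add: internal_direct_sum_def)

lemma part_carrier: "\<lbrakk>x \<in> D i; i \<in> I\<rbrakk> \<Longrightarrow> x \<in> carrier M"
  using part_subgroup additive_subgroup.a_subset by blast

lemma component_all:
  assumes "x \<in> carrier M"
  shows "cmp x \<in> (\<Pi>\<^sub>E i\<in>I. D i) \<and> finite {i \<in> I. cmp x i \<noteq> \<zero>} \<and>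
    x = finsum M (cmp x) {i \<in> I. cmp x i \<noteq> \<zero>}"
proof -
  have "\<exists>!f. f \<in> (\<Pi>\<^sub>E i\<in>I. D i) \<and> finite {i \<in> I. f i \<noteq> \<zero>} \<and>
      x = finsum M f {i \<in> I. f i \<noteq> \<zero>}"
    using internal_direct_sum assms by (simp add: internal_direct_sum_def)
  then show ?thesis unfolding component_def by (rule theI')
qed

lemma component_in_part: "\<lbrakk>x \<in> carrier M; i \<in> I\<rbrakk> \<Longrightarrow> cmp x i \<in> D i"
  using component_all by blast

lemma component_closed [simp, intro]: "\<lbrakk>x \<in> carrier M; i \<in> I\<rbrakk> \<Longrightarrow> cmp x i \<in> carrier M"
  using component_in_part part_carrier by blast

lemma finite_support [simp]: "x \<in> carrier M \<Longrightarrow> finite {i \<in> I. cmp x i \<noteq> \<zero>}"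
  using component_all by blast

lemma finsum_component:
  assumes "x \<in> carrier M" "finite F" "F \<subseteq> I" "{i \<in> I. cmp x i \<noteq> \<zero>} \<subseteq> F"
  shows "x = finsum M (cmp x) F"
proof -
  have "finsum M (cmp x) {i \<in> I. cmp x i \<noteq> \<zero>} = finsum M (cmp x) F"
    using assms by (intro add.finprod_mono_neutral_cong_left) auto
  then show ?thesis using component_all[OF assms(1)] by simp
qed

lemma component_unique:
  assumes F: "finite F" "F \<subseteq> I" and f: "f \<in> Pi F D" and i: "i \<in> I"
  shows "cmp (finsum M f F) i = (if i \<in> F then f i else \<zero>)"
proof -
  \<comment> \<open>Only extensional families belong to \<open>\<Pi>\<^sub>E\<close>, so
    \<open>f\<close> is extended by zero inside \<open>I\<close> and by \<open>undefined\<close>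
    outside before uniqueness is invoked.\<close>
  define g where "g = (\<lambda>i. if i \<in> F then f i else if i \<in> I then \<zero> else undefined)"
  have fc: "f \<in> F \<rightarrow> carrier M" using f F part_carrier by blast
  then have x: "finsum M f F \<in> carrier M" by (rule finsum_closed)
  have sub: "{i \<in> I. g i \<noteq> \<zero>} \<subseteq> F" by (auto simp: g_def)
  have "g \<in> (\<Pi>\<^sub>E i\<in>I. D i)"
    using f F part_subgroup additive_subgroup.zero_closed by (fastforce simp: g_def)
  moreover have "finite {i \<in> I. g i \<noteq> \<zero>}" using sub F(1) by (rule finite_subset)
  moreover have "finsum M f F = finsum M g {i \<in> I. g i \<noteq> \<zero>}"
    using F fc sub by (intro add.finprod_mono_neutral_cong_right) (auto simp: g_def)
  moreover have "\<exists>!h. h \<in> (\<Pi>\<^sub>E i\<in>I. D i) \<and> finite {i \<in> I. h i \<noteq> \<zero>} \<and>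
      finsum M f F = finsum M h {i \<in> I. h i \<noteq> \<zero>}"
    using internal_direct_sum x by (simp add: internal_direct_sum_def)
  ultimately have "cmp (finsum M f F) = g" using component_all[OF x] by blast
  then show ?thesis using i F by (auto simp: g_def)
qed

lemma component_of_part:
  assumes "x \<in> D j" "j \<in> I" "i \<in> I"
  shows "cmp x i = (if i = j then x else \<zero>)"
proof -
  have "finsum M (\<lambda>_. x) {j} = x" using part_carrier[OF assms(1,2)] by simp
  then show ?thesis using component_unique[of "{j}" "\<lambda>_. x" i] assms by auto
qed

lemma component_zero [simp]:
  assumes "i \<in> I" shows "cmp \<zero> i = \<zero>"
  using component_of_part[OF additive_subgroup.zero_closed[OF part_subgroup[OF assms]], of i] assms
  by simp

lemma component_add:
  assumes x: "x \<in> carrier M" and y: "y \<in> carrier M" and i: "i \<in> I"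
  shows "cmp (x \<oplus> y) i = cmp x i \<oplus> cmp y i"
proof -
  let ?F = "{i \<in> I. cmp x i \<noteq> \<zero>} \<union> {i \<in> I. cmp y i \<noteq> \<zero>}"
  have F: "finite ?F" "?F \<subseteq> I" using x y by auto
  have "x = finsum M (cmp x) ?F" "y = finsum M (cmp y) ?F"
    by (rule finsum_component; use x y F in auto)+
  moreover have "finsum M (\<lambda>i. cmp x i \<oplus> cmp y i) ?F = finsum M (cmp x) ?F \<oplus> finsum M (cmp y) ?F"
    using x y by (intro finsum_addf) auto
  ultimately have "x \<oplus> y = finsum M (\<lambda>i. cmp x i \<oplus> cmp y i) ?F" by simp
  moreover have "cmp (finsum M (\<lambda>i. cmp x i \<oplus> cmp y i) ?F) i
      = (if i \<in> ?F then cmp x i \<oplus> cmp y i else \<zero>)"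
    using F i x y component_in_part part_subgroup
    by (intro component_unique) (auto intro!: additive_subgroup.a_closed[OF part_subgroup])
  ultimately show ?thesis using x y i by auto
qed

lemma component_uminus:
  assumes x: "x \<in> carrier M" and i: "i \<in> I"
  shows "cmp (\<ominus> x) i = \<ominus> cmp x i"
proof -
  have "cmp (\<ominus> x) i \<oplus> cmp x i = \<zero>"
    using component_add[of "\<ominus> x" x i] x i by (simp add: l_neg)
  then show ?thesis using x i minus_equality by simp
qed

lemma component_finsum:
  assumes "finite S" "\<And>s. s \<in> S \<Longrightarrow> y s \<in> carrier M" "i \<in> I"
  shows "cmp (finsum M y S) i = finsum M (\<lambda>s. cmp (y s) i) S"
  using assms(1,2)
proof (induction S)
  case empty
  then show ?case using assms(3) by simp
next
  case (insert s S)
  then have "finsum M y S \<in> carrier M" by (intro finsum_closed) auto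
  moreover have "finsum M y (insert s S) = y s \<oplus> finsum M y S"
    using insert by (intro finsum_insert) auto
  moreover have "finsum M (\<lambda>s. cmp (y s) i) (insert s S)
      = cmp (y s) i \<oplus> finsum M (\<lambda>s. cmp (y s) i) S"
    using insert assms(3) by (intro finsum_insert) auto
  ultimately show ?case using insert assms(3) by (simp add: component_add)
qed

lemma component_eqI:
  assumes "x \<in> carrier M" "y \<in> carrier M" "\<And>i. i \<in> I \<Longrightarrow> cmp x i = cmp y i"
  shows "x = y"
proof -
  have eq: "{i \<in> I. cmp x i \<noteq> \<zero>} = {i \<in> I. cmp y i \<noteq> \<zero>}" using assms(3) by auto
  have "x = finsum M (cmp x) {i \<in> I. cmp y i \<noteq> \<zero>}"
    using assms eq by (intro finsum_component) auto
  also have "\<dots> = finsum M (cmp y) {i \<in> I. cmp y i \<noteq> \<zero>}"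
    using assms by (intro finsum_cong') auto
  also have "\<dots> = y" using component_all[OF assms(2)] by simp
  finally show ?thesis .
qed

lemma part_iff:
  assumes "x \<in> carrier M" "j \<in> I"
  shows "x \<in> D j \<longleftrightarrow> (\<forall>i\<in>I. i \<noteq> j \<longrightarrow> cmp x i = \<zero>)"
proof
  assume R: "\<forall>i\<in>I. i \<noteq> j \<longrightarrow> cmp x i = \<zero>"
  have "x = cmp x j"
  proof (rule component_eqI)
    fix i assume i: "i \<in> I"
    then show "cmp x i = cmp (cmp x j) i"
      using R component_of_part[OF component_in_part[OF assms] assms(2) i] by auto
  qed (use assms in auto)
  then show "x \<in> D j" using component_in_part[OF assms] by simp
qed (use assms component_of_part in auto)

text \<open>The standard reduction to homogeneous elements: a property of \<open>x\<close> is shown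
  to define an additive subgroup and then checked on the components.\<close>

lemma mem_subgroupI:
  assumes "additive_subgroup H M" "x \<in> carrier M" "\<And>i. i \<in> I \<Longrightarrow> cmp x i \<in> H"
  shows "x \<in> H"
proof -
  have "finsum M (cmp x) {i \<in> I. cmp x i \<noteq> \<zero>} \<in> H"
    using assms by (intro finsum_mem_subgroup) auto
  then show ?thesis using component_all[OF assms(2)] by simp
qed

end

lemma finsum_additive:
  assumes "abelian_group M" "abelian_group N" "\<phi> \<in> hom (add_monoid M) (add_monoid N)"
    and "finite S" "\<And>s. s \<in> S \<Longrightarrow> y s \<in> carrier M"
  shows "\<phi> (finsum M y S) = finsum N (\<lambda>s. \<phi> (y s)) S"
proof -
  interpret M: abelian_group M by fact
  interpret N: abelian_group N by fact
  have \<phi>: "\<And>x. x \<in> carrier M \<Longrightarrow> \<phi> x \<in> carrier N"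
    "\<And>x y. x \<in> carrier M \<Longrightarrow> y \<in> carrier M \<Longrightarrow> \<phi> (x \<oplus>\<^bsub>M\<^esub> y) = \<phi> x \<oplus>\<^bsub>N\<^esub> \<phi> y"
    using assms(3) by (auto simp: hom_def)
  have z: "\<phi> \<zero>\<^bsub>M\<^esub> = \<zero>\<^bsub>N\<^esub>"
    using \<phi>(1) \<phi>(2)[of "\<zero>\<^bsub>M\<^esub>" "\<zero>\<^bsub>M\<^esub>"] by (metis M.zero_closed M.l_zero N.add.r_cancel_one')
  show ?thesis using assms(4,5)
  proof (induction S)
    case empty
    then show ?case by (simp add: z)
  next
    case (insert s S)
    then have "finsum M y S \<in> carrier M" by (intro M.finsum_closed) auto
    moreover have "finsum M y (insert s S) = y s \<oplus>\<^bsub>M\<^esub> finsum M y S"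
      using insert by (intro M.finsum_insert) auto
    moreover have "finsum N (\<lambda>s. \<phi> (y s)) (insert s S) = \<phi> (y s) \<oplus>\<^bsub>N\<^esub> finsum N (\<lambda>s. \<phi> (y s)) S"
      using insert \<phi>(1) by (intro N.finsum_insert) auto
    ultimately show ?case using insert \<phi>(2) by simp
  qed
qed

text \<open>This covers multiplication by a homogeneous element (where \<open>\<sigma>\<close> is a translation of the
  monoid of degrees, injective by cancelation) as well as graded homomorphisms (\<open>\<sigma>\<close> the
  identity).\<close>

lemma component_additive:
  assumes M: "direct_sum M I D" and N: "direct_sum N J E"
    and \<phi>: "\<phi> \<in> hom (add_monoid M) (add_monoid N)"
    and \<sigma>: "inj_on \<sigma> I" "\<sigma> ` I \<subseteq> J" "\<And>i x. i \<in> I \<Longrightarrow> x \<in> D i \<Longrightarrow> \<phi> x \<in> E (\<sigma> i)"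
    and x: "x \<in> carrier M"
  shows "i \<in> I \<Longrightarrow> component J E N (\<phi> x) (\<sigma> i) = \<phi> (component I D M x i)"
    and "\<lbrakk>j \<in> J; j \<notin> \<sigma> ` I\<rbrakk> \<Longrightarrow> component J E N (\<phi> x) j = \<zero>\<^bsub>N\<^esub>"
proof -
  interpret M: direct_sum M I D by fact
  interpret N: direct_sum N J E by fact
  have \<phi>c: "\<phi> y \<in> carrier N" if "y \<in> carrier M" for y using \<phi> that by (auto simp: hom_def)
  have z: "\<phi> \<zero>\<^bsub>M\<^esub> = \<zero>\<^bsub>N\<^esub>"
    using finsum_additive[OF M.abelian_group_axioms N.abelian_group_axioms \<phi> finite.emptyI] by simp
  let ?F = "{i \<in> I. M.cmp x i \<noteq> \<zero>\<^bsub>M\<^esub>}"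
  have "\<phi> x = \<phi> (finsum M (M.cmp x) ?F)" using M.component_all[OF x] by simp
  also have "\<dots> = finsum N (\<lambda>i. \<phi> (M.cmp x i)) ?F"
    by (rule finsum_additive) (use \<phi> x M.abelian_group_axioms N.abelian_group_axioms in auto)
  finally have phi_x: "\<phi> x = finsum N (\<lambda>i. \<phi> (M.cmp x i)) ?F" .
  have part: "\<phi> (M.cmp x i) \<in> E (\<sigma> i)" if "i \<in> I" for i
    using \<sigma>(3) that M.component_in_part x by blast
  have cmp: "N.cmp (\<phi> x) j = finsum N (\<lambda>i. if j = \<sigma> i then \<phi> (M.cmp x i) else \<zero>\<^bsub>N\<^esub>) ?F"
    if j: "j \<in> J" for j
  proof -
    have "N.cmp (\<phi> x) j = finsum N (\<lambda>i. N.cmp (\<phi> (M.cmp x i)) j) ?F"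
      unfolding phi_x using x \<phi>c j by (intro N.component_finsum) auto
    also have "\<dots> = finsum N (\<lambda>i. if j = \<sigma> i then \<phi> (M.cmp x i) else \<zero>\<^bsub>N\<^esub>) ?F"
    proof (rule N.finsum_cong')
      fix i assume "i \<in> ?F"
      then show "N.cmp (\<phi> (M.cmp x i)) j = (if j = \<sigma> i then \<phi> (M.cmp x i) else \<zero>\<^bsub>N\<^esub>)"
        using \<sigma>(2) j by (intro N.component_of_part part) auto
    qed (use x \<phi>c in auto)
    finally show ?thesis .
  qed
  show "component J E N (\<phi> x) j = \<zero>\<^bsub>N\<^esub>" if "j \<in> J" "j \<notin> \<sigma> ` I"
    unfolding cmp[OF that(1)] using that by (intro N.add.finprod_one_eqI) auto
  assume i: "i \<in> I"
  then have "N.cmp (\<phi> x) (\<sigma> i)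
      = finsum N (\<lambda>k. if \<sigma> i = \<sigma> k then \<phi> (M.cmp x k) else \<zero>\<^bsub>N\<^esub>) ?F"
    using \<sigma>(2) by (intro cmp) auto
  \<comment> \<open>Injectivity of \<sigma>: no other component of \<open>x\<close> is carried into
    degree \<open>\<sigma> i\<close>.\<close>
  also have "\<dots> = finsum N (\<lambda>k. if i = k then \<phi> (M.cmp x k) else \<zero>\<^bsub>N\<^esub>) ?F"
    using \<sigma>(1) i x \<phi>c by (intro N.finsum_cong') (auto dest: inj_onD)
  also have "\<dots> = \<phi> (M.cmp x i)"
  proof (cases "i \<in> ?F")
    case True
    then show ?thesis using x \<phi>c by (intro N.finsum_singleton) auto
  next
    case False
    then have "M.cmp x i = \<zero>\<^bsub>M\<^esub>" using i by simp
    with False show ?thesis by (auto simp: z intro!: N.add.finprod_one_eqI)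
  qed
  finally show "component J E N (\<phi> x) (\<sigma> i) = \<phi> (component I D M x i)" .
qed


section \<open>Graded local rings\<close>

locale cancel_graded_ring = G: monoid_cancel G + R: ring R + graded_ring G R \<A>
  for G :: "('g, 'h) monoid_scheme" and R :: "('a, 'r) ring_scheme" and \<A> :: "'g \<Rightarrow> 'a set"
begin

sublocale RD: direct_sum R "carrier G" \<A>
  by (intro direct_sum.intro R.abelian_group_axioms direct_sum_axioms.intro ring_direct_sum)

lemma translate_left_inj: "\<alpha> \<in> carrier G \<Longrightarrow> inj_on (\<lambda>\<gamma>. \<alpha> \<otimes>\<^bsub>G\<^esub> \<gamma>) (carrier G)"
  using G.l_cancel by (auto intro: inj_onI)

lemma translate_right_inj: "\<alpha> \<in> carrier G \<Longrightarrow> inj_on (\<lambda>\<gamma>. \<gamma> \<otimes>\<^bsub>G\<^esub> \<alpha>) (carrier G)"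
  using G.r_cancel by (auto intro: inj_onI)

text \<open>The translate by \<alpha> need not be onto, hence the clause for the degrees it misses.
  The degree of the homogeneous factor is the one to be cancelled, so left cancelation serves here
  and right cancelation in the mirrored lemma.\<close>

lemma component_mult_left:
  assumes "a \<in> \<A> \<alpha>" "\<alpha> \<in> carrier G" "x \<in> carrier R"
  shows "\<gamma> \<in> carrier G \<Longrightarrow> RD.cmp (a \<otimes>\<^bsub>R\<^esub> x) (\<alpha> \<otimes>\<^bsub>G\<^esub> \<gamma>) = a \<otimes>\<^bsub>R\<^esub> RD.cmp x \<gamma>"
    and "\<lbrakk>\<delta> \<in> carrier G; \<delta> \<notin> (\<lambda>\<gamma>. \<alpha> \<otimes>\<^bsub>G\<^esub> \<gamma>) ` carrier G\<rbrakk> \<Longrightarrow> RD.cmp (a \<otimes>\<^bsub>R\<^esub> x) \<delta> = \<zero>\<^bsub>R\<^esub>"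
proof -
  have "(\<lambda>x. a \<otimes>\<^bsub>R\<^esub> x) \<in> hom (add_monoid R) (add_monoid R)"
    using RD.part_carrier[OF assms(1,2)] by (auto simp: hom_def R.r_distr)
  note * = component_additive[OF RD.direct_sum_axioms RD.direct_sum_axioms this
      translate_left_inj[OF assms(2)]]
  show "\<gamma> \<in> carrier G \<Longrightarrow> RD.cmp (a \<otimes>\<^bsub>R\<^esub> x) (\<alpha> \<otimes>\<^bsub>G\<^esub> \<gamma>) = a \<otimes>\<^bsub>R\<^esub> RD.cmp x \<gamma>"
    "\<lbrakk>\<delta> \<in> carrier G; \<delta> \<notin> (\<lambda>\<gamma>. \<alpha> \<otimes>\<^bsub>G\<^esub> \<gamma>) ` carrier G\<rbrakk> \<Longrightarrow> RD.cmp (a \<otimes>\<^bsub>R\<^esub> x) \<delta> = \<zero>\<^bsub>R\<^esub>"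
    by (rule *; use assms ring_degree in auto)+
qed

lemma component_mult_right:
  assumes "a \<in> \<A> \<alpha>" "\<alpha> \<in> carrier G" "x \<in> carrier R"
  shows "\<gamma> \<in> carrier G \<Longrightarrow> RD.cmp (x \<otimes>\<^bsub>R\<^esub> a) (\<gamma> \<otimes>\<^bsub>G\<^esub> \<alpha>) = RD.cmp x \<gamma> \<otimes>\<^bsub>R\<^esub> a"
    and "\<lbrakk>\<delta> \<in> carrier G; \<delta> \<notin> (\<lambda>\<gamma>. \<gamma> \<otimes>\<^bsub>G\<^esub> \<alpha>) ` carrier G\<rbrakk> \<Longrightarrow> RD.cmp (x \<otimes>\<^bsub>R\<^esub> a) \<delta> = \<zero>\<^bsub>R\<^esub>"
proof -
  have "(\<lambda>x. x \<otimes>\<^bsub>R\<^esub> a) \<in> hom (add_monoid R) (add_monoid R)"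
    using RD.part_carrier[OF assms(1,2)] by (auto simp: hom_def R.l_distr)
  note * = component_additive[OF RD.direct_sum_axioms RD.direct_sum_axioms this
      translate_right_inj[OF assms(2)]]
  show "\<gamma> \<in> carrier G \<Longrightarrow> RD.cmp (x \<otimes>\<^bsub>R\<^esub> a) (\<gamma> \<otimes>\<^bsub>G\<^esub> \<alpha>) = RD.cmp x \<gamma> \<otimes>\<^bsub>R\<^esub> a"
    "\<lbrakk>\<delta> \<in> carrier G; \<delta> \<notin> (\<lambda>\<gamma>. \<gamma> \<otimes>\<^bsub>G\<^esub> \<alpha>) ` carrier G\<rbrakk> \<Longrightarrow> RD.cmp (x \<otimes>\<^bsub>R\<^esub> a) \<delta> = \<zero>\<^bsub>R\<^esub>"
    by (rule *; use assms ring_degree in auto)+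
qed

end

section \<open>Units among the homogeneous elements\<close>

locale cancel_graded_local_ring = cancel_graded_ring G R \<A> + graded_local_ring G R \<A>
  for G :: "('g, 'h) monoid_scheme" and R :: "('a, 'r) ring_scheme" and \<A> :: "'g \<Rightarrow> 'a set"
begin

text \<open>This is no axiom of \<open>graded_ring\<close>. It is read off from the degree e part
  being a ring: the record update changes only the carrier, so the unit is that of
  \<open>R\<close>.\<close>

lemma one_degree: "\<one>\<^bsub>R\<^esub> \<in> \<A> \<one>\<^bsub>G\<^esub>"
proof -
  interpret E: ring "R\<lparr>carrier := \<A> \<one>\<^bsub>G\<^esub>\<rparr>"
    using local_ring_degree_one by (simp add: local_ring_def)
  show ?thesis using E.one_closed by simp
qed

lemma one_not_zero: "\<one>\<^bsub>R\<^esub> \<noteq> \<zero>\<^bsub>R\<^esub>"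
  using local_ring_one_not_zero[OF local_ring_degree_one] by simp

lemma zero_nonunit: "\<zero>\<^bsub>R\<^esub> \<notin> Units R"
  using one_not_zero by (auto simp: Units_def)

text \<open>An inverse found inside the degree e part is an inverse in \<open>R\<close>, so locality
  of that part can be phrased with \<open>Units R\<close>.\<close>

lemma degree_one_sum_eq_one:
  assumes "a \<in> \<A> \<one>\<^bsub>G\<^esub>" "b \<in> \<A> \<one>\<^bsub>G\<^esub>" "a \<oplus>\<^bsub>R\<^esub> b = \<one>\<^bsub>R\<^esub>"
  shows "a \<in> Units R \<or> b \<in> Units R"
proof -
  have "Units (R\<lparr>carrier := \<A> \<one>\<^bsub>G\<^esub>\<rparr>) \<subseteq> Units R"
    using RD.part_carrier by (auto simp: Units_def)
  then show ?thesis using local_ring_sum_eq_one[OF local_ring_degree_one, of a b] assms by auto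
qed

lemma unit_complement:
  assumes "a \<in> \<A> \<one>\<^bsub>G\<^esub>" "a \<notin> Units R"
  shows "\<one>\<^bsub>R\<^esub> \<ominus>\<^bsub>R\<^esub> a \<in> Units R"
proof -
  have a: "a \<in> carrier R" using assms(1) RD.part_carrier by blast
  interpret A: additive_subgroup "\<A> \<one>\<^bsub>G\<^esub>" R by (simp add: RD.part_subgroup)
  have "\<one>\<^bsub>R\<^esub> \<ominus>\<^bsub>R\<^esub> a \<in> \<A> \<one>\<^bsub>G\<^esub>"
    using assms(1) one_degree by (simp add: R.minus_eq)
  moreover have "(\<one>\<^bsub>R\<^esub> \<ominus>\<^bsub>R\<^esub> a) \<oplus>\<^bsub>R\<^esub> a = \<one>\<^bsub>R\<^esub>"
    using a by (simp add: R.minus_eq R.a_assoc R.l_neg)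
  ultimately show ?thesis using degree_one_sum_eq_one assms by blast
qed

text \<open>Take the degree e component of ba = 1. It is nonzero, so e is a degree \<delta>\<gamma>
  reached by the translate, and then only the component of \<open>b\<close> in degree \<delta>
  contributes.\<close>

lemma homogeneous_left_inverse:
  assumes a: "a \<in> \<A> \<gamma>" "\<gamma> \<in> carrier G" and b: "b \<in> carrier R" "b \<otimes>\<^bsub>R\<^esub> a = \<one>\<^bsub>R\<^esub>"
  obtains \<delta> v where "\<delta> \<in> carrier G" "v \<in> \<A> \<delta>" "v \<otimes>\<^bsub>R\<^esub> a = \<one>\<^bsub>R\<^esub>"
    "\<delta> \<otimes>\<^bsub>G\<^esub> \<gamma> = \<one>\<^bsub>G\<^esub>" "\<gamma> \<otimes>\<^bsub>G\<^esub> \<delta> = \<one>\<^bsub>G\<^esub>"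
proof -
  have one: "RD.cmp (b \<otimes>\<^bsub>R\<^esub> a) \<one>\<^bsub>G\<^esub> = \<one>\<^bsub>R\<^esub>"
    using RD.component_of_part[OF one_degree, of "\<one>\<^bsub>G\<^esub>"] b by simp
  then obtain \<delta> where \<delta>: "\<delta> \<in> carrier G" "\<delta> \<otimes>\<^bsub>G\<^esub> \<gamma> = \<one>\<^bsub>G\<^esub>"
    using component_mult_right(2)[OF a b(1), of "\<one>\<^bsub>G\<^esub>"] one_not_zero by force
  have "RD.cmp b \<delta> \<otimes>\<^bsub>R\<^esub> a = \<one>\<^bsub>R\<^esub>"
    using component_mult_right(1)[OF a b(1) \<delta>(1)] one \<delta>(2) by simp
  \<comment> \<open>Here \<delta>(\<gamma>\<delta>) = (\<delta>\<gamma>)\<delta> = \<delta>, and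
    \<delta> cancels on the left.\<close>
  moreover have "\<gamma> \<otimes>\<^bsub>G\<^esub> \<delta> = \<one>\<^bsub>G\<^esub>"
  proof (rule G.l_cancel[of \<delta>])
    show "\<delta> \<otimes>\<^bsub>G\<^esub> (\<gamma> \<otimes>\<^bsub>G\<^esub> \<delta>) = \<delta> \<otimes>\<^bsub>G\<^esub> \<one>\<^bsub>G\<^esub>"
      using \<delta> a(2) by (simp add: G.m_assoc[symmetric])
  qed (use \<delta> a(2) in auto)
  ultimately show ?thesis using that[OF \<delta>(1) RD.component_in_part[OF b(1) \<delta>(1)]] \<delta> by blast
qed

lemma homogeneous_right_inverse:
  assumes a: "a \<in> \<A> \<gamma>" "\<gamma> \<in> carrier G" and b: "b \<in> carrier R" "a \<otimes>\<^bsub>R\<^esub> b = \<one>\<^bsub>R\<^esub>"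
  obtains \<delta> v where "\<delta> \<in> carrier G" "v \<in> \<A> \<delta>" "a \<otimes>\<^bsub>R\<^esub> v = \<one>\<^bsub>R\<^esub>"
proof -
  have one: "RD.cmp (a \<otimes>\<^bsub>R\<^esub> b) \<one>\<^bsub>G\<^esub> = \<one>\<^bsub>R\<^esub>"
    using RD.component_of_part[OF one_degree, of "\<one>\<^bsub>G\<^esub>"] b by simp
  then obtain \<delta> where \<delta>: "\<delta> \<in> carrier G" "\<gamma> \<otimes>\<^bsub>G\<^esub> \<delta> = \<one>\<^bsub>G\<^esub>"
    using component_mult_left(2)[OF a b(1), of "\<one>\<^bsub>G\<^esub>"] one_not_zero by force
  have "a \<otimes>\<^bsub>R\<^esub> RD.cmp b \<delta> = \<one>\<^bsub>R\<^esub>"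
    using component_mult_left(1)[OF a b(1) \<delta>(1)] one \<delta>(2) by simp
  then show ?thesis using that[OF \<delta>(1) RD.component_in_part[OF b(1) \<delta>(1)]] by blast
qed

lemma left_and_right_inverse_unit:
  assumes "a \<in> carrier R" "b \<in> carrier R" "c \<in> carrier R" "b \<otimes>\<^bsub>R\<^esub> a = \<one>\<^bsub>R\<^esub>" "a \<otimes>\<^bsub>R\<^esub> c = \<one>\<^bsub>R\<^esub>"
  shows "a \<in> Units R"
proof -
  have "b = c" using assms by (metis R.l_one R.m_assoc R.r_one)
  then show ?thesis using assms by (auto simp: Units_def)
qed

text \<open>With a homogeneous left inverse v, the product av has degree e. Were it no unit, 1 - av
  would be one by locality, yet (1 - av)a = 0 would force a = 0. So av is a unit, and a is right
  invertible too.\<close>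

lemma left_invertible_unit:
  assumes a: "a \<in> \<A> \<gamma>" "\<gamma> \<in> carrier G" and b: "b \<in> carrier R" "b \<otimes>\<^bsub>R\<^esub> a = \<one>\<^bsub>R\<^esub>"
  shows "a \<in> Units R"
proof -
  obtain \<delta> v where v: "\<delta> \<in> carrier G" "v \<in> \<A> \<delta>" "v \<otimes>\<^bsub>R\<^esub> a = \<one>\<^bsub>R\<^esub>" "\<gamma> \<otimes>\<^bsub>G\<^esub> \<delta> = \<one>\<^bsub>G\<^esub>"
    by (rule homogeneous_left_inverse[OF a b])
  have ac: "a \<in> carrier R" and vc: "v \<in> carrier R" using a v RD.part_carrier by blast+
  have av: "a \<otimes>\<^bsub>R\<^esub> v \<in> \<A> \<one>\<^bsub>G\<^esub>" using ring_degree[OF a(2) v(1) a(1) v(2)] v(4) by simp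
  have "a \<otimes>\<^bsub>R\<^esub> v \<in> Units R"
  proof (rule ccontr)
    assume "a \<otimes>\<^bsub>R\<^esub> v \<notin> Units R"
    then have u: "\<one>\<^bsub>R\<^esub> \<ominus>\<^bsub>R\<^esub> a \<otimes>\<^bsub>R\<^esub> v \<in> Units R" using unit_complement[OF av] by blast
    have "(\<one>\<^bsub>R\<^esub> \<ominus>\<^bsub>R\<^esub> a \<otimes>\<^bsub>R\<^esub> v) \<otimes>\<^bsub>R\<^esub> a = \<zero>\<^bsub>R\<^esub>"
      using ac vc v(3) by (simp add: R.minus_eq R.l_distr R.l_minus R.m_assoc R.r_neg)
    then have "(\<one>\<^bsub>R\<^esub> \<ominus>\<^bsub>R\<^esub> a \<otimes>\<^bsub>R\<^esub> v) \<otimes>\<^bsub>R\<^esub> a = (\<one>\<^bsub>R\<^esub> \<ominus>\<^bsub>R\<^esub> a \<otimes>\<^bsub>R\<^esub> v) \<otimes>\<^bsub>R\<^esub> \<zero>\<^bsub>R\<^esub>"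
      using ac vc by simp
    then have "a = \<zero>\<^bsub>R\<^esub>" using u ac R.Units_l_cancel by blast
    then show False using v(3) vc one_not_zero by simp
  qed
  then obtain w where "w \<in> carrier R" "(a \<otimes>\<^bsub>R\<^esub> v) \<otimes>\<^bsub>R\<^esub> w = \<one>\<^bsub>R\<^esub>" by (auto simp: Units_def)
  then have "a \<otimes>\<^bsub>R\<^esub> (v \<otimes>\<^bsub>R\<^esub> w) = \<one>\<^bsub>R\<^esub>" "v \<otimes>\<^bsub>R\<^esub> w \<in> carrier R"
    using ac vc by (auto simp: R.m_assoc)
  then show ?thesis using left_and_right_inverse_unit[OF ac b(1) _ b(2)] by blast
qed

text \<open>A homogeneous right inverse v has a as a left inverse, so v is a unit by the preceding
  lemma, and its inverse can only be a.\<close>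

lemma right_invertible_unit:
  assumes a: "a \<in> \<A> \<gamma>" "\<gamma> \<in> carrier G" and b: "b \<in> carrier R" "a \<otimes>\<^bsub>R\<^esub> b = \<one>\<^bsub>R\<^esub>"
  shows "a \<in> Units R"
proof -
  obtain \<delta> v where v: "\<delta> \<in> carrier G" "v \<in> \<A> \<delta>" "a \<otimes>\<^bsub>R\<^esub> v = \<one>\<^bsub>R\<^esub>"
    by (rule homogeneous_right_inverse[OF a b])
  have ac: "a \<in> carrier R" and vc: "v \<in> carrier R" using a v RD.part_carrier by blast+
  have "v \<in> Units R" using left_invertible_unit[OF v(2,1) ac v(3)] .
  then obtain w where "w \<in> carrier R" "v \<otimes>\<^bsub>R\<^esub> w = \<one>\<^bsub>R\<^esub>" by (auto simp: Units_def)
  then have "w = a" using ac vc v(3) by (metis R.l_one R.m_assoc R.r_one)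
  then show ?thesis using \<open>v \<otimes>\<^bsub>R\<^esub> w = \<one>\<^bsub>R\<^esub>\<close> ac vc v(3) by (auto simp: Units_def)
qed

text \<open>The inverse of ab makes a right invertible and b left invertible, which suffices for
  homogeneous elements. Read backwards, homogeneous non-units absorb homogeneous factors on either
  side.\<close>

lemma mult_unit_factors:
  assumes a: "a \<in> \<A> \<gamma>" "\<gamma> \<in> carrier G" and b: "b \<in> \<A> \<delta>" "\<delta> \<in> carrier G"
    and u: "a \<otimes>\<^bsub>R\<^esub> b \<in> Units R"
  shows "a \<in> Units R" "b \<in> Units R"
proof -
  have c: "a \<in> carrier R" "b \<in> carrier R" using a b RD.part_carrier by blast+
  obtain w where w: "w \<in> carrier R" "w \<otimes>\<^bsub>R\<^esub> (a \<otimes>\<^bsub>R\<^esub> b) = \<one>\<^bsub>R\<^esub>" "(a \<otimes>\<^bsub>R\<^esub> b) \<otimes>\<^bsub>R\<^esub> w = \<one>\<^bsub>R\<^esub>"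
    using u by (auto simp: Units_def)
  show "a \<in> Units R"
    using w c by (intro right_invertible_unit[OF a, of "b \<otimes>\<^bsub>R\<^esub> w"]) (auto simp: R.m_assoc)
  show "b \<in> Units R"
    using w c by (intro left_invertible_unit[OF b, of "w \<otimes>\<^bsub>R\<^esub> a"]) (auto simp: R.m_assoc)
qed

text \<open>Multiplying by a homogeneous left inverse of the sum moves both summands into degree e,
  where they add up to 1 and locality decides. The factor is removed again by
  \<open>mult_unit_factors\<close>.\<close>

lemma sum_unit_summand:
  assumes \<gamma>: "\<gamma> \<in> carrier G" and a: "a \<in> \<A> \<gamma>" and b: "b \<in> \<A> \<gamma>" and u: "a \<oplus>\<^bsub>R\<^esub> b \<in> Units R"
  shows "a \<in> Units R \<or> b \<in> Units R"
proof -
  have c: "a \<in> carrier R" "b \<in> carrier R" using \<gamma> a b RD.part_carrier by blast+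
  have ab: "a \<oplus>\<^bsub>R\<^esub> b \<in> \<A> \<gamma>" using a b additive_subgroup.a_closed[OF RD.part_subgroup[OF \<gamma>]] by blast
  obtain w where w: "w \<in> carrier R" "w \<otimes>\<^bsub>R\<^esub> (a \<oplus>\<^bsub>R\<^esub> b) = \<one>\<^bsub>R\<^esub>" using u by (auto simp: Units_def)
  obtain \<delta> v where v: "\<delta> \<in> carrier G" "v \<in> \<A> \<delta>" "v \<otimes>\<^bsub>R\<^esub> (a \<oplus>\<^bsub>R\<^esub> b) = \<one>\<^bsub>R\<^esub>" "\<delta> \<otimes>\<^bsub>G\<^esub> \<gamma> = \<one>\<^bsub>G\<^esub>"
    by (rule homogeneous_left_inverse[OF ab \<gamma> w])
  have vc: "v \<in> carrier R" using v RD.part_carrier by blast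
  have "v \<otimes>\<^bsub>R\<^esub> a \<in> \<A> \<one>\<^bsub>G\<^esub>" "v \<otimes>\<^bsub>R\<^esub> b \<in> \<A> \<one>\<^bsub>G\<^esub>"
    using ring_degree[OF v(1) \<gamma> v(2)] a b v(4) by auto
  moreover have "v \<otimes>\<^bsub>R\<^esub> a \<oplus>\<^bsub>R\<^esub> v \<otimes>\<^bsub>R\<^esub> b = \<one>\<^bsub>R\<^esub>" using c vc v(3) by (simp add: R.r_distr)
  ultimately have "v \<otimes>\<^bsub>R\<^esub> a \<in> Units R \<or> v \<otimes>\<^bsub>R\<^esub> b \<in> Units R" using degree_one_sum_eq_one by blast
  then show ?thesis using mult_unit_factors(2)[OF v(2,1)] a b \<gamma> by blast
qed

section \<open>The maximal graded ideal described by components\<close>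

definition nonunit_ideal :: "'a set"
  where "nonunit_ideal = {a \<in> carrier R. \<forall>\<gamma>\<in>carrier G. RD.cmp a \<gamma> \<notin> Units R}"

lemma nonunit_ideal_subgroup: "additive_subgroup nonunit_ideal R"
proof (intro additive_subgroupI R.add.subgroupI)
  show "nonunit_ideal \<noteq> {}" using zero_nonunit by (auto simp: nonunit_ideal_def intro!: exI[of _ "\<zero>\<^bsub>R\<^esub>"])
next
  fix a assume a: "a \<in> nonunit_ideal"
  have "\<ominus>\<^bsub>R\<^esub> RD.cmp a \<gamma> \<notin> Units R" if \<gamma>: "\<gamma> \<in> carrier G" for \<gamma>
  proof
    assume u: "\<ominus>\<^bsub>R\<^esub> RD.cmp a \<gamma> \<in> Units R"
    have "\<ominus>\<^bsub>R\<^esub> \<one>\<^bsub>R\<^esub> \<in> Units R" by (rule R.Units_minus_one_closed)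
    then have "(\<ominus>\<^bsub>R\<^esub> \<one>\<^bsub>R\<^esub>) \<otimes>\<^bsub>R\<^esub> (\<ominus>\<^bsub>R\<^esub> RD.cmp a \<gamma>) \<in> Units R" using u by blast
    then show False using a \<gamma> by (simp add: nonunit_ideal_def R.l_minus)
  qed
  then show "\<ominus>\<^bsub>R\<^esub> a \<in> nonunit_ideal"
    using a by (simp add: nonunit_ideal_def RD.component_uminus)
next
  fix a b assume "a \<in> nonunit_ideal" "b \<in> nonunit_ideal"
  then show "a \<oplus>\<^bsub>R\<^esub> b \<in> nonunit_ideal"
    using sum_unit_summand RD.component_in_part by (simp add: nonunit_ideal_def RD.component_add) blast
qed (auto simp: nonunit_ideal_def)

text \<open>For fixed \<open>a\<close> the multipliers whose product with \<open>a\<close> stays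
  inside form an additive subgroup, so the multiplier may be taken homogeneous. A component of the
  product is then zero or a product of two homogeneous factors, of which the one coming from
  \<open>a\<close> is no unit.\<close>

lemma nonunit_ideal_ideal: "ideal nonunit_ideal R"
proof (rule idealI)
  show "subgroup nonunit_ideal (add_monoid R)"
    using nonunit_ideal_subgroup by (rule additive_subgroup.a_subgroup)
next
  fix a x assume a: "a \<in> nonunit_ideal" and x: "x \<in> carrier R"
  have ac: "a \<in> carrier R" using a by (simp add: nonunit_ideal_def)
  have "x \<in> {x \<in> carrier R. x \<otimes>\<^bsub>R\<^esub> a \<in> nonunit_ideal}"
  proof (rule RD.mem_subgroupI[OF _ x])
    show "additive_subgroup {x \<in> carrier R. x \<otimes>\<^bsub>R\<^esub> a \<in> nonunit_ideal} R"
      using ac additive_subgroup.a_closed[OF nonunit_ideal_subgroup]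
        additive_subgroup.a_inv_closed[OF nonunit_ideal_subgroup]
        additive_subgroup.zero_closed[OF nonunit_ideal_subgroup]
      by (intro additive_subgroupI R.add.subgroupI) (auto simp: R.l_distr R.l_minus)
    fix \<alpha> assume \<alpha>: "\<alpha> \<in> carrier G"
    have xa: "RD.cmp x \<alpha> \<in> \<A> \<alpha>" using x \<alpha> by (rule RD.component_in_part)
    have "RD.cmp (RD.cmp x \<alpha> \<otimes>\<^bsub>R\<^esub> a) \<delta> \<notin> Units R" if \<delta>: "\<delta> \<in> carrier G" for \<delta>
    proof (cases "\<delta> \<in> (\<lambda>\<gamma>. \<alpha> \<otimes>\<^bsub>G\<^esub> \<gamma>) ` carrier G")
      case True
      then obtain \<gamma> where \<gamma>: "\<gamma> \<in> carrier G" "\<delta> = \<alpha> \<otimes>\<^bsub>G\<^esub> \<gamma>" by blast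
      then show ?thesis
        using component_mult_left(1)[OF xa \<alpha> ac \<gamma>(1)] a
          mult_unit_factors(2)[OF xa \<alpha> RD.component_in_part[OF ac \<gamma>(1)] \<gamma>(1)]
        by (auto simp: nonunit_ideal_def)
    next
      case False
      then show ?thesis using component_mult_left(2)[OF xa \<alpha> ac \<delta>] zero_nonunit by simp
    qed
    then show "RD.cmp x \<alpha> \<in> {x \<in> carrier R. x \<otimes>\<^bsub>R\<^esub> a \<in> nonunit_ideal}"
      using x \<alpha> ac by (auto simp: nonunit_ideal_def)
  qed
  then show "x \<otimes>\<^bsub>R\<^esub> a \<in> nonunit_ideal" by simp
  have "x \<in> {x \<in> carrier R. a \<otimes>\<^bsub>R\<^esub> x \<in> nonunit_ideal}"
  proof (rule RD.mem_subgroupI[OF _ x])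
    show "additive_subgroup {x \<in> carrier R. a \<otimes>\<^bsub>R\<^esub> x \<in> nonunit_ideal} R"
      using ac additive_subgroup.a_closed[OF nonunit_ideal_subgroup]
        additive_subgroup.a_inv_closed[OF nonunit_ideal_subgroup]
        additive_subgroup.zero_closed[OF nonunit_ideal_subgroup]
      by (intro additive_subgroupI R.add.subgroupI) (auto simp: R.r_distr R.r_minus)
    fix \<alpha> assume \<alpha>: "\<alpha> \<in> carrier G"
    have xa: "RD.cmp x \<alpha> \<in> \<A> \<alpha>" using x \<alpha> by (rule RD.component_in_part)
    have "RD.cmp (a \<otimes>\<^bsub>R\<^esub> RD.cmp x \<alpha>) \<delta> \<notin> Units R" if \<delta>: "\<delta> \<in> carrier G" for \<delta>
    proof (cases "\<delta> \<in> (\<lambda>\<gamma>. \<gamma> \<otimes>\<^bsub>G\<^esub> \<alpha>) ` carrier G")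
      case True
      then obtain \<gamma> where \<gamma>: "\<gamma> \<in> carrier G" "\<delta> = \<gamma> \<otimes>\<^bsub>G\<^esub> \<alpha>" by blast
      then show ?thesis
        using component_mult_right(1)[OF xa \<alpha> ac \<gamma>(1)] a
          mult_unit_factors(1)[OF RD.component_in_part[OF ac \<gamma>(1)] \<gamma>(1) xa \<alpha>]
        by (auto simp: nonunit_ideal_def)
    next
      case False
      then show ?thesis using component_mult_right(2)[OF xa \<alpha> ac \<delta>] zero_nonunit by simp
    qed
    then show "RD.cmp x \<alpha> \<in> {x \<in> carrier R. a \<otimes>\<^bsub>R\<^esub> x \<in> nonunit_ideal}"
      using x \<alpha> ac by (auto simp: nonunit_ideal_def)
  qed
  then show "a \<otimes>\<^bsub>R\<^esub> x \<in> nonunit_ideal" by simp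
qed (rule R.ring_axioms)

text \<open>An element of a generated ideal has no visible shape, whereas membership in
  \<open>nonunit_ideal\<close> is tested degree by degree. One inclusion rests on the componentwise
  set being an ideal; for the other, each component is zero or one of the generators.\<close>

lemma max_graded_ideal_eq: "max_graded_ideal G R \<A> = nonunit_ideal"
proof
  let ?S = "homogeneous G R \<A> - Units R"
  have "?S \<subseteq> nonunit_ideal"
  proof
    fix a assume "a \<in> ?S"
    then obtain \<gamma> where \<gamma>: "\<gamma> \<in> carrier G" "a \<in> \<A> \<gamma>" "a \<notin> Units R" by (auto simp: homogeneous_def)
    then show "a \<in> nonunit_ideal"
      using RD.part_carrier RD.component_of_part[OF \<gamma>(2,1)] zero_nonunit
      by (auto simp: nonunit_ideal_def)
  qed
  then show "max_graded_ideal G R \<A> \<subseteq> nonunit_ideal"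
    unfolding max_graded_ideal_def using nonunit_ideal_ideal by (intro R.genideal_minimal)
  show "nonunit_ideal \<subseteq> max_graded_ideal G R \<A>"
  proof
    fix a assume a: "a \<in> nonunit_ideal"
    have "?S \<subseteq> carrier R" using RD.part_carrier by (auto simp: homogeneous_def)
    then have I: "ideal (max_graded_ideal G R \<A>) R" and S: "?S \<subseteq> max_graded_ideal G R \<A>"
      unfolding max_graded_ideal_def by (auto intro: R.genideal_ideal dest: R.genideal_self)
    interpret I: ideal "max_graded_ideal G R \<A>" R by (rule I)
    show "a \<in> max_graded_ideal G R \<A>"
    proof (rule RD.mem_subgroupI[OF I.is_additive_subgroup])
      show ac: "a \<in> carrier R" using a by (simp add: nonunit_ideal_def)
      fix \<gamma> assume \<gamma>: "\<gamma> \<in> carrier G"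
      show "RD.cmp a \<gamma> \<in> max_graded_ideal G R \<A>"
      proof (cases "RD.cmp a \<gamma> = \<zero>\<^bsub>R\<^esub>")
        case False
        then have "RD.cmp a \<gamma> \<in> ?S"
          using a \<gamma> RD.component_in_part[OF ac \<gamma>] by (auto simp: homogeneous_def nonunit_ideal_def)
        then show ?thesis using S by blast
      qed simp
    qed
  qed
qed

text \<open>Expresses that the ideal is graded, as \<open>ideal_smult_graded\<close>
  requires.\<close>

lemma component_nonunit_ideal:
  assumes "a \<in> nonunit_ideal" "\<gamma> \<in> carrier G"
  shows "RD.cmp a \<gamma> \<in> nonunit_ideal"
  using assms RD.component_of_part[OF RD.component_in_part[OF _ assms(2)] assms(2)] zero_nonunit
  by (auto simp: nonunit_ideal_def)

end


section \<open>Graded modules\<close>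

lemma mem_set_add: "x \<in> H <+>\<^bsub>M\<^esub> K \<longleftrightarrow> (\<exists>h\<in>H. \<exists>k\<in>K. x = h \<oplus>\<^bsub>M\<^esub> k)"
  by (auto simp: set_add_def')

section \<open>Submodules and generation\<close>

context left_module
begin

lemma submodule_subset:
  assumes "submodule H R M" shows "H \<subseteq> carrier M"
  using subgroup.subset[OF submodule.axioms(1)[OF assms]] by simp

lemma submodule_zero:
  assumes "submodule H R M" shows "\<zero>\<^bsub>M\<^esub> \<in> H"
  using subgroup.one_closed[OF submodule.axioms(1)[OF assms]] by simp

lemma submodule_add:
  assumes "submodule H R M" "x \<in> H" "y \<in> H" shows "x \<oplus>\<^bsub>M\<^esub> y \<in> H"
  using subgroup.m_closed[OF submodule.axioms(1)[OF assms(1)]] assms(2,3) by simp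

lemma submodule_smult:
  assumes "submodule H R M" "a \<in> carrier R" "x \<in> H" shows "a \<odot>\<^bsub>M\<^esub> x \<in> H"
  using submodule.smult_closed[OF assms] .

lemma submodule_additive_subgroup:
  assumes "submodule H R M" shows "additive_subgroup H M"
  using submodule.axioms(1)[OF assms] by (rule additive_subgroupI)

lemma smult_uminus:
  assumes "x \<in> carrier M" shows "(\<ominus>\<^bsub>R\<^esub> \<one>\<^bsub>R\<^esub>) \<odot>\<^bsub>M\<^esub> x = \<ominus>\<^bsub>M\<^esub> x"
proof -
  have "(\<ominus>\<^bsub>R\<^esub> \<one>\<^bsub>R\<^esub>) \<odot>\<^bsub>M\<^esub> x \<oplus>\<^bsub>M\<^esub> x = (\<ominus>\<^bsub>R\<^esub> \<one>\<^bsub>R\<^esub> \<oplus>\<^bsub>R\<^esub> \<one>\<^bsub>R\<^esub>) \<odot>\<^bsub>M\<^esub> x"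
    using assms by (subst smult_l_distr) auto
  also have "\<dots> = \<zero>\<^bsub>M\<^esub>" using assms by (simp add: R.l_neg)
  finally show ?thesis using assms M.minus_equality by simp
qed

text \<open>Closure under negation comes from the scalar -1.\<close>

lemma submoduleI:
  assumes "H \<subseteq> carrier M" "\<zero>\<^bsub>M\<^esub> \<in> H" "\<And>x y. \<lbrakk>x \<in> H; y \<in> H\<rbrakk> \<Longrightarrow> x \<oplus>\<^bsub>M\<^esub> y \<in> H"
    and smult: "\<And>a x. \<lbrakk>a \<in> carrier R; x \<in> H\<rbrakk> \<Longrightarrow> a \<odot>\<^bsub>M\<^esub> x \<in> H"
  shows "submodule H R M"
proof (intro submodule.intro submodule_axioms.intro M.add.subgroupI)
  fix x assume "x \<in> H"
  then show "\<ominus>\<^bsub>M\<^esub> x \<in> H" using smult[of "\<ominus>\<^bsub>R\<^esub> \<one>\<^bsub>R\<^esub>" x] smult_uminus assms(1) by auto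
qed (use assms in auto)

lemma submodule_gen_submodule:
  assumes "S \<subseteq> carrier M" shows "submodule (submodule_gen R M S) R M"
proof (rule submoduleI)
  have "submodule (carrier M) R M" by (rule submoduleI) auto
  then show "submodule_gen R M S \<subseteq> carrier M" using assms by (auto simp: submodule_gen_def)
qed (auto simp: submodule_gen_def intro: submodule_zero submodule_add submodule_smult)

lemma submodule_gen_incl: "S \<subseteq> submodule_gen R M S"
  by (auto simp: submodule_gen_def)

lemma submodule_gen_least:
  assumes "submodule H R M" "S \<subseteq> H" shows "submodule_gen R M S \<subseteq> H"
  using assms by (auto simp: submodule_gen_def)

lemma submodule_gen_self:
  assumes "submodule H R M" shows "submodule_gen R M H = H"
  using submodule_gen_least[OF assms order_refl] submodule_gen_incl by blast

lemma submodule_gen_eq_carrierI: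
  assumes "submodule_gen R M S = carrier M" "T \<subseteq> carrier M" "S \<subseteq> submodule_gen R M T"
  shows "submodule_gen R M T = carrier M"
  using submodule_gen_least[OF submodule_gen_submodule[OF assms(2)] assms(3)]
    submodule_subset[OF submodule_gen_submodule[OF assms(2)]] assms(1) by blast

text \<open>Serves twice: with the whole ring for \<open>I\<close> it describes the submodule
  generated by \<open>H\<close> and \<open>x\<close>, and with the maximal graded ideal it bounds
  that ideal times \<open>M\<close> in the Nakayama step.\<close>

lemma submodule_add_ideal_multiples:
  assumes H: "submodule H R M" and x: "x \<in> carrier M" and I: "left_ideal I R"
  shows "submodule {h \<oplus>\<^bsub>M\<^esub> a \<odot>\<^bsub>M\<^esub> x | h a. h \<in> H \<and> a \<in> I} R M" (is "submodule ?T R M")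
proof -
  interpret I: additive_subgroup I R using I by (simp add: left_ideal_def)
  have Hc: "h \<in> carrier M" if "h \<in> H" for h using submodule_subset[OF H] that by blast
  show ?thesis
  proof (rule submoduleI)
    show "?T \<subseteq> carrier M" using Hc x by auto
    have "\<zero>\<^bsub>M\<^esub> = \<zero>\<^bsub>M\<^esub> \<oplus>\<^bsub>M\<^esub> \<zero>\<^bsub>R\<^esub> \<odot>\<^bsub>M\<^esub> x" using x by simp
    then show "\<zero>\<^bsub>M\<^esub> \<in> ?T" using submodule_zero[OF H] I.zero_closed by blast
  next
    fix y z assume "y \<in> ?T" "z \<in> ?T"
    then obtain h a k b where hk: "h \<in> H" "k \<in> H" and ab: "a \<in> I" "b \<in> I"
      and y: "y = h \<oplus>\<^bsub>M\<^esub> a \<odot>\<^bsub>M\<^esub> x" and z: "z = k \<oplus>\<^bsub>M\<^esub> b \<odot>\<^bsub>M\<^esub> x" by blast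
    have "y \<oplus>\<^bsub>M\<^esub> z = (h \<oplus>\<^bsub>M\<^esub> k) \<oplus>\<^bsub>M\<^esub> (a \<oplus>\<^bsub>R\<^esub> b) \<odot>\<^bsub>M\<^esub> x"
      unfolding y z using hk ab x Hc by (simp add: smult_l_distr M.a_ac)
    then show "y \<oplus>\<^bsub>M\<^esub> z \<in> ?T" using submodule_add[OF H hk] ab I.a_closed by blast
  next
    fix c y assume c: "c \<in> carrier R" and "y \<in> ?T"
    then obtain h a where h: "h \<in> H" and a: "a \<in> I" and y: "y = h \<oplus>\<^bsub>M\<^esub> a \<odot>\<^bsub>M\<^esub> x" by blast
    have "c \<odot>\<^bsub>M\<^esub> y = c \<odot>\<^bsub>M\<^esub> h \<oplus>\<^bsub>M\<^esub> (c \<otimes>\<^bsub>R\<^esub> a) \<odot>\<^bsub>M\<^esub> x"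
      unfolding y using c h a x Hc by (simp add: smult_r_distr smult_assoc)
    moreover have "c \<otimes>\<^bsub>R\<^esub> a \<in> I" using I c a by (simp add: left_ideal_def)
    ultimately show "c \<odot>\<^bsub>M\<^esub> y \<in> ?T" using submodule_smult[OF H c h] by blast
  qed
qed

lemma submodule_gen_insert:
  assumes H: "submodule H R M" and x: "x \<in> carrier M" and y: "y \<in> submodule_gen R M (insert x H)"
  obtains h a where "h \<in> H" "a \<in> carrier R" "y = h \<oplus>\<^bsub>M\<^esub> a \<odot>\<^bsub>M\<^esub> x"
proof -
  let ?T = "{h \<oplus>\<^bsub>M\<^esub> a \<odot>\<^bsub>M\<^esub> x | h a. h \<in> H \<and> a \<in> carrier R}"
  have Hc: "h \<in> carrier M" if "h \<in> H" for h using submodule_subset[OF H] that by blast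
  have "left_ideal (carrier R) R"
    by (auto simp: left_ideal_def intro!: additive_subgroupI R.add.subgroup_self)
  then have T: "submodule ?T R M" by (rule submodule_add_ideal_multiples[OF H x])
  have "x = \<zero>\<^bsub>M\<^esub> \<oplus>\<^bsub>M\<^esub> \<one>\<^bsub>R\<^esub> \<odot>\<^bsub>M\<^esub> x" using x by simp
  then have "x \<in> ?T" using submodule_zero[OF H] by blast
  moreover have "h \<in> ?T" if "h \<in> H" for h
  proof -
    have "h = h \<oplus>\<^bsub>M\<^esub> \<zero>\<^bsub>R\<^esub> \<odot>\<^bsub>M\<^esub> x" using x Hc[OF that] by simp
    then show ?thesis using that by blast
  qed
  ultimately have "submodule_gen R M (insert x H) \<subseteq> ?T" by (intro submodule_gen_least[OF T]) auto
  then show ?thesis using y that by blast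
qed

end

section \<open>Components in a graded module and graded submodules\<close>

locale cancel_graded_module = cancel_graded_ring G R \<A> + M: abelian_group M + graded_module G R \<A> M \<M>
  for G :: "('g, 'h) monoid_scheme" and R :: "('a, 'r) ring_scheme" and \<A> :: "'g \<Rightarrow> 'a set"
    and M :: "('a, 'm, 's) module_scheme" and \<M> :: "'g \<Rightarrow> 'm set"
begin

sublocale MD: direct_sum M "carrier G" \<M>
  by (intro direct_sum.intro M.abelian_group_axioms direct_sum_axioms.intro module_direct_sum)

lemma component_smult_left:
  assumes "a \<in> \<A> \<alpha>" "\<alpha> \<in> carrier G" "x \<in> carrier M"
  shows "\<gamma> \<in> carrier G \<Longrightarrow> MD.cmp (a \<odot>\<^bsub>M\<^esub> x) (\<alpha> \<otimes>\<^bsub>G\<^esub> \<gamma>) = a \<odot>\<^bsub>M\<^esub> MD.cmp x \<gamma>"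
    and "\<lbrakk>\<delta> \<in> carrier G; \<delta> \<notin> (\<lambda>\<gamma>. \<alpha> \<otimes>\<^bsub>G\<^esub> \<gamma>) ` carrier G\<rbrakk> \<Longrightarrow> MD.cmp (a \<odot>\<^bsub>M\<^esub> x) \<delta> = \<zero>\<^bsub>M\<^esub>"
proof -
  have "(\<lambda>x. a \<odot>\<^bsub>M\<^esub> x) \<in> hom (add_monoid M) (add_monoid M)"
    using RD.part_carrier[OF assms(1,2)] by (auto simp: hom_def smult_r_distr)
  note * = component_additive[OF MD.direct_sum_axioms MD.direct_sum_axioms this
      translate_left_inj[OF assms(2)]]
  show "\<gamma> \<in> carrier G \<Longrightarrow> MD.cmp (a \<odot>\<^bsub>M\<^esub> x) (\<alpha> \<otimes>\<^bsub>G\<^esub> \<gamma>) = a \<odot>\<^bsub>M\<^esub> MD.cmp x \<gamma>"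
    "\<lbrakk>\<delta> \<in> carrier G; \<delta> \<notin> (\<lambda>\<gamma>. \<alpha> \<otimes>\<^bsub>G\<^esub> \<gamma>) ` carrier G\<rbrakk> \<Longrightarrow> MD.cmp (a \<odot>\<^bsub>M\<^esub> x) \<delta> = \<zero>\<^bsub>M\<^esub>"
    by (rule *; use assms module_degree in auto)+
qed

lemma component_smult_right:
  assumes "x \<in> \<M> \<alpha>" "\<alpha> \<in> carrier G" "a \<in> carrier R"
  shows "\<gamma> \<in> carrier G \<Longrightarrow> MD.cmp (a \<odot>\<^bsub>M\<^esub> x) (\<gamma> \<otimes>\<^bsub>G\<^esub> \<alpha>) = RD.cmp a \<gamma> \<odot>\<^bsub>M\<^esub> x"
    and "\<lbrakk>\<delta> \<in> carrier G; \<delta> \<notin> (\<lambda>\<gamma>. \<gamma> \<otimes>\<^bsub>G\<^esub> \<alpha>) ` carrier G\<rbrakk> \<Longrightarrow> MD.cmp (a \<odot>\<^bsub>M\<^esub> x) \<delta> = \<zero>\<^bsub>M\<^esub>"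
proof -
  have "(\<lambda>a. a \<odot>\<^bsub>M\<^esub> x) \<in> hom (add_monoid R) (add_monoid M)"
    using MD.part_carrier[OF assms(1,2)] by (auto simp: hom_def smult_l_distr)
  note * = component_additive[OF RD.direct_sum_axioms MD.direct_sum_axioms this
      translate_right_inj[OF assms(2)]]
  show "\<gamma> \<in> carrier G \<Longrightarrow> MD.cmp (a \<odot>\<^bsub>M\<^esub> x) (\<gamma> \<otimes>\<^bsub>G\<^esub> \<alpha>) = RD.cmp a \<gamma> \<odot>\<^bsub>M\<^esub> x"
    "\<lbrakk>\<delta> \<in> carrier G; \<delta> \<notin> (\<lambda>\<gamma>. \<gamma> \<otimes>\<^bsub>G\<^esub> \<alpha>) ` carrier G\<rbrakk> \<Longrightarrow> MD.cmp (a \<odot>\<^bsub>M\<^esub> x) \<delta> = \<zero>\<^bsub>M\<^esub>"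
    by (rule *; use assms module_degree in auto)+
qed

text \<open>A direct computation would sum over all factorizations \<delta> = \<alpha>\<gamma>.
  Instead, the scalars that satisfy the claim for fixed \<open>x\<close> and \<delta> form an
  additive subgroup, so \<open>a\<close> may be taken homogeneous, and then at most one component of
  \<open>x\<close> is carried into degree \<delta>.\<close>

lemma component_smult_mem:
  assumes K: "submodule K R M" and a: "a \<in> carrier R" and x: "x \<in> carrier M"
    and mem: "\<And>\<alpha> \<gamma>. \<lbrakk>\<alpha> \<in> carrier G; \<gamma> \<in> carrier G\<rbrakk> \<Longrightarrow> RD.cmp a \<alpha> \<odot>\<^bsub>M\<^esub> MD.cmp x \<gamma> \<in> K"
    and \<delta>: "\<delta> \<in> carrier G"
  shows "MD.cmp (a \<odot>\<^bsub>M\<^esub> x) \<delta> \<in> K"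
proof -
  interpret K: additive_subgroup K M using K by (rule submodule_additive_subgroup)
  let ?H = "{b \<in> carrier R. MD.cmp (b \<odot>\<^bsub>M\<^esub> x) \<delta> \<in> K}"
  have neg: "(\<ominus>\<^bsub>R\<^esub> b) \<odot>\<^bsub>M\<^esub> x = \<ominus>\<^bsub>M\<^esub> (b \<odot>\<^bsub>M\<^esub> x)" if "b \<in> carrier R" for b
    using smult_assoc[of "\<ominus>\<^bsub>R\<^esub> \<one>\<^bsub>R\<^esub>" b x] smult_uminus[of "b \<odot>\<^bsub>M\<^esub> x"] that x by (simp add: R.l_minus)
  have "additive_subgroup ?H R"
    using x \<delta> by (intro additive_subgroupI R.add.subgroupI)
      (auto simp: smult_l_distr MD.component_add neg MD.component_uminus intro: exI[of _ "\<zero>\<^bsub>R\<^esub>"])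
  then have "a \<in> ?H"
  proof (rule RD.mem_subgroupI[OF _ a])
    fix \<alpha> assume \<alpha>: "\<alpha> \<in> carrier G"
    note a\<alpha> = RD.component_in_part[OF a \<alpha>]
    have "MD.cmp (RD.cmp a \<alpha> \<odot>\<^bsub>M\<^esub> x) \<delta> \<in> K"
    proof (cases "\<delta> \<in> (\<lambda>\<gamma>. \<alpha> \<otimes>\<^bsub>G\<^esub> \<gamma>) ` carrier G")
      case True
      then show ?thesis using component_smult_left(1)[OF a\<alpha> \<alpha> x] mem[OF \<alpha>] by auto
    next
      case False
      then show ?thesis using component_smult_left(2)[OF a\<alpha> \<alpha> x \<delta>] by simp
    qed
    then show "RD.cmp a \<alpha> \<in> ?H" using a \<alpha> by simp
  qed
  then show ?thesis by simp
qed

text \<open>The elements of the generated submodule all of whose components stay inside it form a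
  submodule that contains \<open>S\<close>.\<close>

lemma submodule_gen_component:
  assumes S: "S \<subseteq> carrier M"
    and mem: "\<And>x \<gamma>. \<lbrakk>x \<in> S; \<gamma> \<in> carrier G\<rbrakk> \<Longrightarrow> MD.cmp x \<gamma> \<in> submodule_gen R M S"
    and x: "x \<in> submodule_gen R M S" and \<gamma>: "\<gamma> \<in> carrier G"
  shows "MD.cmp x \<gamma> \<in> submodule_gen R M S"
proof -
  let ?N = "submodule_gen R M S"
  let ?T = "{x \<in> ?N. \<forall>\<gamma>\<in>carrier G. MD.cmp x \<gamma> \<in> ?N}"
  note N = submodule_gen_submodule[OF S]
  have Nc: "x \<in> carrier M" if "x \<in> ?N" for x using submodule_subset[OF N] that by blast
  have "submodule ?T R M"
  proof (rule submoduleI)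
    fix x y assume "x \<in> ?T" "y \<in> ?T"
    then show "x \<oplus>\<^bsub>M\<^esub> y \<in> ?T" using Nc by (auto simp: MD.component_add intro!: submodule_add[OF N])
  next
    fix a x assume a: "a \<in> carrier R" and x: "x \<in> ?T"
    have "MD.cmp (a \<odot>\<^bsub>M\<^esub> x) \<delta> \<in> ?N" if "\<delta> \<in> carrier G" for \<delta>
      using a x that Nc by (intro component_smult_mem[OF N a]) (auto intro!: submodule_smult[OF N])
    then show "a \<odot>\<^bsub>M\<^esub> x \<in> ?T" using submodule_smult[OF N a] x by blast
  qed (use submodule_zero[OF N] submodule_subset[OF N] in auto)
  then have "?N \<subseteq> ?T" using mem submodule_gen_incl by (intro submodule_gen_least) blast+
  then show ?thesis using x \<gamma> by blast
qed

text \<open>Closure under components is the working form of gradedness, as it mentions no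
  generators. A submodule with this property is generated by the homogeneous elements it contains,
  because each element is the sum of its components.\<close>

lemma graded_submodule_iff:
  "graded_submodule G R M \<M> H \<longleftrightarrow>
    submodule H R M \<and> (\<forall>x\<in>H. \<forall>\<gamma>\<in>carrier G. MD.cmp x \<gamma> \<in> H)"
proof
  assume "graded_submodule G R M \<M> H"
  then obtain S where S: "S \<subseteq> homogeneous G M \<M>" "H = submodule_gen R M S"
    by (auto simp: graded_submodule_def)
  have Sc: "S \<subseteq> carrier M" using S(1) MD.part_carrier by (auto simp: homogeneous_def)
  have "MD.cmp x \<gamma> \<in> H" if x: "x \<in> S" and \<gamma>: "\<gamma> \<in> carrier G" for x \<gamma>
  proof -
    obtain \<delta> where "\<delta> \<in> carrier G" "x \<in> \<M> \<delta>" using x S(1) by (auto simp: homogeneous_def)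
    then show ?thesis
      using MD.component_of_part[of x \<delta> \<gamma>] \<gamma> x submodule_gen_incl[of S] S(2)
        submodule_zero[OF submodule_gen_submodule[OF Sc]] by auto
  qed
  then show "submodule H R M \<and> (\<forall>x\<in>H. \<forall>\<gamma>\<in>carrier G. MD.cmp x \<gamma> \<in> H)"
    using submodule_gen_component[OF Sc] submodule_gen_submodule[OF Sc] S(2) by auto
next
  assume R: "submodule H R M \<and> (\<forall>x\<in>H. \<forall>\<gamma>\<in>carrier G. MD.cmp x \<gamma> \<in> H)"
  then have H: "submodule H R M" by blast
  let ?S = "H \<inter> homogeneous G M \<M>"
  have Sc: "?S \<subseteq> carrier M" using submodule_subset[OF H] by blast
  note N = submodule_gen_submodule[OF Sc]
  have "x \<in> submodule_gen R M ?S" if x: "x \<in> H" for x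
  proof (rule MD.mem_subgroupI[OF submodule_additive_subgroup[OF N]])
    show xc: "x \<in> carrier M" using x submodule_subset[OF H] by blast
    fix \<gamma> assume \<gamma>: "\<gamma> \<in> carrier G"
    show "MD.cmp x \<gamma> \<in> submodule_gen R M ?S"
    proof (cases "MD.cmp x \<gamma> = \<zero>\<^bsub>M\<^esub>")
      case False
      then have "MD.cmp x \<gamma> \<in> ?S"
        using R x \<gamma> MD.component_in_part[OF xc \<gamma>] by (auto simp: homogeneous_def)
      then show ?thesis using submodule_gen_incl by blast
    qed (simp add: submodule_zero[OF N])
  qed
  then have "H = submodule_gen R M ?S" using submodule_gen_least[OF H, of ?S] by blast
  then show "graded_submodule G R M \<M> H" unfolding graded_submodule_def by blast
qed

text \<open>Keeps the enlarged submodules graded in the induction of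
  \<open>nakayama\<close>.\<close>

lemma graded_submodule_gen:
  assumes "X \<subseteq> homogeneous G M \<M>" "graded_submodule G R M \<M> H"
  shows "graded_submodule G R M \<M> (submodule_gen R M (X \<union> H))"
proof -
  have H: "submodule H R M" "\<forall>x\<in>H. \<forall>\<gamma>\<in>carrier G. MD.cmp x \<gamma> \<in> H"
    using assms(2) by (auto simp: graded_submodule_iff)
  have c: "X \<union> H \<subseteq> carrier M"
    using assms(1) MD.part_carrier submodule_subset[OF H(1)] by (auto simp: homogeneous_def)
  have "MD.cmp x \<gamma> \<in> submodule_gen R M (X \<union> H)"
    if x: "x \<in> X \<union> H" and \<gamma>: "\<gamma> \<in> carrier G" for x \<gamma>
  proof (cases "x \<in> H")
    case True
    then show ?thesis using H(2) \<gamma> submodule_gen_incl[of "X \<union> H"] by blast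
  next
    case False
    then obtain \<delta> where "\<delta> \<in> carrier G" "x \<in> \<M> \<delta>" using x assms(1) by (auto simp: homogeneous_def)
    then show ?thesis
      using MD.component_of_part[of x \<delta> \<gamma>] \<gamma> x submodule_gen_incl[of "X \<union> H"]
        submodule_zero[OF submodule_gen_submodule[OF c]] by auto
  qed
  then show ?thesis
    using submodule_gen_component[OF c] submodule_gen_submodule[OF c] by (auto simp: graded_submodule_iff)
qed

text \<open>The nonzero components of the given generators serve; each support is finite.\<close>

lemma homogeneous_generators:
  assumes "fin_gen_module R M"
  obtains X where "finite X" "X \<subseteq> homogeneous G M \<M>" "submodule_gen R M X = carrier M"
proof -
  obtain S where S: "finite S" "S \<subseteq> carrier M" "submodule_gen R M S = carrier M"
    using assms by (auto simp: fin_gen_module_def)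
  define X where "X = (\<Union>s\<in>S. MD.cmp s ` {\<gamma> \<in> carrier G. MD.cmp s \<gamma> \<noteq> \<zero>\<^bsub>M\<^esub>})"
  have "finite X" using S by (auto simp: X_def)
  moreover have "MD.cmp s \<gamma> \<in> homogeneous G M \<M>"
    if "s \<in> S" "\<gamma> \<in> carrier G" "MD.cmp s \<gamma> \<noteq> \<zero>\<^bsub>M\<^esub>" for s \<gamma>
    using that S(2) MD.component_in_part[of s \<gamma>] by (auto simp: homogeneous_def)
  then have "X \<subseteq> homogeneous G M \<M>" by (auto simp: X_def)
  ultimately have X: "finite X" "X \<subseteq> homogeneous G M \<M>" .
  have Xc: "X \<subseteq> carrier M" using X(2) MD.part_carrier by (auto simp: homogeneous_def)
  have "S \<subseteq> submodule_gen R M X"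
  proof
    fix s assume s: "s \<in> S"
    show "s \<in> submodule_gen R M X"
    proof (rule MD.mem_subgroupI[OF submodule_additive_subgroup[OF submodule_gen_submodule[OF Xc]]])
      show "s \<in> carrier M" using s S by blast
      fix \<gamma> assume "\<gamma> \<in> carrier G"
      then have "MD.cmp s \<gamma> = \<zero>\<^bsub>M\<^esub> \<or> MD.cmp s \<gamma> \<in> X" using s by (auto simp: X_def)
      then show "MD.cmp s \<gamma> \<in> submodule_gen R M X"
        using submodule_gen_incl[of X] submodule_zero[OF submodule_gen_submodule[OF Xc]] by auto
    qed
  qed
  then have "submodule_gen R M X = carrier M" by (rule submodule_gen_eq_carrierI[OF S(3) Xc])
  then show ?thesis using that X by blast
qed

end


section \<open>The graded Nakayama lemma\<close>

locale local_graded_module = cancel_graded_local_ring G R \<A> + cancel_graded_module G R \<A> M \<M>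
  for G :: "('g, 'h) monoid_scheme" and R :: "('a, 'r) ring_scheme" and \<A> :: "'g \<Rightarrow> 'a set"
    and M :: "('a, 'm, 's) module_scheme" and \<M> :: "'g \<Rightarrow> 'm set"
begin

lemma nonunit_multiples_subset: "{a \<odot>\<^bsub>M\<^esub> x | a x. a \<in> nonunit_ideal \<and> x \<in> carrier M} \<subseteq> carrier M"
  by (auto simp: nonunit_ideal_def)

lemma ideal_smult_submodule: "submodule (ideal_smult R nonunit_ideal M) R M"
  unfolding ideal_smult_def by (rule submodule_gen_submodule[OF nonunit_multiples_subset])

lemma ideal_smult_graded: "graded_submodule G R M \<M> (ideal_smult R nonunit_ideal M)"
proof -
  let ?S = "{a \<odot>\<^bsub>M\<^esub> x | a x. a \<in> nonunit_ideal \<and> x \<in> carrier M}"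
  note N = submodule_gen_submodule[OF nonunit_multiples_subset]
  have "MD.cmp z \<delta> \<in> submodule_gen R M ?S" if z: "z \<in> ?S" and \<delta>: "\<delta> \<in> carrier G" for z \<delta>
  proof -
    obtain a x where ax: "a \<in> nonunit_ideal" "x \<in> carrier M" "z = a \<odot>\<^bsub>M\<^esub> x" using z by blast
    have "RD.cmp a \<alpha> \<odot>\<^bsub>M\<^esub> MD.cmp x \<gamma> \<in> ?S" if "\<alpha> \<in> carrier G" "\<gamma> \<in> carrier G" for \<alpha> \<gamma>
      using component_nonunit_ideal[OF ax(1) that(1)] MD.component_closed[OF ax(2) that(2)] by blast
    then show ?thesis
      using ax \<delta> submodule_gen_incl[of ?S] unfolding ax(3)
      by (intro component_smult_mem[OF N]) (auto simp: nonunit_ideal_def)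
  qed
  then show ?thesis
    unfolding graded_submodule_iff ideal_smult_def
    using N submodule_gen_component[OF nonunit_multiples_subset] by blast
qed

text \<open>Writing \<open>x = k + m x\<close> with \<open>k \<in> H\<close> and \<open>m\<close> in the maximal graded ideal, the component in the
  degree of \<open>x\<close> reads \<open>(1 - m\<^sub>e) x \<in> H\<close> by right cancelation, and \<open>1 - m\<^sub>e\<close> is a unit.\<close>

lemma nakayama_one_generator:
  assumes H: "graded_submodule G R M \<M> H" and x: "x \<in> \<M> \<gamma>" "\<gamma> \<in> carrier G"
    and gen: "submodule_gen R M (insert x H) = carrier M"
    and sum: "H <+>\<^bsub>M\<^esub> ideal_smult R nonunit_ideal M = carrier M"
  shows "x \<in> H"
proof -
  have Hs: "submodule H R M" and Hcmp: "\<And>y. y \<in> H \<Longrightarrow> MD.cmp y \<gamma> \<in> H"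
    using H x(2) by (auto simp: graded_submodule_iff)
  have Hc: "h \<in> carrier M" if "h \<in> H" for h using submodule_subset[OF Hs] that by blast
  have xc: "x \<in> carrier M" using MD.part_carrier[OF x] .
  interpret I: ideal nonunit_ideal R by (rule nonunit_ideal_ideal)
  let ?T = "{h \<oplus>\<^bsub>M\<^esub> a \<odot>\<^bsub>M\<^esub> x | h a. h \<in> H \<and> a \<in> nonunit_ideal}"
  have "left_ideal nonunit_ideal R"
    using I.is_additive_subgroup I.I_l_closed by (simp add: left_ideal_def)
  then have T: "submodule ?T R M" by (rule submodule_add_ideal_multiples[OF Hs xc])
  \<comment> \<open>Every y is h + bx with h in \<open>H\<close>, so ay = ah + (ab)x, and ab stays
    in the ideal because the ideal absorbs factors on the right as well.\<close>
  have "ideal_smult R nonunit_ideal M \<subseteq> ?T"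
    unfolding ideal_smult_def
  proof (rule submodule_gen_least[OF T], safe)
    fix a y assume a: "a \<in> nonunit_ideal" and y: "y \<in> carrier M"
    have "y \<in> submodule_gen R M (insert x H)" using y gen by simp
    then obtain h b where hb: "h \<in> H" "b \<in> carrier R" "y = h \<oplus>\<^bsub>M\<^esub> b \<odot>\<^bsub>M\<^esub> x"
      by (rule submodule_gen_insert[OF Hs xc])
    have ac: "a \<in> carrier R" using a by (rule I.a_Hcarr)
    have "a \<odot>\<^bsub>M\<^esub> y = a \<odot>\<^bsub>M\<^esub> h \<oplus>\<^bsub>M\<^esub> (a \<otimes>\<^bsub>R\<^esub> b) \<odot>\<^bsub>M\<^esub> x"
      using hb ac Hc xc by (simp add: smult_r_distr smult_assoc)
    then show "\<exists>h c. a \<odot>\<^bsub>M\<^esub> y = h \<oplus>\<^bsub>M\<^esub> c \<odot>\<^bsub>M\<^esub> x \<and> h \<in> H \<and> c \<in> nonunit_ideal"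
      using submodule_smult[OF Hs ac hb(1)] I.I_r_closed[OF a hb(2)] by blast
  qed
  moreover have "x \<in> H <+>\<^bsub>M\<^esub> ideal_smult R nonunit_ideal M" using xc sum by simp
  ultimately obtain h t where h: "h \<in> H" and t: "t \<in> ?T" and xht: "x = h \<oplus>\<^bsub>M\<^esub> t"
    unfolding mem_set_add by blast
  obtain k m where km: "k \<in> H" "m \<in> nonunit_ideal" "t = k \<oplus>\<^bsub>M\<^esub> m \<odot>\<^bsub>M\<^esub> x" using t by blast
  have hkm: "h \<in> H" "k \<in> H" "m \<in> nonunit_ideal" "x = h \<oplus>\<^bsub>M\<^esub> (k \<oplus>\<^bsub>M\<^esub> m \<odot>\<^bsub>M\<^esub> x)"
    using h km xht by auto
  define l where "l = h \<oplus>\<^bsub>M\<^esub> k"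
  have l: "l \<in> H" "l \<in> carrier M" using submodule_add[OF Hs hkm(1,2)] Hc by (auto simp: l_def)
  have mc: "m \<in> carrier R" using hkm(3) by (rule I.a_Hcarr)
  have "x = l \<oplus>\<^bsub>M\<^esub> m \<odot>\<^bsub>M\<^esub> x" using hkm Hc xc mc by (simp add: l_def M.a_assoc)
  then have "MD.cmp x \<gamma> = MD.cmp l \<gamma> \<oplus>\<^bsub>M\<^esub> MD.cmp (m \<odot>\<^bsub>M\<^esub> x) \<gamma>"
    using MD.component_add[of l "m \<odot>\<^bsub>M\<^esub> x" \<gamma>] l mc xc x(2) by simp
  moreover have "MD.cmp (m \<odot>\<^bsub>M\<^esub> x) \<gamma> = RD.cmp m \<one>\<^bsub>G\<^esub> \<odot>\<^bsub>M\<^esub> x"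
    using component_smult_right(1)[OF x mc, of "\<one>\<^bsub>G\<^esub>"] x(2) by simp
  moreover have "MD.cmp x \<gamma> = x" using MD.component_of_part[OF x x(2)] by simp
  ultimately have eq: "x = MD.cmp l \<gamma> \<oplus>\<^bsub>M\<^esub> RD.cmp m \<one>\<^bsub>G\<^esub> \<odot>\<^bsub>M\<^esub> x" by simp
  define n where "n = RD.cmp m \<one>\<^bsub>G\<^esub>"
  have n: "n \<in> \<A> \<one>\<^bsub>G\<^esub>" "n \<in> carrier R"
    using RD.component_in_part[OF mc] RD.component_closed[OF mc] by (simp_all add: n_def)
  have n_nonunit: "n \<notin> Units R"
    using hkm(3) unfolding nonunit_ideal_def n_def by blast
  define u where "u = \<one>\<^bsub>R\<^esub> \<ominus>\<^bsub>R\<^esub> n"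
  have u: "u \<in> Units R" "u \<in> carrier R" "u \<oplus>\<^bsub>R\<^esub> n = \<one>\<^bsub>R\<^esub>"
    using unit_complement[OF n(1) n_nonunit] n(2) by (auto simp: u_def R.minus_eq R.a_assoc R.l_neg)
  have "u \<odot>\<^bsub>M\<^esub> x \<oplus>\<^bsub>M\<^esub> n \<odot>\<^bsub>M\<^esub> x = x"
    using smult_l_distr[OF u(2) n(2) xc] u(3) xc by simp
  also have "\<dots> = MD.cmp l \<gamma> \<oplus>\<^bsub>M\<^esub> n \<odot>\<^bsub>M\<^esub> x" using eq by (simp add: n_def)
  finally have "u \<odot>\<^bsub>M\<^esub> x = MD.cmp l \<gamma>"
    using u(2) n(2) xc MD.component_closed[OF l(2) x(2)] by (simp only: M.add.r_cancel smult_closed)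
  then have "u \<odot>\<^bsub>M\<^esub> x \<in> H" using Hcmp[OF l(1)] by simp
  then have "inv\<^bsub>R\<^esub> u \<odot>\<^bsub>M\<^esub> (u \<odot>\<^bsub>M\<^esub> x) \<in> H"
    by (rule submodule_smult[OF Hs R.Units_inv_closed[OF u(1)]])
  moreover have "inv\<^bsub>R\<^esub> u \<odot>\<^bsub>M\<^esub> (u \<odot>\<^bsub>M\<^esub> x) = x"
    using smult_assoc[OF R.Units_inv_closed[OF u(1)] u(2) xc] u(1) xc by simp
  ultimately show ?thesis by simp
qed

text \<open>Induction on the generators that complement \<open>H\<close>. Adjoining one of them, x,
  gives a graded \<open>K\<close> that needs one less and inherits the condition on the sum, so
  \<open>K\<close> is everything. Then \<open>H\<close> and x generate \<open>M\<close>, and the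
  case of one generator puts x into \<open>H\<close>. As the submodule changes in the induction, the
  claim is made for all \<open>H\<close> at once.\<close>

lemma nakayama:
  assumes "finite X" "X \<subseteq> homogeneous G M \<M>" "graded_submodule G R M \<M> H"
    and "submodule_gen R M (X \<union> H) = carrier M"
    and "H <+>\<^bsub>M\<^esub> ideal_smult R nonunit_ideal M = carrier M"
  shows "H = carrier M"
  using assms
proof (induction X arbitrary: H)
  case empty
  then show ?case using submodule_gen_self[of H] by (simp add: graded_submodule_iff)
next
  case (insert x X)
  obtain \<gamma> where x: "x \<in> \<M> \<gamma>" "\<gamma> \<in> carrier G" using insert.prems(1) by (auto simp: homogeneous_def)
  define K where "K = submodule_gen R M ({x} \<union> H)"
  have Hs: "submodule H R M" using insert.prems(2) by (simp add: graded_submodule_iff)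
  have K: "graded_submodule G R M \<M> K"
    using insert.prems(1,2) unfolding K_def by (intro graded_submodule_gen) auto
  then have Ks: "submodule K R M" by (simp add: graded_submodule_iff)
  have HK: "insert x H \<subseteq> K" using submodule_gen_incl[of "{x} \<union> H"] by (simp add: K_def)
  have XK: "X \<union> K \<subseteq> carrier M"
    using insert.prems(1) MD.part_carrier submodule_subset[OF Ks] by (auto simp: homogeneous_def)
  have "K = carrier M"
  proof (rule insert.IH[OF _ K])
    show "X \<subseteq> homogeneous G M \<M>" using insert.prems(1) by simp
    show "submodule_gen R M (X \<union> K) = carrier M"
      using HK submodule_gen_incl[of "X \<union> K"]
      by (intro submodule_gen_eq_carrierI[OF insert.prems(3) XK]) auto
    have "H <+>\<^bsub>M\<^esub> ideal_smult R nonunit_ideal M \<subseteq> K <+>\<^bsub>M\<^esub> ideal_smult R nonunit_ideal M"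
      using HK unfolding subset_iff mem_set_add by blast
    moreover have "K <+>\<^bsub>M\<^esub> ideal_smult R nonunit_ideal M \<subseteq> carrier M"
      using submodule_subset[OF Ks] submodule_subset[OF ideal_smult_submodule]
      by (auto simp: mem_set_add subset_iff)
    ultimately show "K <+>\<^bsub>M\<^esub> ideal_smult R nonunit_ideal M = carrier M"
      using insert.prems(4) by blast
  qed
  moreover from this have "x \<in> H"
    using nakayama_one_generator[OF insert.prems(2) x _ insert.prems(4)] by (simp add: K_def)
  then have "insert x H = H" by blast
  ultimately show ?case using submodule_gen_self[OF Hs] by (simp add: K_def)
qed

theorem ideal_smult_gr_superfluous:
  assumes "fin_gen_module R M"
  shows "gr_superfluous G R M \<M> (ideal_smult R (max_graded_ideal G R \<A>) M)"
proof -
  obtain X where X: "finite X" "X \<subseteq> homogeneous G M \<M>" "submodule_gen R M X = carrier M"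
    using homogeneous_generators[OF assms] .
  have "H = carrier M"
    if H: "graded_submodule G R M \<M> H"
      and sum: "H <+>\<^bsub>M\<^esub> ideal_smult R nonunit_ideal M = carrier M" for H
  proof (rule nakayama[OF X(1,2) H _ sum])
    have "X \<union> H \<subseteq> carrier M"
      using X(2) H MD.part_carrier submodule_subset by (auto simp: graded_submodule_iff homogeneous_def)
    then show "submodule_gen R M (X \<union> H) = carrier M"
      using submodule_gen_incl[of "X \<union> H"] by (intro submodule_gen_eq_carrierI[OF X(3)]) auto
  qed
  then show ?thesis using ideal_smult_graded by (simp add: gr_superfluous_def max_graded_ideal_eq)
qed

end


section \<open>Graded homomorphisms and uniqueness of projective covers\<close>

lemma graded_hom_component:
  assumes "cancel_graded_module G R \<A> M \<M>" "cancel_graded_module G R \<A> N \<N>"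
    and f: "f \<in> graded_hom G R M \<M> N \<N>" and "x \<in> carrier M" "\<gamma> \<in> carrier G"
  shows "component (carrier G) \<N> N (f x) \<gamma> = f (component (carrier G) \<M> M x \<gamma>)"
proof -
  interpret M: cancel_graded_module G R \<A> M \<M> by fact
  interpret N: cancel_graded_module G R \<A> N \<N> by fact
  show ?thesis
    by (rule component_additive(1)[OF M.MD.direct_sum_axioms N.MD.direct_sum_axioms, where \<sigma> = "\<lambda>i. i"])
      (use assms in \<open>fastforce simp: graded_hom_def mod_hom_def\<close>)+
qed

lemma graded_hom_image:
  assumes M: "cancel_graded_module G R \<A> M \<M>" and N: "cancel_graded_module G R \<A> N \<N>"
    and f: "f \<in> graded_hom G R M \<M> N \<N>"
  shows "graded_submodule G R N \<N> (f ` carrier M)"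
proof -
  interpret M: cancel_graded_module G R \<A> M \<M> by fact
  interpret N: cancel_graded_module G R \<A> N \<N> by fact
  have fh: "f \<in> mod_hom R M N" using f by (simp add: graded_hom_def)
  have "submodule (f ` carrier M) R N"
  proof (rule N.submoduleI)
    show "\<zero>\<^bsub>N\<^esub> \<in> f ` carrier M"
      using mod_hom_zero[OF M.left_module_axioms N.left_module_axioms fh] by force
  qed (auto simp: mod_homD(1)[OF fh] mod_homD(2,3)[OF fh, symmetric])
  moreover have "component (carrier G) \<N> N (f x) \<gamma> \<in> f ` carrier M"
    if "x \<in> carrier M" "\<gamma> \<in> carrier G" for x \<gamma>
    using graded_hom_component[OF M N f that] that by auto
  ultimately show ?thesis by (auto simp: N.graded_submodule_iff)
qed

lemma mem_a_kernel: "x \<in> a_kernel M N f \<longleftrightarrow> x \<in> carrier M \<and> f x = \<zero>\<^bsub>N\<^esub>"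
  by (auto simp: a_kernel_def kernel_def)

lemma graded_hom_kernel:
  assumes M: "cancel_graded_module G R \<A> M \<M>" and N: "cancel_graded_module G R \<A> N \<N>"
    and f: "f \<in> graded_hom G R M \<M> N \<N>"
  shows "graded_submodule G R M \<M> (a_kernel M N f)"
proof -
  interpret M: cancel_graded_module G R \<A> M \<M> by fact
  interpret N: cancel_graded_module G R \<A> N \<N> by fact
  have fh: "f \<in> mod_hom R M N" using f by (simp add: graded_hom_def)
  have "submodule (a_kernel M N f) R M"
    by (rule M.submoduleI)
      (auto simp: mem_a_kernel mod_homD(2,3)[OF fh] mod_hom_zero[OF M.left_module_axioms N.left_module_axioms fh])
  moreover have "component (carrier G) \<M> M x \<gamma> \<in> a_kernel M N f"
    if "x \<in> a_kernel M N f" "\<gamma> \<in> carrier G" for x \<gamma>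
    using graded_hom_component[OF M N f _ that(2), of x] that by (auto simp: mem_a_kernel)
  ultimately show ?thesis by (auto simp: M.graded_submodule_iff)
qed

text \<open>An ungraded lift \<open>h\<close> is replaced by its degree-preserving part, the sum of the maps
  \<open>\<pi>\<^sub>\<gamma> \<circ> h \<circ> \<pi>\<^sub>\<gamma>\<close>; left cancelation makes it linear.\<close>

lemma projective_graded_lift:
  fixes P :: "('a, 'p) module"
  assumes P: "cancel_graded_module G R \<A> P \<P>" and N: "cancel_graded_module G R \<A> N \<N>"
    and L: "cancel_graded_module G R \<A> L \<L>" and proj: "projective_module R P"
    and g: "g \<in> graded_hom G R N \<N> L \<L>" "g ` carrier N = carrier L"
    and f: "f \<in> graded_hom G R P \<P> L \<L>"
  shows "\<exists>h\<in>graded_hom G R P \<P> N \<N>. \<forall>x\<in>carrier P. g (h x) = f x"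
proof -
  interpret P: cancel_graded_module G R \<A> P \<P> by fact
  interpret N: cancel_graded_module G R \<A> N \<N> by fact
  interpret L: cancel_graded_module G R \<A> L \<L> by fact
  have gm: "g \<in> mod_hom R N L" and fm: "f \<in> mod_hom R P L" using g f by (auto simp: graded_hom_def)
  obtain h where h: "h \<in> mod_hom R P N" "\<And>x. x \<in> carrier P \<Longrightarrow> g (h x) = f x"
    using projective_module_lift[OF proj N.left_module_axioms L.left_module_axioms gm g(2) fm] by blast
  note hc = mod_homD(1)[OF h(1)]
  have h0: "h \<zero>\<^bsub>P\<^esub> = \<zero>\<^bsub>N\<^esub>"
    by (rule mod_hom_zero[OF P.left_module_axioms N.left_module_axioms h(1)])
  define k where "k x = finsum N (\<lambda>\<gamma>. N.MD.cmp (h (P.MD.cmp x \<gamma>)) \<gamma>)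
    {\<gamma> \<in> carrier G. P.MD.cmp x \<gamma> \<noteq> \<zero>\<^bsub>P\<^esub>}" for x
  have kc: "k x \<in> carrier N" if "x \<in> carrier P" for x
    unfolding k_def using that hc by (intro N.M.finsum_closed) auto
  \<comment> \<open>Off the support of \<open>x\<close> both sides vanish because \<open>h\<close>
    maps zero to zero, so the formula holds in every degree.\<close>
  have k: "N.MD.cmp (k x) \<gamma> = N.MD.cmp (h (P.MD.cmp x \<gamma>)) \<gamma>"
    if x: "x \<in> carrier P" and \<gamma>: "\<gamma> \<in> carrier G" for x \<gamma>
  proof -
    have "N.MD.cmp (k x) \<gamma> = (if \<gamma> \<in> {\<gamma> \<in> carrier G. P.MD.cmp x \<gamma> \<noteq> \<zero>\<^bsub>P\<^esub>}
        then N.MD.cmp (h (P.MD.cmp x \<gamma>)) \<gamma> else \<zero>\<^bsub>N\<^esub>)"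
      unfolding k_def using x \<gamma> hc N.MD.component_in_part by (intro N.MD.component_unique) auto
    then show ?thesis using \<gamma> h0 by auto
  qed
  have kadd: "k (x \<oplus>\<^bsub>P\<^esub> y) = k x \<oplus>\<^bsub>N\<^esub> k y" if "x \<in> carrier P" "y \<in> carrier P" for x y
    by (rule N.MD.component_eqI)
      (use that kc hc in \<open>auto simp: k N.MD.component_add P.MD.component_add mod_homD(2)[OF h(1)]\<close>)
  \<comment> \<open>In degree \<alpha>\<gamma> both sides equal a times the degree \<gamma>
    component of h(x_\<gamma>); in the degrees missed by the translate by \<alpha> both are
    zero.\<close>
  have khom: "k (a \<odot>\<^bsub>P\<^esub> x) = a \<odot>\<^bsub>N\<^esub> k x" if a: "a \<in> \<A> \<alpha>" "\<alpha> \<in> carrier G" and x: "x \<in> carrier P" for a \<alpha> x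
  proof (rule N.MD.component_eqI)
    have ac: "a \<in> carrier R" using P.RD.part_carrier[OF a] .
    show "k (a \<odot>\<^bsub>P\<^esub> x) \<in> carrier N" "a \<odot>\<^bsub>N\<^esub> k x \<in> carrier N" using ac x kc by auto
    fix \<delta> assume \<delta>: "\<delta> \<in> carrier G"
    show "N.MD.cmp (k (a \<odot>\<^bsub>P\<^esub> x)) \<delta> = N.MD.cmp (a \<odot>\<^bsub>N\<^esub> k x) \<delta>"
    proof (cases "\<delta> \<in> (\<lambda>\<gamma>. \<alpha> \<otimes>\<^bsub>G\<^esub> \<gamma>) ` carrier G")
      case True
      then obtain \<gamma> where \<gamma>: "\<gamma> \<in> carrier G" "\<delta> = \<alpha> \<otimes>\<^bsub>G\<^esub> \<gamma>" by blast
      have xg: "P.MD.cmp x \<gamma> \<in> carrier P" using x \<gamma> by blast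
      have "N.MD.cmp (k (a \<odot>\<^bsub>P\<^esub> x)) \<delta> = N.MD.cmp (h (a \<odot>\<^bsub>P\<^esub> P.MD.cmp x \<gamma>)) \<delta>"
        using P.component_smult_left(1)[OF a x \<gamma>(1)] ac x \<delta> \<gamma>(2) by (simp add: k)
      also have "\<dots> = a \<odot>\<^bsub>N\<^esub> N.MD.cmp (h (P.MD.cmp x \<gamma>)) \<gamma>"
        using N.component_smult_left(1)[OF a hc[OF xg] \<gamma>(1)] mod_homD(3)[OF h(1) ac xg] \<gamma>(2) by simp
      also have "\<dots> = N.MD.cmp (a \<odot>\<^bsub>N\<^esub> k x) \<delta>"
        using N.component_smult_left(1)[OF a kc[OF x] \<gamma>(1)] k[OF x \<gamma>(1)] \<gamma>(2) by simp
      finally show ?thesis .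
    next
      case False
      then show ?thesis
        using P.component_smult_left(2)[OF a x \<delta>] N.component_smult_left(2)[OF a kc[OF x] \<delta>] ac x \<delta> h0
        by (simp add: k)
    qed
  qed
  \<comment> \<open>Both sides are additive in \<open>a\<close>, so a general scalar is split into
    its components.\<close>
  have ksmult: "k (a \<odot>\<^bsub>P\<^esub> x) = a \<odot>\<^bsub>N\<^esub> k x" if a: "a \<in> carrier R" and x: "x \<in> carrier P" for a x
  proof -
    let ?F = "{\<alpha> \<in> carrier G. P.RD.cmp a \<alpha> \<noteq> \<zero>\<^bsub>R\<^esub>}"
    have hom: "k \<in> hom (add_monoid P) (add_monoid N)" using kc kadd by (auto simp: hom_def)
    have dist: "(\<lambda>a. a \<odot>\<^bsub>P\<^esub> x) \<in> hom (add_monoid R) (add_monoid P)"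
        "(\<lambda>a. a \<odot>\<^bsub>N\<^esub> k x) \<in> hom (add_monoid R) (add_monoid N)"
      using x kc by (auto simp: hom_def P.smult_l_distr N.smult_l_distr)
    have ka: "(\<lambda>a. k (a \<odot>\<^bsub>P\<^esub> x)) \<in> hom (add_monoid R) (add_monoid N)"
      using x kc kadd by (auto simp: hom_def P.smult_l_distr)
    note fs = finsum_additive[OF P.R.abelian_group_axioms N.M.abelian_group_axioms]
    have "k (finsum R (P.RD.cmp a) ?F \<odot>\<^bsub>P\<^esub> x) = finsum N (\<lambda>\<alpha>. k (P.RD.cmp a \<alpha> \<odot>\<^bsub>P\<^esub> x)) ?F"
      by (rule fs[OF ka]) (use a in auto)
    also have "\<dots> = finsum N (\<lambda>\<alpha>. P.RD.cmp a \<alpha> \<odot>\<^bsub>N\<^esub> k x) ?F"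
      using a x kc khom[OF P.RD.component_in_part[OF a]] by (intro N.M.finsum_cong') auto
    also have "\<dots> = finsum R (P.RD.cmp a) ?F \<odot>\<^bsub>N\<^esub> k x"
      by (rule fs[OF dist(2), symmetric]) (use a in auto)
    finally show ?thesis using P.RD.component_all[OF a] by simp
  qed
  have "k \<in> mod_hom R P N" using kc kadd ksmult by (intro mod_homI) auto
  moreover have "k x \<in> \<N> \<gamma>" if x: "x \<in> \<P> \<gamma>" and \<gamma>: "\<gamma> \<in> carrier G" for x \<gamma>
    using P.MD.part_carrier[OF x \<gamma>] \<gamma> P.MD.component_of_part[OF x \<gamma>] h0
    by (simp add: N.MD.part_iff kc k)
  ultimately have kg: "k \<in> graded_hom G R P \<P> N \<N>" by (auto simp: graded_hom_def)
  \<comment> \<open>Only \<open>h\<close> may fail to respect degrees. As \<open>g\<close> and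
    \<open>f\<close> respect them, the degree \<gamma> component of g(h(x_\<gamma>)) = f(x_\<gamma>)
    is the claim in degree \<gamma>.\<close>
  have "g (k x) = f x" if x: "x \<in> carrier P" for x
  proof (rule L.MD.component_eqI)
    show "g (k x) \<in> carrier L" "f x \<in> carrier L" using x kc mod_homD(1)[OF gm] mod_homD(1)[OF fm] by auto
    fix \<gamma> assume \<gamma>: "\<gamma> \<in> carrier G"
    have xg: "P.MD.cmp x \<gamma> \<in> carrier P" using x \<gamma> by blast
    have "L.MD.cmp (g (k x)) \<gamma> = g (N.MD.cmp (h (P.MD.cmp x \<gamma>)) \<gamma>)"
      using graded_hom_component[OF N L g(1) kc[OF x] \<gamma>] k[OF x \<gamma>] by simp
    also have "\<dots> = L.MD.cmp (f (P.MD.cmp x \<gamma>)) \<gamma>"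
      using graded_hom_component[OF N L g(1) hc[OF xg] \<gamma>] h(2)[OF xg] by simp
    also have "\<dots> = f (P.MD.cmp (P.MD.cmp x \<gamma>) \<gamma>)"
      using graded_hom_component[OF P L f xg \<gamma>] .
    also have "\<dots> = f (P.MD.cmp x \<gamma>)"
      using P.MD.component_of_part[OF P.MD.component_in_part[OF x \<gamma>] \<gamma> \<gamma>] by simp
    also have "\<dots> = L.MD.cmp (f x) \<gamma>" using graded_hom_component[OF P L f x \<gamma>] by simp
    finally show "L.MD.cmp (g (k x)) \<gamma> = L.MD.cmp (f x) \<gamma>" .
  qed
  then show ?thesis using kg by blast
qed

text \<open>Under \<open>onto\<close>, each element of \<open>P\<close> differs from an element of
  the image of \<open>f\<close> by one of the kernel of \<open>e\<close>. The image is graded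
  because \<open>f\<close> is, so superfluity of the kernel applies to it.\<close>

lemma superfluous_kernel_surjective:
  assumes Q: "cancel_graded_module G R \<A> Q \<Q>" and P: "cancel_graded_module G R \<A> P \<P>"
    and M: "cancel_graded_module G R \<A> M \<M>"
    and f: "f \<in> graded_hom G R Q \<Q> P \<P>" and e: "e \<in> graded_hom G R P \<P> M \<M>"
    and sup: "gr_superfluous G R P \<P> (a_kernel P M e)"
    and onto: "e ` carrier P \<subseteq> (\<lambda>x. e (f x)) ` carrier Q"
  shows "f ` carrier Q = carrier P"
proof -
  interpret Q: cancel_graded_module G R \<A> Q \<Q> by fact
  interpret P: cancel_graded_module G R \<A> P \<P> by fact
  interpret M: cancel_graded_module G R \<A> M \<M> by fact
  have fm: "f \<in> mod_hom R Q P" and em: "e \<in> mod_hom R P M" using e f by (auto simp: graded_hom_def)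
  note fc = mod_homD(1)[OF fm] and ec = mod_homD(1)[OF em]
  have "y \<in> f ` carrier Q <+>\<^bsub>P\<^esub> a_kernel P M e" if y: "y \<in> carrier P" for y
  proof -
    obtain x where x: "x \<in> carrier Q" "e y = e (f x)" using onto y by blast
    let ?z = "\<ominus>\<^bsub>P\<^esub> f x \<oplus>\<^bsub>P\<^esub> y"
    have "e (f x) \<oplus>\<^bsub>M\<^esub> e ?z = e (f x \<oplus>\<^bsub>P\<^esub> ?z)" using mod_homD(2)[OF em] fc x y by simp
    also have "f x \<oplus>\<^bsub>P\<^esub> ?z = y" using fc[OF x(1)] y by (simp add: P.M.r_neg2)
    finally have "e ?z = \<zero>\<^bsub>M\<^esub>" using x fc ec y by (simp add: M.M.add.r_cancel_one)
    moreover have "y = f x \<oplus>\<^bsub>P\<^esub> ?z" using fc[OF x(1)] y by (simp add: P.M.r_neg2)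
    ultimately show ?thesis
      unfolding mem_set_add using x fc y
      by (intro bexI[of _ "f x"] bexI[of _ ?z]) (auto simp: mem_a_kernel)
  qed
  moreover have "f ` carrier Q <+>\<^bsub>P\<^esub> a_kernel P M e \<subseteq> carrier P"
    using fc by (auto simp: mem_set_add mem_a_kernel)
  ultimately show ?thesis
    using sup graded_hom_image[OF Q P f] unfolding gr_superfluous_def by blast
qed

theorem gr_projective_cover_unique:
  fixes P\<^sub>1 :: "('a, 'p) module" and P\<^sub>2 :: "('a, 'q) module"
  assumes G: "monoid_cancel G" and M: "graded_module G R \<A> M \<M>"
    and c1: "gr_projective_cover G R \<A> M \<M> P\<^sub>1 \<P>\<^sub>1 e\<^sub>1" and c2: "gr_projective_cover G R \<A> M \<M> P\<^sub>2 \<P>\<^sub>2 e\<^sub>2"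
  shows "gr_cover_isomorphic G R P\<^sub>1 \<P>\<^sub>1 e\<^sub>1 P\<^sub>2 \<P>\<^sub>2 e\<^sub>2"
proof -
  interpret M: graded_module G R \<A> M \<M> by fact
  have gM: "cancel_graded_module G R \<A> M \<M>"
    using G M M.graded_ring_axioms M.ring_axioms
    by (simp add: cancel_graded_module_def cancel_graded_ring_def graded_module_def left_module_def)
  have P1: "cancel_graded_module G R \<A> P\<^sub>1 \<P>\<^sub>1" and P2: "cancel_graded_module G R \<A> P\<^sub>2 \<P>\<^sub>2"
    using c1 c2 G M.graded_ring_axioms M.ring_axioms
    by (simp_all add: gr_projective_cover_def cancel_graded_module_def cancel_graded_ring_def
        graded_module_def left_module_def)
  have proj1: "projective_module R P\<^sub>1" and proj2: "projective_module R P\<^sub>2"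
    and e1: "e\<^sub>1 \<in> graded_hom G R P\<^sub>1 \<P>\<^sub>1 M \<M>" "e\<^sub>1 ` carrier P\<^sub>1 = carrier M"
    and e2: "e\<^sub>2 \<in> graded_hom G R P\<^sub>2 \<P>\<^sub>2 M \<M>" "e\<^sub>2 ` carrier P\<^sub>2 = carrier M"
    and s1: "gr_superfluous G R P\<^sub>1 \<P>\<^sub>1 (a_kernel P\<^sub>1 M e\<^sub>1)"
    and s2: "gr_superfluous G R P\<^sub>2 \<P>\<^sub>2 (a_kernel P\<^sub>2 M e\<^sub>2)"
    using c1 c2 by (auto simp: gr_projective_cover_def)
  interpret P1: cancel_graded_module G R \<A> P\<^sub>1 \<P>\<^sub>1 by (rule P1)
  interpret P2: cancel_graded_module G R \<A> P\<^sub>2 \<P>\<^sub>2 by (rule P2)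
  obtain h where h: "h \<in> graded_hom G R P\<^sub>1 \<P>\<^sub>1 P\<^sub>2 \<P>\<^sub>2" "\<And>x. x \<in> carrier P\<^sub>1 \<Longrightarrow> e\<^sub>2 (h x) = e\<^sub>1 x"
    using projective_graded_lift[OF P1 P2 gM proj1 e2 e1(1)] by blast
  have hc: "\<And>x. x \<in> carrier P\<^sub>1 \<Longrightarrow> h x \<in> carrier P\<^sub>2"
    using h(1) mod_homD(1) by (fastforce simp: graded_hom_def)
  have hsurj: "h ` carrier P\<^sub>1 = carrier P\<^sub>2"
  proof (rule superfluous_kernel_surjective[OF P1 P2 gM h(1) e2(1) s2])
    have "(\<lambda>x. e\<^sub>2 (h x)) ` carrier P\<^sub>1 = e\<^sub>1 ` carrier P\<^sub>1" using h(2) by auto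
    then show "e\<^sub>2 ` carrier P\<^sub>2 \<subseteq> (\<lambda>x. e\<^sub>2 (h x)) ` carrier P\<^sub>1" using e1(2) e2(2) by simp
  qed
  have id: "(\<lambda>x. x) \<in> graded_hom G R P\<^sub>2 \<P>\<^sub>2 P\<^sub>2 \<P>\<^sub>2" by (auto simp: graded_hom_def intro: mod_homI)
  obtain s where s: "s \<in> graded_hom G R P\<^sub>2 \<P>\<^sub>2 P\<^sub>1 \<P>\<^sub>1" "\<And>y. y \<in> carrier P\<^sub>2 \<Longrightarrow> h (s y) = y"
    using projective_graded_lift[OF P2 P1 P2 proj2 h(1) hsurj id] by blast
  have sc: "\<And>y. y \<in> carrier P\<^sub>2 \<Longrightarrow> s y \<in> carrier P\<^sub>1"
    using s(1) mod_homD(1) by (fastforce simp: graded_hom_def)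
  have es: "e\<^sub>1 (s y) = e\<^sub>2 y" if "y \<in> carrier P\<^sub>2" for y using h(2)[OF sc[OF that]] s(2)[OF that] by simp
  have "s ` carrier P\<^sub>2 = carrier P\<^sub>1"
  proof (rule superfluous_kernel_surjective[OF P2 P1 gM s(1) e1(1) s1])
    have "(\<lambda>x. e\<^sub>1 (s x)) ` carrier P\<^sub>2 = e\<^sub>2 ` carrier P\<^sub>2" using es by auto
    then show "e\<^sub>1 ` carrier P\<^sub>1 \<subseteq> (\<lambda>x. e\<^sub>1 (s x)) ` carrier P\<^sub>2" using e1(2) e2(2) by simp
  qed
  \<comment> \<open>Since \<open>s\<close> is onto, every element of \<open>P\<^sub>1\<close> is
    some \<open>s y\<close>, and \<open>h\<close> recovers \<open>y\<close> from it.\<close>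
  then have "inj_on h (carrier P\<^sub>1)" using s(2) by (intro inj_onI) (metis imageE)
  then have "bij_betw h (carrier P\<^sub>1) (carrier P\<^sub>2)" using hsurj by (simp add: bij_betw_def)
  then show ?thesis using h unfolding gr_cover_isomorphic_def graded_iso_def by blast
qed


section \<open>Graded free modules\<close>

text \<open>Here \<open>\<pi> i\<close> is the candidate projection onto \<open>D i\<close>. Applied
  to a finite sum of elements of the parts it returns the summand at \<open>i\<close>, so any
  decomposition of \<open>x\<close> must be the family of its projections; \<open>span\<close>
  supplies existence.\<close>

lemma internal_direct_sumI:
  assumes M: "abelian_group M" and D: "\<And>i. i \<in> I \<Longrightarrow> additive_subgroup (D i) M"
    and add: "\<And>i x y. \<lbrakk>i \<in> I; x \<in> carrier M; y \<in> carrier M\<rbrakk> \<Longrightarrow> \<pi> i (x \<oplus>\<^bsub>M\<^esub> y) = \<pi> i x \<oplus>\<^bsub>M\<^esub> \<pi> i y"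
    and mem: "\<And>i x. \<lbrakk>i \<in> I; x \<in> carrier M\<rbrakk> \<Longrightarrow> \<pi> i x \<in> D i"
    and part: "\<And>i j x. \<lbrakk>i \<in> I; j \<in> I; x \<in> D j\<rbrakk> \<Longrightarrow> \<pi> i x = (if i = j then x else \<zero>\<^bsub>M\<^esub>)"
    and span: "\<And>x. x \<in> carrier M \<Longrightarrow> \<exists>F. finite F \<and> F \<subseteq> I \<and> x = finsum M (\<lambda>i. \<pi> i x) F"
  shows "internal_direct_sum I D M"
  unfolding internal_direct_sum_def
proof (intro conjI ballI D ex_ex1I)
  interpret abelian_group M by fact
  have Dc: "x \<in> carrier M" if "x \<in> D i" "i \<in> I" for x i
    using additive_subgroup.a_subset[OF D[OF that(2)]] that(1) by blast
  have proj: "\<pi> i (finsum M f F) = (if i \<in> F then f i else \<zero>\<^bsub>M\<^esub>)"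
    if F: "finite F" "F \<subseteq> I" and f: "\<And>j. j \<in> F \<Longrightarrow> f j \<in> D j" and i: "i \<in> I" for f F i
  proof -
    have fc: "f j \<in> carrier M" if "j \<in> F" for j using Dc[OF f[OF that]] that F by blast
    have "\<pi> i \<in> hom (add_monoid M) (add_monoid M)"
      using add[OF i] Dc[OF mem[OF i] i] by (auto simp: hom_def)
    then have "\<pi> i (finsum M f F) = finsum M (\<lambda>j. \<pi> i (f j)) F"
      using fc F by (intro finsum_additive abelian_group_axioms) auto
    also have "\<dots> = finsum M (\<lambda>j. if i = j then f j else \<zero>\<^bsub>M\<^esub>) F"
      using part[OF i _ f] F fc by (intro finsum_cong') auto
    also have "\<dots> = (if i \<in> F then f i else \<zero>\<^bsub>M\<^esub>)"
    proof (cases "i \<in> F")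
      case True
      then show ?thesis using finsum_singleton[OF True F(1), of f] fc by auto
    next
      case False
      then show ?thesis by (auto intro!: add.finprod_one_eqI)
    qed
    finally show ?thesis .
  qed
  fix x assume x: "x \<in> carrier M"
  obtain F where F: "finite F" "F \<subseteq> I" "x = finsum M (\<lambda>i. \<pi> i x) F" using span[OF x] by blast
  let ?f = "restrict (\<lambda>i. \<pi> i x) I"
  \<comment> \<open>So far the projections are only known to add up to \<open>x\<close> over
    \<open>F\<close>. Projecting that sum shows that all others vanish, so \<open>F\<close> contains
    the support.\<close>
  have zero: "\<pi> i x = \<zero>\<^bsub>M\<^esub>" if "i \<in> I" "i \<notin> F" for i
    using proj[OF F(1,2) mem[OF _ x] that(1)] that F(2) by (simp add: F(3)[symmetric] subset_iff)
  have sub: "{i \<in> I. ?f i \<noteq> \<zero>\<^bsub>M\<^esub>} \<subseteq> F" using zero by auto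
  have "x = finsum M ?f {i \<in> I. ?f i \<noteq> \<zero>\<^bsub>M\<^esub>}"
    by (subst F(3), rule add.finprod_mono_neutral_cong_right)
      (use F(1,2) Dc[OF mem[OF _ x]] sub in auto)
  moreover have "finite {i \<in> I. ?f i \<noteq> \<zero>\<^bsub>M\<^esub>}" using sub F(1) by (rule finite_subset)
  ultimately show "\<exists>f. f \<in> Pi\<^sub>E I D \<and> finite {i \<in> I. f i \<noteq> \<zero>\<^bsub>M\<^esub>} \<and> x = finsum M f {i \<in> I. f i \<noteq> \<zero>\<^bsub>M\<^esub>}"
    using mem[OF _ x] by (intro exI[of _ ?f]) auto
  have uniq: "f = ?f" if f: "f \<in> Pi\<^sub>E I D \<and> finite {i \<in> I. f i \<noteq> \<zero>\<^bsub>M\<^esub>} \<and> x = finsum M f {i \<in> I. f i \<noteq> \<zero>\<^bsub>M\<^esub>}" for f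
  proof
    fix i
    have fD: "\<And>j. j \<in> I \<Longrightarrow> f j \<in> D j" using f by auto
    show "f i = ?f i"
    proof (cases "i \<in> I")
      case True
      have "\<pi> i (finsum M f {i \<in> I. f i \<noteq> \<zero>\<^bsub>M\<^esub>}) = f i"
        using f fD True by (subst proj) auto
      then show ?thesis using f True by simp
    next
      case False
      then show ?thesis using PiE_arb[of f I D i] f by simp
    qed
  qed
  fix f g
  assume f: "f \<in> Pi\<^sub>E I D \<and> finite {i \<in> I. f i \<noteq> \<zero>\<^bsub>M\<^esub>} \<and> x = finsum M f {i \<in> I. f i \<noteq> \<zero>\<^bsub>M\<^esub>}"
    and g: "g \<in> Pi\<^sub>E I D \<and> finite {i \<in> I. g i \<noteq> \<zero>\<^bsub>M\<^esub>} \<and> x = finsum M g {i \<in> I. g i \<noteq> \<zero>\<^bsub>M\<^esub>}"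
  show "f = g" by (rule trans[OF uniq[OF f] uniq[OF g, symmetric]])
qed

section \<open>Free modules, unit vectors and projectivity\<close>

lemma free_module_carrier:
  "c \<in> carrier (free_module R B) \<longleftrightarrow>
    (\<forall>x. c x \<in> carrier R) \<and> finite {x. c x \<noteq> \<zero>\<^bsub>R\<^esub>} \<and> {x. c x \<noteq> \<zero>\<^bsub>R\<^esub>} \<subseteq> B"
  by (simp add: free_module_def)

lemma free_module_sel [simp]:
  "\<zero>\<^bsub>free_module R B\<^esub> = (\<lambda>_. \<zero>\<^bsub>R\<^esub>)"
  "c \<oplus>\<^bsub>free_module R B\<^esub> c' = (\<lambda>x. c x \<oplus>\<^bsub>R\<^esub> c' x)"
  "a \<odot>\<^bsub>free_module R B\<^esub> c = (\<lambda>x. a \<otimes>\<^bsub>R\<^esub> c x)"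
  by (simp_all add: free_module_def)

lemma free_module_finsum_apply:
  assumes "ring R" "finite S" "\<And>s. s \<in> S \<Longrightarrow> c s \<in> carrier (free_module R B)"
  shows "finsum (free_module R B) c S x = finsum R (\<lambda>s. c s x) S"
proof -
  interpret ring R by fact
  interpret F: left_module R "free_module R B" using assms(1) by (rule free_module_left_module)
  have "(\<lambda>c. c x) \<in> hom (add_monoid (free_module R B)) (add_monoid R)"
    by (auto simp: hom_def free_module_carrier)
  from finsum_additive[OF F.M.abelian_group_axioms abelian_group_axioms this assms(2,3)]
  show ?thesis .
qed

definition unit_vector :: "('a, 'r) ring_scheme \<Rightarrow> 'x \<Rightarrow> 'x \<Rightarrow> 'a"
  where "unit_vector R x = (\<lambda>y. if x = y then \<one>\<^bsub>R\<^esub> else \<zero>\<^bsub>R\<^esub>)"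

lemma unit_vector_closed:
  assumes "ring R" "x \<in> B" shows "unit_vector R x \<in> carrier (free_module R B)"
proof -
  interpret ring R by fact
  have "{y. unit_vector R x y \<noteq> \<zero>\<^bsub>R\<^esub>} \<subseteq> {x}" by (auto simp: unit_vector_def)
  then show ?thesis
    using assms(2) by (auto simp: free_module_carrier unit_vector_def elim: finite_subset)
qed

lemma free_module_expansion:
  assumes R: "ring R" and c: "c \<in> carrier (free_module R B)"
  shows "c = finsum (free_module R B) (\<lambda>x. c x \<odot>\<^bsub>free_module R B\<^esub> unit_vector R x) {x. c x \<noteq> \<zero>\<^bsub>R\<^esub>}"
proof
  interpret ring R by fact
  interpret F: left_module R "free_module R B" using R by (rule free_module_left_module)
  fix y
  let ?S = "{x. c x \<noteq> \<zero>\<^bsub>R\<^esub>}"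
  have cR: "\<And>x. c x \<in> carrier R" and fin: "finite ?S" and sub: "?S \<subseteq> B"
    using c by (auto simp: free_module_carrier)
  have summand: "c x \<odot>\<^bsub>free_module R B\<^esub> unit_vector R x \<in> carrier (free_module R B)" if "x \<in> ?S" for x
  proof -
    have "x \<in> B" using sub that by blast
    then show ?thesis by (intro F.smult_closed cR unit_vector_closed R)
  qed
  have "finsum (free_module R B) (\<lambda>x. c x \<odot>\<^bsub>free_module R B\<^esub> unit_vector R x) ?S y
      = finsum R (\<lambda>x. (c x \<odot>\<^bsub>free_module R B\<^esub> unit_vector R x) y) ?S"
    by (rule free_module_finsum_apply[OF R fin summand])
  also have "\<dots> = finsum R (\<lambda>x. if y = x then c x else \<zero>\<^bsub>R\<^esub>) ?S"
    using cR by (intro finsum_cong') (auto simp: unit_vector_def)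
  also have "\<dots> = c y"
  proof (cases "y \<in> ?S")
    case True
    then show ?thesis using finsum_singleton[OF True fin, of c] cR by auto
  next
    case False
    then show ?thesis by (auto intro!: add.finprod_one_eqI)
  qed
  finally show "c y = finsum (free_module R B)
      (\<lambda>x. c x \<odot>\<^bsub>free_module R B\<^esub> unit_vector R x) ?S y" by simp
qed

lemma free_eval_unit_vector:
  assumes N: "left_module R N" and "x \<in> B" "n x \<in> carrier N"
  shows "free_eval R N n (unit_vector R x) = n x"
proof -
  interpret left_module R N by fact
  have "free_eval R N n (unit_vector R x) = finsum N (\<lambda>y. unit_vector R x y \<odot>\<^bsub>N\<^esub> n y) {x}"
    by (rule free_eval_superset[OF N, of "{x}"]) (use assms in \<open>auto simp: unit_vector_def\<close>)
  then show ?thesis using assms(3) by (simp add: unit_vector_def)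
qed

text \<open>Preimages under \<open>g\<close> are chosen for the images of the unit vectors, and
  \<open>free_eval\<close> extends the choice linearly. That this is a lift follows by expanding an
  element in unit vectors.\<close>

lemma projective_free_module:
  fixes R :: "('a, 'r) ring_scheme" and B :: "'x set"
  assumes R: "ring R"
  shows "projective_module R (free_module R B)"
  unfolding projective_module_def
proof (intro conjI allI impI)
  let ?F = "free_module R B"
  show F: "left_module R ?F" using R by (rule free_module_left_module)
  fix N :: "('a, ('x \<Rightarrow> 'a) \<Rightarrow> 'a) module" and L :: "('a, 'x \<Rightarrow> 'a) module" and g f
  assume A: "left_module R N \<and> left_module R L \<and> g \<in> mod_hom R N L \<and> g ` carrier N = carrier L \<and>
    f \<in> mod_hom R ?F L"
  then have N: "left_module R N" and L: "left_module R L" and g: "g \<in> mod_hom R N L"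
    and f: "f \<in> mod_hom R ?F L" by blast+
  interpret F: left_module R ?F by (rule F)
  interpret N: left_module R N by (rule N)
  interpret L: left_module R L by (rule L)
  have "\<forall>x\<in>B. \<exists>z\<in>carrier N. g z = f (unit_vector R x)"
    using A mod_homD(1)[OF f unit_vector_closed[OF R]] by (metis imageE)
  then obtain n where n: "\<And>x. x \<in> B \<Longrightarrow> n x \<in> carrier N"
      "\<And>x. x \<in> B \<Longrightarrow> g (n x) = f (unit_vector R x)" by metis
  have h: "free_eval R N n \<in> mod_hom R ?F N" using N n(1) by (rule free_eval_mod_hom)
  have "g (free_eval R N n c) = f c" if c: "c \<in> carrier ?F" for c
  proof -
    let ?S = "{x. c x \<noteq> \<zero>\<^bsub>R\<^esub>}"
    have S: "finite ?S" "?S \<subseteq> B" "\<And>x. c x \<in> carrier R" using c by (auto simp: free_module_carrier)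
    have u: "unit_vector R x \<in> carrier ?F" if "x \<in> ?S" for x
      using that S(2) by (intro unit_vector_closed[OF R]) blast
    have nS: "n x \<in> carrier N" if "x \<in> ?S" for x using that S(2) n(1) by blast
    have "g (free_eval R N n c) = finsum L (\<lambda>x. g (c x \<odot>\<^bsub>N\<^esub> n x)) ?S"
      unfolding free_eval_def by (rule mod_hom_finsum[OF N L g S(1)]) (use nS S(3) in blast)
    also have "\<dots> = finsum L (\<lambda>x. f (c x \<odot>\<^bsub>?F\<^esub> unit_vector R x)) ?S"
    proof (rule L.M.finsum_cong')
      fix x assume x: "x \<in> ?S"
      then have "x \<in> B" using S(2) by blast
      then show "g (c x \<odot>\<^bsub>N\<^esub> n x) = f (c x \<odot>\<^bsub>?F\<^esub> unit_vector R x)"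
        using mod_homD(3)[OF g S(3) nS[OF x]] mod_homD(3)[OF f S(3) u[OF x]] n(2) by metis
    next
      show "(\<lambda>x. f (c x \<odot>\<^bsub>?F\<^esub> unit_vector R x)) \<in> ?S \<rightarrow> carrier L"
        using mod_homD(1)[OF f F.smult_closed[OF S(3) u]] by blast
    qed simp
    also have "\<dots> = f (finsum ?F (\<lambda>x. c x \<odot>\<^bsub>?F\<^esub> unit_vector R x) ?S)"
      by (rule mod_hom_finsum[OF F L f S(1), symmetric]) (use F.smult_closed S(3) u in blast)
    also have "\<dots> = f c" using free_module_expansion[OF R c] by simp
    finally show ?thesis .
  qed
  then show "\<exists>h\<in>mod_hom R ?F N. \<forall>x\<in>carrier ?F. g (h x) = f x" using h by blast
qed

text \<open>Makes the Nakayama argument available for the cover itself.\<close>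

lemma fin_gen_free_module:
  assumes R: "ring R" and "finite B"
  shows "fin_gen_module R (free_module R B)"
proof -
  let ?F = "free_module R B"
  interpret F: left_module R ?F using R by (rule free_module_left_module)
  let ?S = "unit_vector R ` B"
  have S: "?S \<subseteq> carrier ?F" by (intro image_subsetI unit_vector_closed[OF R])
  note N = F.submodule_gen_submodule[OF S]
  have "c \<in> submodule_gen R ?F ?S" if c: "c \<in> carrier ?F" for c
  proof -
    have S': "finite {x. c x \<noteq> \<zero>\<^bsub>R\<^esub>}" "{x. c x \<noteq> \<zero>\<^bsub>R\<^esub>} \<subseteq> B" "\<And>x. c x \<in> carrier R"
      using c by (auto simp: free_module_carrier)
    have "finsum ?F (\<lambda>x. c x \<odot>\<^bsub>?F\<^esub> unit_vector R x) {x. c x \<noteq> \<zero>\<^bsub>R\<^esub>} \<in> submodule_gen R ?F ?S"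
    proof (rule F.M.finsum_mem_subgroup[OF F.submodule_additive_subgroup[OF N] S'(1)])
      fix x assume "x \<in> {x. c x \<noteq> \<zero>\<^bsub>R\<^esub>}"
      then have "unit_vector R x \<in> submodule_gen R ?F ?S"
        using S'(2) F.submodule_gen_incl[of ?S] by blast
      then show "c x \<odot>\<^bsub>?F\<^esub> unit_vector R x \<in> submodule_gen R ?F ?S"
        by (rule F.submodule_smult[OF N S'(3)])
    qed
    then show ?thesis using free_module_expansion[OF R c] by simp
  qed
  then have "submodule_gen R ?F ?S = carrier ?F" using F.submodule_subset[OF N] by blast
  then show ?thesis using S assms(2) unfolding fin_gen_module_def by blast
qed

text \<open>The basis vector at \<open>x\<close> gets degree \<open>d x\<close>.  Stating the condition through the nonzero components
  avoids a choice of the \<open>\<gamma>\<close> with \<open>\<gamma> d(x) = \<delta>\<close>, which need not exist in a monoid.\<close>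

definition free_grading :: "('g, 'h) monoid_scheme \<Rightarrow> ('a, 'r) ring_scheme \<Rightarrow> ('g \<Rightarrow> 'a set) \<Rightarrow>
    'x set \<Rightarrow> ('x \<Rightarrow> 'g) \<Rightarrow> 'g \<Rightarrow> ('x \<Rightarrow> 'a) set"
  where "free_grading G R \<A> B d \<delta> = {c \<in> carrier (free_module R B).
    \<forall>x. \<forall>\<gamma>\<in>carrier G. component (carrier G) \<A> R (c x) \<gamma> \<noteq> \<zero>\<^bsub>R\<^esub> \<longrightarrow> \<gamma> \<otimes>\<^bsub>G\<^esub> d x = \<delta>}"

section \<open>The grading of a free module with shifted degrees\<close>

context cancel_graded_ring
begin

text \<open>The contribution of a coefficient to total degree \<delta> at a basis vector of degree
  \<epsilon>. For \<epsilon> in \<Gamma> right cancelation leaves at most one summand; writing a sum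
  covers the case of none, and it stays meaningful for \<epsilon> outside \<Gamma>, which occurs at
  indices off the basis.\<close>

definition shift_part :: "'g \<Rightarrow> 'g \<Rightarrow> 'a \<Rightarrow> 'a"
  where "shift_part \<epsilon> \<delta> a = finsum R (RD.cmp a) {\<gamma> \<in> carrier G. \<gamma> \<otimes>\<^bsub>G\<^esub> \<epsilon> = \<delta> \<and> RD.cmp a \<gamma> \<noteq> \<zero>\<^bsub>R\<^esub>}"

lemma finite_shift_support:
  "a \<in> carrier R \<Longrightarrow> finite {\<gamma> \<in> carrier G. \<gamma> \<otimes>\<^bsub>G\<^esub> \<epsilon> = \<delta> \<and> RD.cmp a \<gamma> \<noteq> \<zero>\<^bsub>R\<^esub>}"
  by (rule finite_subset[OF _ RD.finite_support[of a]]) auto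

lemma shift_part_closed: "a \<in> carrier R \<Longrightarrow> shift_part \<epsilon> \<delta> a \<in> carrier R"
  unfolding shift_part_def by (intro R.finsum_closed) auto

lemma component_shift_part:
  assumes "a \<in> carrier R" "\<gamma> \<in> carrier G"
  shows "RD.cmp (shift_part \<epsilon> \<delta> a) \<gamma> = (if \<gamma> \<otimes>\<^bsub>G\<^esub> \<epsilon> = \<delta> then RD.cmp a \<gamma> else \<zero>\<^bsub>R\<^esub>)"
proof -
  have "RD.cmp (shift_part \<epsilon> \<delta> a) \<gamma> =
      (if \<gamma> \<in> {\<gamma> \<in> carrier G. \<gamma> \<otimes>\<^bsub>G\<^esub> \<epsilon> = \<delta> \<and> RD.cmp a \<gamma> \<noteq> \<zero>\<^bsub>R\<^esub>} then RD.cmp a \<gamma> else \<zero>\<^bsub>R\<^esub>)"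
    unfolding shift_part_def using assms finite_shift_support[OF assms(1)]
    by (intro RD.component_unique) (auto intro: RD.component_in_part)
  then show ?thesis using assms(2) by auto
qed

lemma shift_part_zero: "shift_part \<epsilon> \<delta> \<zero>\<^bsub>R\<^esub> = \<zero>\<^bsub>R\<^esub>"
  by (rule RD.component_eqI) (auto simp: component_shift_part shift_part_closed)

text \<open>The projections act on each coordinate by \<open>shift_part\<close>, so
  \<open>internal_direct_sumI\<close> reduces the decomposition to identities between coefficients,
  and these are checked component by component.\<close>

lemma free_module_graded:
  fixes d :: "'x \<Rightarrow> 'g"
  assumes d: "\<And>x. x \<in> B \<Longrightarrow> d x \<in> carrier G"
  shows "graded_module G R \<A> (free_module R B) (free_grading G R \<A> B d)"
proof -
  let ?F = "free_module R B"
  let ?D = "free_grading G R \<A> B d"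
  interpret F: left_module R ?F using R.ring_axioms by (rule free_module_left_module)
  have cR: "c x \<in> carrier R" if "c \<in> carrier ?F" for c x using that by (simp add: free_module_carrier)
  define \<pi> where "\<pi> \<delta> c = (\<lambda>x. shift_part (d x) \<delta> (c x))" for \<delta> and c :: "'x \<Rightarrow> 'a"
  have \<pi>F: "\<pi> \<delta> c \<in> carrier ?F" if c: "c \<in> carrier ?F" for \<delta> c
  proof -
    have "{x. \<pi> \<delta> c x \<noteq> \<zero>\<^bsub>R\<^esub>} \<subseteq> {x. c x \<noteq> \<zero>\<^bsub>R\<^esub>}" by (auto simp: \<pi>_def shift_part_zero)
    then show ?thesis
      using c shift_part_closed by (auto simp: free_module_carrier \<pi>_def elim: finite_subset)
  qed
  have "internal_direct_sum (carrier G) ?D ?F"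
  proof (rule internal_direct_sumI[where \<pi> = \<pi>])
    show "abelian_group ?F" by (rule F.M.abelian_group_axioms)
  next
    fix \<delta> assume "\<delta> \<in> carrier G"
    have add: "c \<oplus>\<^bsub>?F\<^esub> c' \<in> ?D \<delta>" if c: "c \<in> ?D \<delta>" "c' \<in> ?D \<delta>" for c c'
    proof -
      have cc: "c \<in> carrier ?F" "c' \<in> carrier ?F" using c by (auto simp: free_grading_def)
      have "\<gamma> \<otimes>\<^bsub>G\<^esub> d x = \<delta>"
        if "\<gamma> \<in> carrier G" "RD.cmp (c x \<oplus>\<^bsub>R\<^esub> c' x) \<gamma> \<noteq> \<zero>\<^bsub>R\<^esub>" for x \<gamma>
      proof -
        have "RD.cmp (c x) \<gamma> \<noteq> \<zero>\<^bsub>R\<^esub> \<or> RD.cmp (c' x) \<gamma> \<noteq> \<zero>\<^bsub>R\<^esub>"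
          using that by (auto simp: RD.component_add cR[OF cc(1)] cR[OF cc(2)])
        then show ?thesis using c that(1) by (auto simp: free_grading_def)
      qed
      then show ?thesis using F.M.a_closed[OF cc] by (simp add: free_grading_def)
    qed
    have neg: "\<ominus>\<^bsub>?F\<^esub> c \<in> ?D \<delta>" if c: "c \<in> ?D \<delta>" for c
    proof -
      have cc: "c \<in> carrier ?F" using c by (auto simp: free_grading_def)
      have "(\<ominus>\<^bsub>R\<^esub> \<one>\<^bsub>R\<^esub>) \<odot>\<^bsub>?F\<^esub> c = \<ominus>\<^bsub>?F\<^esub> c" by (rule F.smult_uminus[OF cc])
      then have "\<ominus>\<^bsub>?F\<^esub> c = (\<lambda>x. \<ominus>\<^bsub>R\<^esub> c x)" using cR[OF cc] by (simp add: R.l_minus)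
      then show ?thesis
        using c F.M.a_inv_closed[OF cc] cR[OF cc] by (auto simp: free_grading_def RD.component_uminus)
    qed
    have "(\<lambda>_. \<zero>\<^bsub>R\<^esub>) \<in> ?D \<delta>" using F.M.zero_closed by (auto simp: free_grading_def)
    then have "?D \<delta> \<noteq> {}" by blast
    moreover have "?D \<delta> \<subseteq> carrier ?F" by (auto simp: free_grading_def)
    ultimately show "additive_subgroup (?D \<delta>) ?F"
      using add neg by (intro additive_subgroupI F.M.add.subgroupI)
  next
    fix \<delta> c c' assume "c \<in> carrier ?F" "c' \<in> carrier ?F"
    note cR = cR[OF this(1)] cR[OF this(2)]
    have "shift_part (d x) \<delta> (c x \<oplus>\<^bsub>R\<^esub> c' x)
        = shift_part (d x) \<delta> (c x) \<oplus>\<^bsub>R\<^esub> shift_part (d x) \<delta> (c' x)" for x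
      by (rule RD.component_eqI)
        (auto simp: component_shift_part shift_part_closed RD.component_add cR)
    then show "\<pi> \<delta> (c \<oplus>\<^bsub>?F\<^esub> c') = \<pi> \<delta> c \<oplus>\<^bsub>?F\<^esub> \<pi> \<delta> c'" by (simp add: \<pi>_def)
  next
    fix \<delta> c assume "\<delta> \<in> carrier G" and c: "c \<in> carrier ?F"
    then show "\<pi> \<delta> c \<in> ?D \<delta>"
      using \<pi>F[OF c] by (auto simp: free_grading_def \<pi>_def component_shift_part cR)
  next
    fix \<delta> \<delta>' c assume c: "c \<in> ?D \<delta>'"
    then have cc: "c \<in> carrier ?F" by (simp add: free_grading_def)
    have cmp: "RD.cmp (c x) \<gamma> = \<zero>\<^bsub>R\<^esub>" if "\<gamma> \<in> carrier G" "\<gamma> \<otimes>\<^bsub>G\<^esub> d x \<noteq> \<delta>'" for x \<gamma>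
      using c that by (auto simp: free_grading_def)
    have "shift_part (d x) \<delta> (c x) = (if \<delta> = \<delta>' then c x else \<zero>\<^bsub>R\<^esub>)" for x
      by (rule RD.component_eqI)
        (auto simp: component_shift_part shift_part_closed cR[OF cc] cmp)
    then show "\<pi> \<delta> c = (if \<delta> = \<delta>' then c else \<zero>\<^bsub>?F\<^esub>)" by (auto simp: \<pi>_def)
  next
    fix c assume c: "c \<in> carrier ?F"
    \<comment> \<open>All total degrees \<gamma>d(x) occurring in \<open>c\<close>. They are
      finitely many, as \<open>c\<close> has finitely many nonzero coefficients and each of these
      finitely many nonzero components.\<close>
    define F where "F = (\<Union>x\<in>{x. c x \<noteq> \<zero>\<^bsub>R\<^esub>}. (\<lambda>\<gamma>. \<gamma> \<otimes>\<^bsub>G\<^esub> d x) ` {\<gamma> \<in> carrier G. RD.cmp (c x) \<gamma> \<noteq> \<zero>\<^bsub>R\<^esub>})"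
    have F: "finite F" "F \<subseteq> carrier G"
      using c d cR[OF c] by (auto simp: F_def free_module_carrier)
    have "c x = finsum ?F (\<lambda>\<delta>. \<pi> \<delta> c) F x" for x
    proof -
      have "c x = finsum R (\<lambda>\<delta>. \<pi> \<delta> c x) F"
      proof (rule RD.component_eqI)
        show "c x \<in> carrier R" "finsum R (\<lambda>\<delta>. \<pi> \<delta> c x) F \<in> carrier R"
          using cR[OF c] cR[OF \<pi>F[OF c]] by auto
        fix \<gamma> assume \<gamma>: "\<gamma> \<in> carrier G"
        have "RD.cmp (finsum R (\<lambda>\<delta>. \<pi> \<delta> c x) F) \<gamma> = finsum R (\<lambda>\<delta>. RD.cmp (\<pi> \<delta> c x) \<gamma>) F"
          using cR[OF \<pi>F[OF c]] F \<gamma> by (intro RD.component_finsum)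
        also have "\<dots> = finsum R (\<lambda>\<delta>. if \<gamma> \<otimes>\<^bsub>G\<^esub> d x = \<delta> then RD.cmp (c x) \<gamma> else \<zero>\<^bsub>R\<^esub>) F"
          using \<gamma> cR[OF c] by (simp add: \<pi>_def component_shift_part)
        also have "\<dots> = RD.cmp (c x) \<gamma>"
        \<comment> \<open>A vanishing component gives no guarantee that \<gamma>d(x) belongs to
          \<open>F\<close>, but then all summands are zero.\<close>
        proof (cases "RD.cmp (c x) \<gamma> = \<zero>\<^bsub>R\<^esub>")
          case True
          then show ?thesis by (auto intro!: R.add.finprod_one_eqI)
        next
          case False
          then have "c x \<noteq> \<zero>\<^bsub>R\<^esub>" using \<gamma> by auto
          then have "\<gamma> \<otimes>\<^bsub>G\<^esub> d x \<in> F" using False \<gamma> by (auto simp: F_def)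
          then show ?thesis
            using F(1) \<gamma> cR[OF c] R.finsum_singleton[of "\<gamma> \<otimes>\<^bsub>G\<^esub> d x" F "\<lambda>_. RD.cmp (c x) \<gamma>"] by auto
        qed
        finally show "RD.cmp (c x) \<gamma> = RD.cmp (finsum R (\<lambda>\<delta>. \<pi> \<delta> c x) F) \<gamma>" by simp
      qed
      then show ?thesis using free_module_finsum_apply[OF R.ring_axioms F(1), of "\<lambda>\<delta>. \<pi> \<delta> c" B x] \<pi>F[OF c] by simp
    qed
    then have "c = finsum ?F (\<lambda>\<delta>. \<pi> \<delta> c) F" by blast
    then show "\<exists>F. finite F \<and> F \<subseteq> carrier G \<and> c = finsum ?F (\<lambda>\<delta>. \<pi> \<delta> c) F" using F by blast
  qed
  moreover have "a \<odot>\<^bsub>?F\<^esub> c \<in> ?D (\<alpha> \<otimes>\<^bsub>G\<^esub> \<delta>)"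
    if \<alpha>: "\<alpha> \<in> carrier G" and \<delta>: "\<delta> \<in> carrier G" and a: "a \<in> \<A> \<alpha>" and c: "c \<in> ?D \<delta>" for \<alpha> \<delta> a c
  proof -
    have cc: "c \<in> carrier ?F" using c by (simp add: free_grading_def)
    have ac: "a \<in> carrier R" using RD.part_carrier[OF a \<alpha>] .
    have "\<gamma> \<otimes>\<^bsub>G\<^esub> d x = \<alpha> \<otimes>\<^bsub>G\<^esub> \<delta>"
      if \<gamma>: "\<gamma> \<in> carrier G" and nz: "RD.cmp (a \<otimes>\<^bsub>R\<^esub> c x) \<gamma> \<noteq> \<zero>\<^bsub>R\<^esub>" for x \<gamma>
    proof -
      obtain \<beta> where \<beta>: "\<beta> \<in> carrier G" "\<gamma> = \<alpha> \<otimes>\<^bsub>G\<^esub> \<beta>"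
        using component_mult_left(2)[OF a \<alpha> cR[OF cc] \<gamma>] nz by blast
      have "RD.cmp (c x) \<beta> \<noteq> \<zero>\<^bsub>R\<^esub>"
        using component_mult_left(1)[OF a \<alpha> cR[OF cc] \<beta>(1)] nz \<beta>(2) ac by auto
      then have "\<beta> \<otimes>\<^bsub>G\<^esub> d x = \<delta>" using c \<beta>(1) by (auto simp: free_grading_def)
      \<comment> \<open>The associativity used next needs d(x) in \<Gamma>, which is known only for
        indices in \<open>B\<close>; elsewhere the coefficient is zero.\<close>
      moreover have "x \<in> B"
      proof (rule ccontr)
        assume "x \<notin> B"
        then have "c x = \<zero>\<^bsub>R\<^esub>" using cc by (auto simp: free_module_carrier)
        then show False using nz ac \<gamma> by simp
      qed
      ultimately show ?thesis using d \<alpha> \<beta> by (auto simp: G.m_assoc)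
    qed
    then show ?thesis using F.smult_closed[OF ac cc] by (simp add: free_grading_def)
  qed
  ultimately show ?thesis
    by (intro graded_module.intro graded_module_axioms.intro graded_ring_axioms F.left_module_axioms)
qed

end

text \<open>In a vector of degree \<delta> the coefficient at i has components only in degrees
  \<gamma> with \<gamma>d(i) = \<delta>, so its product with an element of degree d(i) lies in
  degree \<delta>.\<close>

lemma (in cancel_graded_module) free_eval_graded:
  assumes d: "\<And>i. i \<in> B \<Longrightarrow> d i \<in> carrier G" and x: "\<And>i. i \<in> B \<Longrightarrow> x i \<in> \<M> (d i)"
  shows "free_eval R M x \<in> graded_hom G R (free_module R B) (free_grading G R \<A> B d) M \<M>"
proof -
  have xc: "x i \<in> carrier M" if "i \<in> B" for i using MD.part_carrier[OF x d] that by blast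
  have "free_eval R M x c \<in> \<M> \<delta>" if \<delta>: "\<delta> \<in> carrier G" and c: "c \<in> free_grading G R \<A> B d \<delta>" for \<delta> c
    unfolding free_eval_def
  proof (rule M.finsum_mem_subgroup[OF MD.part_subgroup[OF \<delta>]])
    have c': "finite {x. c x \<noteq> \<zero>\<^bsub>R\<^esub>}" "{x. c x \<noteq> \<zero>\<^bsub>R\<^esub>} \<subseteq> B" "\<And>x. c x \<in> carrier R"
      using c by (auto simp: free_grading_def free_module_carrier)
    then show "finite {x. c x \<noteq> \<zero>\<^bsub>R\<^esub>}" by blast
    fix i assume "i \<in> {x. c x \<noteq> \<zero>\<^bsub>R\<^esub>}"
    then have i: "i \<in> B" using c' by blast
    have "MD.cmp (c i \<odot>\<^bsub>M\<^esub> x i) \<delta>' = \<zero>\<^bsub>M\<^esub>" if \<delta>': "\<delta>' \<in> carrier G" "\<delta>' \<noteq> \<delta>" for \<delta>'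
    proof (cases "\<delta>' \<in> (\<lambda>\<gamma>. \<gamma> \<otimes>\<^bsub>G\<^esub> d i) ` carrier G")
      case True
      then obtain \<gamma> where \<gamma>: "\<gamma> \<in> carrier G" "\<delta>' = \<gamma> \<otimes>\<^bsub>G\<^esub> d i" by blast
      then have "RD.cmp (c i) \<gamma> = \<zero>\<^bsub>R\<^esub>" using c \<delta>'(2) by (auto simp: free_grading_def)
      then show ?thesis
        using component_smult_right(1)[OF x[OF i] d[OF i] c'(3) \<gamma>(1)] \<gamma>(2) xc[OF i] by simp
    next
      case False
      then show ?thesis using component_smult_right(2)[OF x[OF i] d[OF i] c'(3) \<delta>'(1)] by blast
    qed
    then show "c i \<odot>\<^bsub>M\<^esub> x i \<in> \<M> \<delta>" using MD.part_iff[OF _ \<delta>] c'(3) xc[OF i] by blast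
  qed
  moreover have "free_eval R M x \<in> mod_hom R (free_module R B) M"
    using left_module_axioms xc by (rule free_eval_mod_hom)
  ultimately show ?thesis by (auto simp: graded_hom_def)
qed


section \<open>Existence of projective covers\<close>

context local_graded_module
begin

text \<open>A homogeneous generating set of least cardinality is taken: a generator in the span of
  the others could be dropped. It is indexed by natural numbers so that the free module lives on the
  type \<open>nat \<Rightarrow> 'a\<close>.\<close>

lemma irredundant_homogeneous_generators:
  assumes "fin_gen_module R M"
  obtains n :: nat and x d where "\<And>i. i < n \<Longrightarrow> d i \<in> carrier G" "\<And>i. i < n \<Longrightarrow> x i \<in> \<M> (d i)"
    "x ` {..<n} \<subseteq> homogeneous G M \<M>" "submodule_gen R M (x ` {..<n}) = carrier M"
    "\<And>i. i < n \<Longrightarrow> x i \<notin> submodule_gen R M (x ` ({..<n} - {i}))"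
proof -
  let ?Q = "\<lambda>X. finite X \<and> X \<subseteq> homogeneous G M \<M> \<and> submodule_gen R M X = carrier M"
  have "\<exists>Y. ?Q Y" by (rule homogeneous_generators[OF assms]) blast
  then obtain Y where "?Q Y" by blast
  from ex_has_least_nat[of ?Q Y card, OF this]
  obtain X where X: "?Q X" and min: "\<And>Y. ?Q Y \<Longrightarrow> card X \<le> card Y" by blast
  obtain x where bij: "bij_betw x {..<card X} X"
    using X ex_bij_betw_nat_finite[of X] by (auto simp: atLeast0LessThan)
  then have im: "x ` {..<card X} = X" and inj: "inj_on x {..<card X}" by (auto simp: bij_betw_def)
  have "\<forall>y\<in>X. \<exists>\<gamma>\<in>carrier G. y \<in> \<M> \<gamma>" using X by (auto simp: homogeneous_def)
  then have "\<forall>i\<in>{..<card X}. \<exists>\<gamma>\<in>carrier G. x i \<in> \<M> \<gamma>" using im by blast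
  then obtain d where d: "\<And>i. i < card X \<Longrightarrow> d i \<in> carrier G" "\<And>i. i < card X \<Longrightarrow> x i \<in> \<M> (d i)"
    by (metis lessThan_iff)
  have Xc: "X \<subseteq> carrier M" using X MD.part_carrier by (auto simp: homogeneous_def)
  have "x i \<notin> submodule_gen R M (x ` ({..<card X} - {i}))" if i: "i < card X" for i
  proof
    \<comment> \<open>By injectivity of the enumeration, deleting the index \<open>i\<close> removes
      just the element \<open>x i\<close>.\<close>
    have eq: "x ` ({..<card X} - {i}) = X - {x i}"
      using inj_on_image_set_diff[OF inj, of "{..<card X}" "{i}"] i im by auto
    assume "x i \<in> submodule_gen R M (x ` ({..<card X} - {i}))"
    then have "X \<subseteq> submodule_gen R M (X - {x i})"
      unfolding eq using submodule_gen_incl[of "X - {x i}"] by blast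
    moreover have "X - {x i} \<subseteq> carrier M" using Xc by blast
    ultimately have "submodule_gen R M (X - {x i}) = carrier M"
      using X submodule_gen_eq_carrierI[of X] by blast
    then have "card X \<le> card (X - {x i})" using X by (intro min) blast
    moreover have "x i \<in> X" using im i by blast
    ultimately show False using X by (metis card_Diff1_less not_le)
  qed
  moreover have "x ` {..<card X} \<subseteq> homogeneous G M \<M>" "submodule_gen R M (x ` {..<card X}) = carrier M"
    using X im by simp_all
  ultimately show ?thesis using d by (intro that[of "card X" d x])
qed

text \<open>The relation puts c_i x_i into the graded submodule generated by the other generators.
  By right cancelation its component in degree \<gamma>d(i) is (c_i)_\<gamma> x_i, so an invertible
  (c_i)_\<gamma> would put x_i there too, against irredundance.\<close>

lemma irredundant_kernel:
  assumes B: "finite B" and d: "\<And>i. i \<in> B \<Longrightarrow> d i \<in> carrier G" and x: "\<And>i. i \<in> B \<Longrightarrow> x i \<in> \<M> (d i)"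
    and hom: "x ` B \<subseteq> homogeneous G M \<M>"
    and irr: "\<And>i. i \<in> B \<Longrightarrow> x i \<notin> submodule_gen R M (x ` (B - {i}))"
    and c: "c \<in> carrier (free_module R B)" "free_eval R M x c = \<zero>\<^bsub>M\<^esub>"
  shows "c i \<in> nonunit_ideal"
proof (cases "i \<in> B")
  case False
  then have "c i = \<zero>\<^bsub>R\<^esub>" using c(1) by (auto simp: free_module_carrier)
  then show ?thesis using additive_subgroup.zero_closed[OF nonunit_ideal_subgroup] by simp
next
  case i: True
  have cR: "\<And>j. c j \<in> carrier R" using c(1) by (simp add: free_module_carrier)
  have xc: "x j \<in> carrier M" if "j \<in> B" for j using MD.part_carrier[OF x d] that by blast
  let ?N = "submodule_gen R M (x ` (B - {i}))"
  have "graded_submodule G R M \<M> ?N"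
    unfolding graded_submodule_def using hom by (intro exI[of _ "x ` (B - {i})"]) auto
  then have N: "submodule ?N R M" and Ncmp: "\<And>y \<gamma>. y \<in> ?N \<Longrightarrow> \<gamma> \<in> carrier G \<Longrightarrow> MD.cmp y \<gamma> \<in> ?N"
    by (auto simp: graded_submodule_iff)
  have Nsub: "additive_subgroup ?N M" using N by (rule submodule_additive_subgroup)
  let ?s = "finsum M (\<lambda>j. c j \<odot>\<^bsub>M\<^esub> x j) (B - {i})"
  have s: "?s \<in> ?N"
  proof (rule M.finsum_mem_subgroup[OF Nsub])
    fix j assume "j \<in> B - {i}"
    then have "x j \<in> ?N" using submodule_gen_incl[of "x ` (B - {i})"] by blast
    then show "c j \<odot>\<^bsub>M\<^esub> x j \<in> ?N" by (rule submodule_smult[OF N cR])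
  qed (use B in simp)
  have "free_eval R M x c = finsum M (\<lambda>j. c j \<odot>\<^bsub>M\<^esub> x j) B"
    by (rule free_eval_superset[OF left_module_axioms, of B])
      (use xc cR B c(1) in \<open>auto simp: free_module_carrier\<close>)
  also have "\<dots> = finsum M (\<lambda>j. c j \<odot>\<^bsub>M\<^esub> x j) (insert i (B - {i}))" using i by (simp add: insert_absorb)
  also have "\<dots> = c i \<odot>\<^bsub>M\<^esub> x i \<oplus>\<^bsub>M\<^esub> ?s"
    using B cR xc i by (intro M.finsum_insert) auto
  finally have "c i \<odot>\<^bsub>M\<^esub> x i \<oplus>\<^bsub>M\<^esub> ?s = \<zero>\<^bsub>M\<^esub>" using c(2) by simp
  then have "c i \<odot>\<^bsub>M\<^esub> x i = \<ominus>\<^bsub>M\<^esub> ?s"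
    using additive_subgroup.a_Hcarr[OF Nsub s] cR xc[OF i] M.minus_equality by auto
  then have mem: "c i \<odot>\<^bsub>M\<^esub> x i \<in> ?N" using additive_subgroup.a_inv_closed[OF Nsub s] by simp
  have "RD.cmp (c i) \<gamma> \<notin> Units R" if \<gamma>: "\<gamma> \<in> carrier G" for \<gamma>
  proof
    let ?u = "RD.cmp (c i) \<gamma>"
    assume u: "?u \<in> Units R"
    have "MD.cmp (c i \<odot>\<^bsub>M\<^esub> x i) (\<gamma> \<otimes>\<^bsub>G\<^esub> d i) \<in> ?N" using \<gamma> d[OF i] by (intro Ncmp[OF mem]) blast
    then have "?u \<odot>\<^bsub>M\<^esub> x i \<in> ?N" using component_smult_right(1)[OF x[OF i] d[OF i] cR \<gamma>] by simp
    then have "inv\<^bsub>R\<^esub> ?u \<odot>\<^bsub>M\<^esub> (?u \<odot>\<^bsub>M\<^esub> x i) \<in> ?N"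
      by (rule submodule_smult[OF N R.Units_inv_closed[OF u]])
    moreover have "inv\<^bsub>R\<^esub> ?u \<odot>\<^bsub>M\<^esub> (?u \<odot>\<^bsub>M\<^esub> x i) = x i"
      using smult_assoc[OF R.Units_inv_closed[OF u] R.Units_closed[OF u] xc[OF i]] u xc[OF i] by simp
    ultimately show False using irr[OF i] by simp
  qed
  then show ?thesis using cR by (simp add: nonunit_ideal_def)
qed

text \<open>The expansion in unit vectors displays \<open>c\<close> as a sum of multiples by
  elements of the ideal.\<close>

lemma free_module_ideal_smult:
  assumes "\<And>i. c i \<in> nonunit_ideal" and c: "c \<in> carrier (free_module R B)"
  shows "c \<in> ideal_smult R nonunit_ideal (free_module R B)"
proof -
  let ?F = "free_module R B"
  interpret F: left_module R ?F using R.ring_axioms by (rule free_module_left_module)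
  let ?S = "{a \<odot>\<^bsub>?F\<^esub> y | a y. a \<in> nonunit_ideal \<and> y \<in> carrier ?F}"
  have "?S \<subseteq> carrier ?F" using F.smult_closed additive_subgroup.a_Hcarr[OF nonunit_ideal_subgroup] by blast
  note N = F.submodule_gen_submodule[OF this]
  have S: "finite {x. c x \<noteq> \<zero>\<^bsub>R\<^esub>}" "{x. c x \<noteq> \<zero>\<^bsub>R\<^esub>} \<subseteq> B" using c by (auto simp: free_module_carrier)
  have "finsum ?F (\<lambda>x. c x \<odot>\<^bsub>?F\<^esub> unit_vector R x) {x. c x \<noteq> \<zero>\<^bsub>R\<^esub>} \<in> submodule_gen R ?F ?S"
  proof (rule F.M.finsum_mem_subgroup[OF F.submodule_additive_subgroup[OF N] S(1)])
    fix x assume "x \<in> {x. c x \<noteq> \<zero>\<^bsub>R\<^esub>}"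
    then have "unit_vector R x \<in> carrier ?F" using S(2) by (intro unit_vector_closed R.ring_axioms) blast
    then show "c x \<odot>\<^bsub>?F\<^esub> unit_vector R x \<in> submodule_gen R ?F ?S"
      using assms(1) F.submodule_gen_incl[of ?S] by blast
  qed
  then show ?thesis using free_module_expansion[OF R.ring_axioms c] by (simp add: ideal_smult_def)
qed

text \<open>Superfluity of the maximal graded ideal times a module is used for the free module
  instead of \<open>M\<close>. The kernel lies inside that submodule and inherits superfluity from
  it.\<close>

theorem gr_projective_cover_exists:
  assumes "fin_gen_module R M"
  shows "\<exists>(P :: ('a, nat \<Rightarrow> 'a) module) \<P> \<epsilon>. gr_projective_cover G R \<A> M \<M> P \<P> \<epsilon>"
proof -
  obtain n :: nat and x d where d: "\<And>i. i < n \<Longrightarrow> d i \<in> carrier G" and x: "\<And>i. i < n \<Longrightarrow> x i \<in> \<M> (d i)"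
    and hom: "x ` {..<n} \<subseteq> homogeneous G M \<M>" and gen: "submodule_gen R M (x ` {..<n}) = carrier M"
    and irr: "\<And>i. i < n \<Longrightarrow> x i \<notin> submodule_gen R M (x ` ({..<n} - {i}))"
    by (rule irredundant_homogeneous_generators[OF assms]) blast
  let ?P = "free_module R {..<n}"
  let ?\<P> = "free_grading G R \<A> {..<n} d"
  let ?e = "free_eval R M x"
  have gP: "graded_module G R \<A> ?P ?\<P>" by (rule free_module_graded) (use d in simp)
  interpret P: graded_module G R \<A> ?P ?\<P> by (rule gP)
  interpret P: local_graded_module G R \<A> ?P ?\<P> ..
  have e: "?e \<in> graded_hom G R ?P ?\<P> M \<M>" by (rule free_eval_graded) (use d x in auto)
  have em: "?e \<in> mod_hom R ?P M" using e by (simp add: graded_hom_def)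
  have xc: "x i \<in> carrier M" if "i < n" for i using MD.part_carrier[OF x d] that by blast
  have im: "submodule (?e ` carrier ?P) R M"
    using graded_hom_image[OF P.cancel_graded_module_axioms cancel_graded_module_axioms e]
    by (simp add: graded_submodule_iff)
  have "x i \<in> ?e ` carrier ?P" if "i < n" for i
  proof -
    have "?e (unit_vector R i) = x i"
      using that xc by (intro free_eval_unit_vector[OF left_module_axioms, of _ "{..<n}"]) auto
    moreover have "unit_vector R i \<in> carrier ?P"
      using that by (intro unit_vector_closed R.ring_axioms) simp
    ultimately show ?thesis by (metis imageI)
  qed
  then have "submodule_gen R M (x ` {..<n}) \<subseteq> ?e ` carrier ?P"
    by (intro submodule_gen_least[OF im]) auto
  then have onto: "?e ` carrier ?P = carrier M" using gen mod_homD(1)[OF em] by blast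
  have ker: "a_kernel ?P M ?e \<subseteq> ideal_smult R nonunit_ideal ?P"
  proof
    fix c assume "c \<in> a_kernel ?P M ?e"
    then have c: "c \<in> carrier ?P" "?e c = \<zero>\<^bsub>M\<^esub>" by (auto simp: mem_a_kernel)
    have "c i \<in> nonunit_ideal" for i
      by (rule irredundant_kernel[OF _ _ _ hom _ c, of d]) (use d x irr in auto)
    then show "c \<in> ideal_smult R nonunit_ideal ?P" using c(1) by (rule free_module_ideal_smult)
  qed
  have MP: "gr_superfluous G R ?P ?\<P> (ideal_smult R nonunit_ideal ?P)"
    using P.ideal_smult_gr_superfluous[OF fin_gen_free_module[OF R.ring_axioms finite_lessThan]]
    by (simp add: max_graded_ideal_eq)
  have "H = carrier ?P"
    if H: "graded_submodule G R ?P ?\<P> H" "H <+>\<^bsub>?P\<^esub> a_kernel ?P M ?e = carrier ?P" for H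
  proof -
    \<comment> \<open>Enlarging the second summand from the kernel to the ideal multiple keeps the
      sum equal to the whole module.\<close>
    have "H <+>\<^bsub>?P\<^esub> a_kernel ?P M ?e \<subseteq> H <+>\<^bsub>?P\<^esub> ideal_smult R nonunit_ideal ?P"
      using ker unfolding subset_iff mem_set_add by blast
    moreover have "H \<subseteq> carrier ?P"
      using H(1) P.submodule_subset[of H] by (simp add: P.graded_submodule_iff)
    then have "H <+>\<^bsub>?P\<^esub> ideal_smult R nonunit_ideal ?P \<subseteq> carrier ?P"
      using P.submodule_subset[OF P.ideal_smult_submodule] P.M.a_closed
      unfolding subset_iff mem_set_add by blast
    ultimately have "H <+>\<^bsub>?P\<^esub> ideal_smult R nonunit_ideal ?P = carrier ?P" using H(2) by simp
    then show ?thesis using MP H(1) by (simp add: gr_superfluous_def)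
  qed
  then have "gr_superfluous G R ?P ?\<P> (a_kernel ?P M ?e)"
    using graded_hom_kernel[OF P.cancel_graded_module_axioms cancel_graded_module_axioms e]
    by (simp add: gr_superfluous_def)
  then have "gr_projective_cover G R \<A> M \<M> ?P ?\<P> ?e"
    using gP e onto projective_free_module[OF R.ring_axioms] by (simp add: gr_projective_cover_def)
  then show ?thesis by blast
qed

end

text \<open>Existence names the concrete type \<open>nat \<Rightarrow> 'a\<close>, while the
  compared covers live on the independent type variables \<open>'p\<close> and \<open>'q\<close>.
  Uniqueness thus holds across any two types, in particular against the cover whose existence is
  claimed.\<close>

theorem theorem5p2:
  fixes G :: "('g, 'h) monoid_scheme" and R :: "('a, 'r) ring_scheme" and \<A> :: "'g \<Rightarrow> 'a set"
    and M :: "('a, 'm, 's) module_scheme" and \<M> :: "'g \<Rightarrow> 'm set"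
  assumes "monoid_cancel G"
    and "graded_local_ring G R \<A>"
    and "graded_module G R \<A> M \<M>"
    and "fin_gen_module R M"
  shows "gr_superfluous G R M \<M> (ideal_smult R (max_graded_ideal G R \<A>) M) \<and>
    (\<exists>(P :: ('a, nat \<Rightarrow> 'a) module) \<P> \<epsilon>. gr_projective_cover G R \<A> M \<M> P \<P> \<epsilon>) \<and>
    (\<forall>(P\<^sub>1 :: ('a, 'p) module) \<P>\<^sub>1 \<epsilon>\<^sub>1 (P\<^sub>2 :: ('a, 'q) module) \<P>\<^sub>2 \<epsilon>\<^sub>2.
      gr_projective_cover G R \<A> M \<M> P\<^sub>1 \<P>\<^sub>1 \<epsilon>\<^sub>1 \<and> gr_projective_cover G R \<A> M \<M> P\<^sub>2 \<P>\<^sub>2 \<epsilon>\<^sub>2 \<longrightarrow>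
      gr_cover_isomorphic G R P\<^sub>1 \<P>\<^sub>1 \<epsilon>\<^sub>1 P\<^sub>2 \<P>\<^sub>2 \<epsilon>\<^sub>2)"
proof -
  interpret G: monoid_cancel G by fact
  interpret A: graded_local_ring G R \<A> by fact
  interpret M: graded_module G R \<A> M \<M> by fact
  interpret local_graded_module G R \<A> M \<M> ..
  show ?thesis
    using ideal_smult_gr_superfluous[OF assms(4)] gr_projective_cover_exists[OF assms(4)]
      gr_projective_cover_unique[OF assms(1,3)] by blast
qed

end
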